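(* Let $2\le \nu<5$ (equivalently $\gamma=1+\frac1\nu\in(\frac65,\frac32]$) and fix $R_0\ge 2\xi_1(\nu)$. Then there exist $\varepsilon_0>0$ and $C>0$ such that for each $0<\varepsilon\le\varepsilon_0$ there exists $\Theta=\Theta(\cdot,\cdot;\nu,\varepsilon)\in\mathfrak{E}$ satisfying $$\Theta(r,\zeta)=\varepsilon\,\mathfrak{g}(r,\zeta)+\mathcal{G}(\Theta)(r,\zeta)\qquad\text{for all }(r,\zeta)\in[0,R_0]\times[-1,1],$$ and moreover $\|\Theta-\theta\|_{\mathfrak{E}}\le C\varepsilon$.
   Context: For $1<\nu<5$, the Lane-Emden function $\theta=\theta(r;\nu)$ is the unique solution of $\theta''+\frac2r\theta'+\theta^\nu=0$ with $\theta=1+O(r^2)$ as $r\to0$, considered up to its first zero $\xi_1=\xi_1(\nu)\in(0,\infty)$ ($\theta>0$ and $\theta'<0$ on $(0,\xi_1)$). Put $\mu_1=\mu_1(\nu)=\int_0^{\xi_1}\theta^\nu r^2dr=-\xi_1^2\theta'(\xi_1)$, and extend $\theta$ to $[0,\infty)$ as a $C^2$ function by $\theta(r)=-\mu_1\left(\frac1{\xi_1}-\frac1r\right)$ for $r>\xi_1$. Coordinates on $\mathbb{R}^3$: $x=r\sqrt{1-\zeta^2}\cos\phi$, $y=r\sqrt{1-\zeta^2}\sin\phi$, $z=r\zeta$. $\mathfrak{E}$ is the space of all $u\in C([0,R_0]\times[-1,1])$ with $u(0,\zeta)=u(0,0)$ and $u(r,\zeta)=u(r,-\zeta)$ for all $r,\zeta$,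 with the norm $\|u\|_{\mathfrak{E}}=\sup|u|$; a function of $r$ alone is regarded as a function of $(r,\zeta)$. Write $u_\sharp=\max\{0,u\}$, $$K(r,\zeta,r',\zeta')=\int_0^{2\pi}\frac{d\beta}{\sqrt{r^2+r'^2-2rr'(\sqrt{1-\zeta^2}\sqrt{1-\zeta'^2}\cos\beta+\zeta\zeta')}},$$ $\mathfrak{g}(r,\zeta)=\frac14(1-\zeta^2)r^2$, and $$\mathcal{G}(u)(r,\zeta)=1+\frac1{4\pi}\int_{-1}^1\int_0^{R_0}K(r,\zeta,r',\zeta')u_\sharp(r',\zeta')^\nu r'^2dr'd\zeta'-\frac12\int_{-1}^1\int_0^{R_0}u_\sharp(r',\zeta')^\nu r'dr'd\zeta'.$$ *)

theory Defs
  imports "HOL-Analysis.Analysis" "HOL-Library.Landau_Symbols"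
begin

(* The equation is imposed only up to the first zero xi1; values of theta outside [0,xi1] are irrelevant, and theta 0 = 1 follows from the last clause
   together with continuity. *)
definition lane_emden :: "real \<Rightarrow> real \<Rightarrow> (real \<Rightarrow> real) \<Rightarrow> bool" where
  "lane_emden \<nu> \<xi>1 \<theta> \<longleftrightarrow>
     0 < \<xi>1 \<and>
     continuous_on {0..\<xi>1} \<theta> \<and>
     (\<forall>r\<in>{0<..<\<xi>1}. 0 < \<theta> r) \<and>
     \<theta> \<xi>1 = 0 \<and>
     (\<exists>\<theta>' \<theta>''. \<forall>r\<in>{0<..<\<xi>1}.
        (\<theta> has_real_derivative \<theta>' r) (at r) \<and>
        (\<theta>' has_real_derivative \<theta>'' r) (at r) \<and>
        \<theta>'' r + 2 / r * \<theta>' r + \<theta> r powr \<nu> = 0) \<and>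
     (\<lambda>r. \<theta> r - 1) \<in> O[at_right 0](\<lambda>r. r\<^sup>2)"

definition lane_emden_mass :: "real \<Rightarrow> real \<Rightarrow> (real \<Rightarrow> real) \<Rightarrow> real" where
  "lane_emden_mass \<nu> \<xi>1 \<theta> = (LBINT r:{0..\<xi>1}. \<theta> r powr \<nu> * r\<^sup>2)"

definition lane_emden_ext :: "real \<Rightarrow> real \<Rightarrow> (real \<Rightarrow> real) \<Rightarrow> real \<Rightarrow> real" where
  "lane_emden_ext \<nu> \<xi>1 \<theta> r =
     (if r \<le> \<xi>1 then \<theta> r else - lane_emden_mass \<nu> \<xi>1 \<theta> * (1 / \<xi>1 - 1 / r))"

(* Functions on [0,R0] x [-1,1] are total functions on pairs (r,zeta) of which only the
   restriction to the rectangle matters. *)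
definition rect :: "real \<Rightarrow> (real \<times> real) set" where
  "rect R0 = {0..R0} \<times> {-1..1}"

definition E_space :: "real \<Rightarrow> (real \<times> real \<Rightarrow> real) set" where
  "E_space R0 = {u. continuous_on (rect R0) u \<and>
     (\<forall>\<zeta>\<in>{-1..1}. u (0, \<zeta>) = u (0, 0)) \<and>
     (\<forall>(r, \<zeta>)\<in>rect R0. u (r, \<zeta>) = u (r, - \<zeta>))}"

(* The supremum is over a nonempty set bounded above when R0 >= 0 and u is in E_space R0. *)
definition E_norm :: "real \<Rightarrow> (real \<times> real \<Rightarrow> real) \<Rightarrow> real" where
  "E_norm R0 u = (SUP p\<in>rect R0. \<bar>u p\<bar>)"

(* Where the integral diverges, i.e. (r',zeta') = (r,zeta) or r = r' = 0, it takes a finite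
   value by convention (non-integrable functions have integral 0, and 1 / 0 = 0); for each
   (r,zeta) this affects only a null set of (r',zeta'). *)
definition K :: "real \<Rightarrow> real \<Rightarrow> real \<Rightarrow> real \<Rightarrow> real" where
  "K r \<zeta> r' \<zeta>' = (LBINT \<beta>:{0..2 * pi}.
     1 / sqrt (r\<^sup>2 + r'\<^sup>2
       - 2 * r * r' * (sqrt (1 - \<zeta>\<^sup>2) * sqrt (1 - \<zeta>'\<^sup>2) * cos \<beta> + \<zeta> * \<zeta>')))"

definition \<gg> :: "real \<times> real \<Rightarrow> real" where
  "\<gg> = (\<lambda>(r, \<zeta>). 1 / 4 * (1 - \<zeta>\<^sup>2) * r\<^sup>2)"

definition \<G> :: "real \<Rightarrow> real \<Rightarrow> (real \<times> real \<Rightarrow> real) \<Rightarrow> real \<times> real \<Rightarrow> real" where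
  "\<G> \<nu> R0 u = (\<lambda>(r, \<zeta>).
     1
     + 1 / (4 * pi) * (LBINT \<zeta>':{-1..1}. LBINT r':{0..R0}.
         K r \<zeta> r' \<zeta>' * max 0 (u (r', \<zeta>')) powr \<nu> * r'\<^sup>2)
     - 1 / 2 * (LBINT \<zeta>':{-1..1}. LBINT r':{0..R0}.
         max 0 (u (r', \<zeta>')) powr \<nu> * r'))"

end

theory Submission
  imports Defs "HOL-Complex_Analysis.Great_Picard"
begin

text \<open>
  In Cartesian coordinates the equation reads $u = \varepsilon g + 1 + N[u_\sharp^\nu]$ with
  $N[f](x) = \frac{1}{4\pi}\int f(y)\,(1/|x-y| - 1/|y|)\,dy$, and the Lane--Emden function solves it
  for $\varepsilon = 0$. Its linearisation is $h - Lh$ with $Lh = N[qh]$ and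
  $q = \nu\theta_\sharp^{\nu-1}$. Let $h = tLh$ with $0 \le t \le 1$ and $h(-x) = h(x)$. For a reflection
  $\sigma$ in a plane orthogonal to $n$, the function $g = h - h\circ\sigma$ is odd under $\sigma$, and on
  odd functions the potential has a positive kernel on the half space $x\cdot n > 0$, for which the
  weight $-\partial_n\theta$ is a positive eigenfunction with eigenvalue $1$. Since $g$ is even under
  $-1$ it changes sign on the half space unless it vanishes, so pairing with $q\,\partial_n\theta$ gives
  $g = 0$. Hence $h$ is radial, and by Newton's theorem it satisfies a Volterra equation, so $h = 0$.
  Compactness and the method of continuity in $t$ invert $1 - L$; because $\nu \ge 2$, the
  remainder is quadratically small in the supremum norm and a contraction in a ball of radius
  $C\varepsilon$ gives the solution.
\<close>

section \<open>Spherical coordinates on three-space\<close>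

text \<open>Evenness is indispensable: the derivatives of the profile in a fixed direction are fixed
  points of L, so 1 - L has a nontrivial kernel among odd functions. Symmetry about the axis
  together with symmetry in \<zeta> makes every admissible function even under -1. The same
  directional derivatives then serve as positive test functions on half spaces. Subtracting 1/|y| in
  the kernel forces Lh(0) = 0 and, for radial densities, cancels the contribution of all shells
  beyond |x|. A radial solution therefore starts from zero data at the centre and satisfies an
  equation of Volterra type. The problem is posed on all of three-space, where reflections and
  translations act without boundary terms. Since q vanishes outside the ball of radius \<xi>1,
  values on that ball control Lh in the supremum norm over the whole space. The method of continuity
  needs injectivity of 1 - tL for every t in [0,1]. The reflection argument is uniform in t because
  its strict inequality comes from the sign change of g, not from t < 1.\<close>

definition vec3 :: "real \<times> real \<times> real \<Rightarrow> real^3" where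
  "vec3 = (\<lambda>(a, b, c). vector [a, b, c])"

lemma vec3_nth [simp]: "vec3 (a, b, c) $ 1 = a" "vec3 (a, b, c) $ 2 = b" "vec3 (a, b, c) $ 3 = c"
  by (simp_all add: vec3_def)

lemma continuous_vec3: "continuous_on UNIV vec3"
proof -
  have "vec3 = (\<lambda>p. \<chi> i. if i = 1 then fst p else if i = 2 then fst (snd p) else snd (snd p))"
    by (auto simp: vec3_def vec_eq_iff forall_3 fun_eq_iff)
  moreover have "continuous_on UNIV (\<lambda>p :: real \<times> real \<times> real. \<chi> i::3. if i = 1 then fst p else if i = 2 then fst (snd p) else snd (snd p))"
  proof (intro continuous_on_vec_lambda)
    fix i :: 3
    show "continuous_on UNIV (\<lambda>p. if i = 1 then fst p else if i = 2 then fst (snd p) else snd (snd p :: real \<times> real))"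
      by (cases "i = 1"; cases "i = 2") (simp_all add: continuous_intros)
  qed
  ultimately show ?thesis by (simp only:)
qed

lemma measurable_vec3 [measurable]: "vec3 \<in> borel_measurable borel"
  using continuous_vec3 by (rule borel_measurable_continuous_onI)

text \<open>The Jacobian change of variables is available on \<open>real^3\<close>, Fubini on
  iterated products; this identification lets the two be combined.\<close>

lemma lborel_vec3: "(lborel :: (real^3) measure) = distr lborel borel vec3"
proof (rule lborel_eqI)
  fix l u :: "real^3" assume le: "\<And>b. b \<in> Basis \<Longrightarrow> l \<bullet> b \<le> u \<bullet> b"
  have le': "l $ i \<le> u $ i" for i
    using le[of "axis i 1"] by (simp add: inner_axis)
  have "vec3 -` box l u = {l$1<..<u$1} \<times> {l$2<..<u$2} \<times> {l$3<..<u$3}"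
    by (auto simp: mem_box_cart forall_3)
  then have "emeasure (distr lborel borel vec3) (box l u) =
    emeasure (lborel \<Otimes>\<^sub>M (lborel \<Otimes>\<^sub>M lborel)) ({l$1<..<u$1} \<times> {l$2<..<u$2} \<times> {l$3<..<u$3})"
    by (simp add: emeasure_distr lborel_prod)
  also have "\<dots> = ennreal (u$1 - l$1) * (ennreal (u$2 - l$2) * ennreal (u$3 - l$3))"
    using le' by (simp add: lborel.emeasure_pair_measure_Times lborel_prod[symmetric] lborel_pair.emeasure_pair_measure_Times)
  also have "\<dots> = ennreal (\<Prod>b\<in>Basis. (u - l) \<bullet> b)"
  proof -
    have "(\<Prod>b\<in>Basis. (u - l) \<bullet> b) = (\<Prod>i\<in>UNIV. (u - l) $ i)"
      by (subst Basis_vec_def)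
        (simp add: UNION_singleton_eq_range prod.reindex inj_def axis_eq_axis inner_axis)
    also have "\<dots> = (u$1 - l$1) * (u$2 - l$2) * (u$3 - l$3)"
      unfolding UNIV_3 by simp
    finally have eq: "(\<Prod>b\<in>Basis. (u - l) \<bullet> b) = (u$1 - l$1) * ((u$2 - l$2) * (u$3 - l$3))"
      by (simp only: mult.assoc)
    show ?thesis unfolding eq using le'[of 1] le'[of 2] le'[of 3] by (simp add: ennreal_mult)
  qed
  finally show "emeasure (distr lborel borel vec3) (box l u) = ennreal (\<Prod>b\<in>Basis. (u - l) \<bullet> b)" .
qed simp

lemma distr_orthogonal_lborel:
  fixes f :: "real^'n::{finite,wellorder} \<Rightarrow> real^'n::_"
  assumes f: "orthogonal_transformation f"
  shows "distr lborel borel f = lborel"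
proof (rule lborel_eqI[symmetric])
  let ?g = "inv f"
  have g: "orthogonal_transformation ?g" using f by (rule orthogonal_transformation_inv)
  have bij: "bij f" using f by (rule orthogonal_transformation_bij)
  have [measurable]: "f \<in> borel_measurable borel"
    by (intro borel_measurable_continuous_onI linear_continuous_on linear_conv_bounded_linear[THEN iffD1]
        orthogonal_transformation_linear f)
  fix l u :: "real^'n::{finite,wellorder}" assume le: "\<And>b. b \<in> Basis \<Longrightarrow> l \<bullet> b \<le> u \<bullet> b"
  have "emeasure (distr lborel borel f) (box l u) = emeasure lborel (f -` box l u)"
    by (simp add: emeasure_distr)
  also have "\<dots> = emeasure lebesgue (f -` box l u)"
  proof -
    have "f -` box l u \<in> sets lborel" using measurable_sets_borel[of f borel "box l u"] by simp
    then show ?thesis by simp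
  qed
  also have "f -` box l u = ?g ` box l u" using bij by (simp add: bij_vimage_eq_inv_image)
  also have "emeasure lebesgue (?g ` box l u) = measure lebesgue (?g ` box l u)"
    by (rule emeasure_eq_measure2, rule measurable_orthogonal_image[OF g lmeasurable_box])
  also have "\<dots> = measure lebesgue (box l u)"
    by (subst measure_orthogonal_image[OF g lmeasurable_box]) (rule refl)
  also have "\<dots> = ennreal (\<Prod>b\<in>Basis. (u - l) \<bullet> b)"
    using le by (simp add: measure_lborel_box_eq)
  finally show "emeasure (distr lborel borel f) (box l u) = ennreal (\<Prod>b\<in>Basis. (u - l) \<bullet> b)" .
qed simp

text \<open>The arguments are ordered \<zeta>, r, \<beta> so that Fubini produces the integrals in
  the nesting of \<open>\<G>\<close>, with the \<beta>-integral of \<open>K\<close>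
  innermost.\<close>

definition sph :: "real \<times> real \<times> real \<Rightarrow> real^3" where
  "sph = (\<lambda>(\<zeta>, r, \<beta>). vec3 (r * sqrt (1 - \<zeta>\<^sup>2) * cos \<beta>, r * sqrt (1 - \<zeta>\<^sup>2) * sin \<beta>, r * \<zeta>))"

lemma sph_nth [simp]:
  "sph (\<zeta>, r, \<beta>) $ 1 = r * sqrt (1 - \<zeta>\<^sup>2) * cos \<beta>"
  "sph (\<zeta>, r, \<beta>) $ 2 = r * sqrt (1 - \<zeta>\<^sup>2) * sin \<beta>"
  "sph (\<zeta>, r, \<beta>) $ 3 = r * \<zeta>"
  by (simp_all add: sph_def)

lemma continuous_sph: "continuous_on UNIV sph"
  unfolding sph_def case_prod_beta
  by (intro continuous_on_compose2[OF continuous_vec3] continuous_intros) auto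

lemma measurable_sph [measurable]: "sph \<in> borel_measurable borel"
  using continuous_sph by (rule borel_measurable_continuous_onI)

lemma norm_sph:
  assumes "\<zeta> \<in> {-1..1}" "0 \<le> r"
  shows "norm (sph (\<zeta>, r, \<beta>)) = r"
proof -
  have z: "\<zeta>\<^sup>2 \<le> 1" using assms by (auto simp: abs_square_le_1 abs_le_iff)
  have "(norm (sph (\<zeta>, r, \<beta>)))\<^sup>2 = (r * sqrt (1 - \<zeta>\<^sup>2) * cos \<beta>)\<^sup>2 + (r * sqrt (1 - \<zeta>\<^sup>2) * sin \<beta>)\<^sup>2 + (r * \<zeta>)\<^sup>2"
    unfolding power2_norm_eq_inner by (simp add: inner_vec_def sum_3 power2_eq_square)
  also have "\<dots> = r\<^sup>2 * ((1 - \<zeta>\<^sup>2) * ((cos \<beta>)\<^sup>2 + (sin \<beta>)\<^sup>2) + \<zeta>\<^sup>2)"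
    using z by (simp add: power_mult_distrib sin_squared_eq) (simp add: algebra_simps)
  also have "\<dots> = r\<^sup>2" by simp
  finally show ?thesis using assms by simp
qed

definition sph_box :: "(real \<times> real \<times> real) set" where
  "sph_box = {-1<..<1} \<times> {0<..} \<times> {0<..<2*pi}"

lemma sph_box_sets [measurable]: "sph_box \<in> sets borel"
  unfolding sph_box_def by (intro borel_open open_Times) auto

lemma inj_on_sph: "inj_on sph sph_box"
proof (rule inj_onI, clarsimp simp: sph_box_def)
  fix z r b z' r' b' :: real
  assume *: "sph (z, r, b) = sph (z', r', b')"
    and z: "- 1 < z" "z < 1" "- 1 < z'" "z' < 1" and r: "0 < r" "0 < r'"
    and b: "0 < b" "b < 2 * pi" "0 < b'" "b' < 2 * pi"
  have "norm (sph (z, r, b)) = norm (sph (z', r', b'))" using * by simp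
  then have rr: "r = r'" using z r by (simp add: norm_sph)
  have zz: "z = z'" using arg_cong[OF *, of "\<lambda>v. v $ 3"] rr r by simp
  have "z\<^sup>2 < 1" using z by (auto simp: abs_square_less_1 abs_less_iff)
  then have s: "sqrt (1 - z\<^sup>2) \<noteq> 0" by simp
  have "cos b = cos b'" "sin b = sin b'"
    using arg_cong[OF *, of "\<lambda>v. v $ 1"] arg_cong[OF *, of "\<lambda>v. v $ 2"] rr zz r s by auto
  then have "cis b = cis b'" by (simp add: complex_eq_iff)
  moreover have "Arg2pi (cis a) = a" if "0 < a" "a < 2 * pi" for a
    using that by (intro Arg2pi_unique[of 1]) (auto simp: cis_conv_exp)
  ultimately have "b = b'" using b by metis
  with rr zz show "z = z' \<and> r = r' \<and> b = b'" by simp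
qed

text \<open>If the second coordinate is nonzero, then |\<zeta>| < 1, the radius is positive and the
  azimuth avoids the cut at 0, so the spherical coordinates of the point lie in the open box. The
  exceptional set sits in a plane and is negligible.\<close>

lemma sph_image: "- (sph ` sph_box) \<subseteq> {x. x $ 2 = 0}"
proof (clarify, rule ccontr)
  fix x :: "real^3" assume x: "x \<notin> sph ` sph_box" and "x $ 2 \<noteq> 0"
  define r where "r = norm x"
  define z where "z = x $ 3 / r"
  define c where "c = Complex (x $ 1) (x $ 2)"
  define b where "b = Arg2pi c"
  have r2: "r\<^sup>2 = (x$1)\<^sup>2 + (x$2)\<^sup>2 + (x$3)\<^sup>2"
    unfolding r_def power2_norm_eq_inner by (simp add: inner_vec_def sum_3 power2_eq_square)
  have x2: "0 < (x$2)\<^sup>2" using \<open>x $ 2 \<noteq> 0\<close> by simp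
  have "(x$3)\<^sup>2 < r\<^sup>2" using r2 x2 by (smt (verit) zero_le_power2)
  moreover have r: "r > 0" using \<open>x $ 2 \<noteq> 0\<close> by (auto simp: r_def)
  ultimately have z2: "z\<^sup>2 < 1" by (simp add: z_def power_divide)
  then have z: "-1 < z" "z < 1" by (auto simp: abs_square_less_1 abs_less_iff)
  have im: "Im c \<noteq> 0" using \<open>x $ 2 \<noteq> 0\<close> by (simp add: c_def)
  have b: "0 < b" "b < 2 * pi"
  proof -
    have "b \<noteq> 0" using im by (auto simp: b_def Arg2pi_eq_0 complex_is_Real_iff)
    then show "0 < b" using Arg2pi_ge_0[of c] by (simp add: b_def)
    show "b < 2 * pi" by (simp add: b_def Arg2pi_lt_2pi)
  qed
  have nc: "norm c = r * sqrt (1 - z\<^sup>2)"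
  proof -
    have "(x$3)\<^sup>2 = r\<^sup>2 * z\<^sup>2" using r by (simp add: z_def power_divide)
    have "(norm c)\<^sup>2 = (x$1)\<^sup>2 + (x$2)\<^sup>2" by (simp add: c_def cmod_power2)
    also have "\<dots> = r\<^sup>2 * (1 - z\<^sup>2)" using r2 \<open>(x$3)\<^sup>2 = r\<^sup>2 * z\<^sup>2\<close> by (simp add: right_diff_distrib)
    also have "\<dots> = (r * sqrt (1 - z\<^sup>2))\<^sup>2" using z2 by (simp add: power_mult_distrib)
    finally show ?thesis using r z2 by (smt (verit) mult_nonneg_nonneg norm_ge_zero power2_eq_iff_nonneg real_sqrt_ge_zero)
  qed
  have "c = of_real (norm c) * cis b" unfolding b_def cis_conv_exp by (rule Arg2pi_eq)
  then have "Re c = Re (of_real (norm c) * cis b)" "Im c = Im (of_real (norm c) * cis b)" by metis+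
  then have "Re c = norm c * cos b" "Im c = norm c * sin b" by simp_all
  then have "sph (z, r, b) = x"
    using nc r by (simp add: vec_eq_iff forall_3 c_def) (simp add: z_def)
  with x z r b show False by (force simp: sph_box_def image_iff)
qed

text \<open>The Jacobian of \<open>sph\<close> at v = (\<zeta>, r, \<beta>), applied to h. The
  factor z / s comes from differentiating sqrt (1 - z^2), which is why the derivative is taken only
  for |z| < 1.\<close>

definition dsph :: "real^3 \<Rightarrow> real^3 \<Rightarrow> real^3" where
  "dsph v h = (let z = v $ 1; r = v $ 2; b = v $ 3; s = sqrt (1 - z\<^sup>2) in
     vector [ - r * z / s * cos b * h $ 1 + s * cos b * h $ 2 - r * s * sin b * h $ 3,
              - r * z / s * sin b * h $ 1 + s * sin b * h $ 2 + r * s * cos b * h $ 3,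
              r * h $ 1 + z * h $ 2])"

lemma has_derivative_sph:
  assumes z: "-1 < v $ 1" "v $ 1 < 1"
  shows "((\<lambda>v. sph (v $ 1, v $ 2, v $ 3)) has_derivative dsph v) (at v within S)"
proof -
  have "(v$1)\<^sup>2 < 1" using z by (auto simp: abs_square_less_1 abs_less_iff)
  then have p: "1 - (v$1)\<^sup>2 > 0" by simp
  define s where "s = sqrt (1 - (v$1)\<^sup>2)"
  have s: "s > 0" using p by (simp add: s_def)
  have nth: "((\<lambda>v. v $ i) has_derivative (\<lambda>h. h $ i)) (at v within S)" for i :: 3
    by (intro bounded_linear_imp_has_derivative bounded_linear_vec_nth)
  have sq: "((\<lambda>v. sqrt (1 - (v$1)\<^sup>2)) has_derivative (\<lambda>h. - (v$1 / s) * h$1)) (at v within S)"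
  proof -
    have "((\<lambda>v. (v$1)\<^sup>2) has_derivative (\<lambda>h. 2 * v$1 * h$1)) (at v within S)"
      unfolding power2_eq_square
      by (rule has_derivative_eq_rhs[OF has_derivative_mult[OF nth nth]]) (auto simp: fun_eq_iff)
    from has_derivative_diff[OF has_derivative_const[of 1] this]
    have "((\<lambda>v. 1 - (v$1)\<^sup>2) has_derivative (\<lambda>h. - 2 * v$1 * h$1)) (at v within S)" by simp
    from has_derivative_real_sqrt[OF p this] show ?thesis
      by (rule has_derivative_eq_rhs) (use s in \<open>auto simp: s_def fun_eq_iff field_simps\<close>)
  qed
  have cs: "((\<lambda>v. cos (v$3)) has_derivative (\<lambda>h. - sin (v$3) * h$3)) (at v within S)"
    by (rule has_derivative_eq_rhs[OF has_derivative_cos[OF nth]]) (auto simp: fun_eq_iff)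
  have sn: "((\<lambda>v. sin (v$3)) has_derivative (\<lambda>h. cos (v$3) * h$3)) (at v within S)"
    by (rule has_derivative_eq_rhs[OF has_derivative_sin[OF nth]]) (auto simp: fun_eq_iff)
  note rsq = has_derivative_mult[OF nth[of 2] sq]
  show ?thesis
  proof (rule has_derivative_componentwise_within[THEN iffD2], rule ballI)
    fix e :: "real^3" assume "e \<in> Basis"
    then obtain i where e: "e = axis i 1" by (auto simp: Basis_vec_def)
    have ie: "x \<bullet> e = x $ i" for x by (simp add: e inner_axis)
    consider "i = 1" | "i = 2" | "i = 3" using exhaust_3 by blast
    then show "((\<lambda>x. sph (x $ 1, x $ 2, x $ 3) \<bullet> e) has_derivative (\<lambda>x. dsph v x \<bullet> e)) (at v within S)"
    proof cases
      case 1
      show ?thesis unfolding ie 1 sph_nth dsph_def Let_def vector_3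
        by (rule has_derivative_eq_rhs[OF has_derivative_mult[OF rsq cs]]) (auto simp: algebra_simps s_def)
    next
      case 2
      show ?thesis unfolding ie 2 sph_nth dsph_def Let_def vector_3
        by (rule has_derivative_eq_rhs[OF has_derivative_mult[OF rsq sn]]) (auto simp: algebra_simps s_def)
    next
      case 3
      show ?thesis unfolding ie 3 sph_nth dsph_def Let_def vector_3
        by (rule has_derivative_eq_rhs[OF has_derivative_mult[OF nth[of 2] nth[of 1]]])
           (auto simp: fun_eq_iff algebra_simps)
    qed
  qed
qed

text \<open>Using \<zeta>, the cosine of the polar angle, as coordinate absorbs the usual sine
  factor: the powers of s cancel and r^2 alone remains.\<close>

lemma det_dsph:
  assumes z: "-1 < v $ 1" "v $ 1 < 1"
  shows "\<bar>det (matrix (dsph v))\<bar> = (v $ 2)\<^sup>2"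
proof -
  have "(v$1)\<^sup>2 < 1" using z by (auto simp: abs_square_less_1 abs_less_iff)
  define s where "s = sqrt (1 - (v$1)\<^sup>2)"
  have s: "s > 0" "s\<^sup>2 = 1 - (v$1)\<^sup>2" using \<open>(v$1)\<^sup>2 < 1\<close> by (auto simp: s_def)
  define C S where "C = cos (v $ 3)" and "S = sin (v $ 3)"
  have CS: "C\<^sup>2 + S\<^sup>2 = 1" by (simp add: C_def S_def)
  let ?z = "v $ 1" and ?r = "v $ 2"
  have "det (matrix (dsph v)) =
     (s * C) * (?r * s * C) * ?r + (- (?r * s * S)) * (- (?r * ?z / s * S)) * ?z
     - (- (?r * ?z / s * C)) * (?r * s * C) * ?z - (- (?r * s * S)) * (s * S) * ?r"
    by (simp add: det_3 matrix_def dsph_def Let_def axis_def flip: s_def C_def S_def)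
  also have "\<dots> = ?r\<^sup>2 * (C\<^sup>2 + S\<^sup>2) * (?z\<^sup>2 + s\<^sup>2)"
    using s(1) by (simp add: power2_eq_square) (simp add: algebra_simps)
  also have "\<dots> = ?r\<^sup>2" using CS s by simp
  finally show ?thesis by simp
qed

text \<open>Boxes determine Lebesgue measure. For a box, the injective change of variables on its
  coordinate preimage gives the integral of r^2, and the image misses only a negligible part of the
  box.\<close>

lemma lborel_spherical:
  "(lborel :: (real^3) measure) =
    distr (density lborel (\<lambda>(\<zeta>, r, \<beta>). ennreal (indicator sph_box (\<zeta>, r, \<beta>) * r\<^sup>2))) borel sph"
proof (rule lborel_eqI)
  fix l u :: "real^3" assume le: "\<And>b. b \<in> Basis \<Longrightarrow> l \<bullet> b \<le> u \<bullet> b"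
  let ?A = "box l u"
  let ?G = "\<lambda>v::real^3. sph (v $ 1, v $ 2, v $ 3)"
  define T where "T = {v::real^3. (v $ 1, v $ 2, v $ 3) \<in> sph_box}"
  define S where "S = {v \<in> T. ?G v \<in> ?A}"
  have [measurable]: "(\<lambda>v::real^3. (v $ 1, v $ 2, v $ 3)) \<in> borel_measurable borel"
    by (intro borel_measurable_continuous_onI continuous_intros)
  have S_sets [measurable]: "S \<in> sets borel"
  proof -
    have "S = (\<lambda>v::real^3. (v $ 1, v $ 2, v $ 3)) -` (sph_box \<inter> sph -` ?A)"
      by (auto simp: S_def T_def)
    also have "\<dots> \<in> sets borel"
      by (intro measurable_sets_borel[of _ borel] sets.Int sph_box_sets measurable_sph) auto
    finally show ?thesis .
  qed
  have inj: "inj_on ?G S"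
  proof (rule inj_onI)
    fix v w assume "v \<in> S" "w \<in> S" "?G v = ?G w"
    then show "v = w"
      using inj_onD[OF inj_on_sph, of "(v $ 1, v $ 2, v $ 3)" "(w $ 1, w $ 2, w $ 3)"]
      by (simp add: S_def T_def vec_eq_iff forall_3)
  qed
  have GT: "?G ` T = sph ` sph_box"
  proof -
    have "(\<lambda>v::real^3. (v $ 1, v $ 2, v $ 3)) ` T = sph_box"
    proof (rule set_eqI)
      fix p :: "real \<times> real \<times> real"
      obtain a b c where "p = (a, b, c)" by (cases p)
      then have "p = (vec3 p $ 1, vec3 p $ 2, vec3 p $ 3)" by simp
      then show "p \<in> (\<lambda>v::real^3. (v $ 1, v $ 2, v $ 3)) ` T \<longleftrightarrow> p \<in> sph_box"
        unfolding T_def by (metis (mono_tags, lifting) image_iff mem_Collect_eq)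
    qed
    then have "sph ` ((\<lambda>v::real^3. (v $ 1, v $ 2, v $ 3)) ` T) = sph ` sph_box" by (simp only:)
    then show ?thesis by (simp add: image_image)
  qed
  have GS: "?G ` S = ?A \<inter> ?G ` T" by (auto simp: S_def)
  have "?A - ?G ` S \<subseteq> {x. x $ 2 = 0}" unfolding GS GT using sph_image by blast
  then have neg: "negligible (?A - ?G ` S)"
    by (rule negligible_subset[OF negligible_standard_hyperplane_cart])
  have "sym_diff ?A (?G ` S) = ?A - ?G ` S" unfolding GS by blast
  with neg have "negligible (sym_diff ?A (?G ` S))" by (simp only:)
  from lmeasurable_negligible_symdiff[OF lmeasurable_box this] measure_negligible_symdiff[OF lmeasurable_box this]
  have GSm: "?G ` S \<in> lmeasurable \<and> measure lebesgue (?G ` S) = measure lebesgue ?A" by blast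
  have rng: "- 1 < v $ 1" "v $ 1 < 1" if "v \<in> S" for v using that by (auto simp: S_def T_def sph_box_def)
  have "((\<lambda>v. \<bar>det (matrix (dsph v))\<bar>) has_integral measure lebesgue ?A) S"
  proof (rule iffD1[OF has_measure_differentiable_image GSm])
    show "S \<in> sets lebesgue" using S_sets by simp
    show "inj_on ?G S" by (rule inj)
    show "(?G has_derivative dsph v) (at v within S)" if "v \<in> S" for v
      by (intro has_derivative_sph rng that)
  qed
  then have hi: "((\<lambda>v. (v $ 2)\<^sup>2) has_integral measure lebesgue ?A) S"
    by (rule has_integral_eq[rotated]) (use det_dsph rng in auto)
  have 1: "(\<integral>\<^sup>+v. ennreal (indicator S v * (v $ 2)\<^sup>2) \<partial>lborel) = measure lebesgue ?A"
    by (rule nn_integral_has_integral_lebesgue[OF _ hi]) auto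
  let ?w = "\<lambda>p::real\<times>real\<times>real. ennreal (indicator sph_box p * (fst (snd p))\<^sup>2)"
  have [measurable]: "(\<lambda>p. fst (snd p)) \<in> borel_measurable (borel :: (real \<times> real \<times> real) measure)"
    by (intro borel_measurable_continuous_onI continuous_intros)
  have [measurable]: "?w \<in> borel_measurable borel" by measurable
  have sphA: "sph -` ?A \<in> sets borel" by (rule measurable_sets_borel[OF measurable_sph]) auto
  have "emeasure (distr (density lborel ?w) borel sph) ?A = (\<integral>\<^sup>+p. ?w p * indicator (sph -` ?A) p \<partial>lborel)"
    using sphA by (simp add: emeasure_distr emeasure_density)
  also have "\<dots> = (\<integral>\<^sup>+p. ennreal (indicator S (vec3 p) * (vec3 p $ 2)\<^sup>2) \<partial>lborel)"
  proof (rule nn_integral_cong)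
    fix p :: "real \<times> real \<times> real"
    obtain a b c where p: "p = (a, b, c)" by (cases p)
    have "vec3 p \<in> S \<longleftrightarrow> p \<in> sph_box \<and> p \<in> sph -` ?A" by (simp add: S_def T_def p)
    then show "?w p * indicator (sph -` ?A) p = ennreal (indicator S (vec3 p) * (vec3 p $ 2)\<^sup>2)"
      by (simp add: p indicator_def)
  qed
  also have "\<dots> = (\<integral>\<^sup>+v. ennreal (indicator S v * (v $ 2)\<^sup>2) \<partial>(distr lborel borel vec3))"
    by (rule nn_integral_distr[symmetric]) measurable
  also have "\<dots> = measure lebesgue ?A" unfolding lborel_vec3[symmetric] by (rule 1)
  also have "\<dots> = ennreal (\<Prod>b\<in>Basis. (u - l) \<bullet> b)" using le by (simp add: measure_lborel_box_eq)
  finally show "emeasure (distr (density lborel (\<lambda>(\<zeta>, r, \<beta>). ennreal (indicator sph_box (\<zeta>, r, \<beta>) * r\<^sup>2))) borel sph) ?A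
     = ennreal (\<Prod>b\<in>Basis. (u - l) \<bullet> b)" by (simp only: case_prod_beta' prod.collapse)
qed simp

definition sph_cbox :: "(real \<times> real \<times> real) set" where
  "sph_cbox = {-1..1} \<times> {0..} \<times> {0..2*pi}"

lemma sph_cbox_sets [measurable]: "sph_cbox \<in> sets borel"
  unfolding sph_cbox_def by (intro borel_closed closed_Times) auto

lemma measurable_triple [measurable]:
  "(\<lambda>p. fst p) \<in> borel_measurable (borel :: (real \<times> real \<times> real) measure)"
  "(\<lambda>p. fst (snd p)) \<in> borel_measurable (borel :: (real \<times> real \<times> real) measure)"
  "(\<lambda>p. snd (snd p)) \<in> borel_measurable (borel :: (real \<times> real \<times> real) measure)"
  by (intro borel_measurable_continuous_onI continuous_intros)+

abbreviation sph_weight :: "real \<times> real \<times> real \<Rightarrow> real" where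
  "sph_weight p \<equiv> indicator sph_cbox p * (fst (snd p))\<^sup>2"

text \<open>\<open>K\<close> and \<open>\<G>\<close> integrate over closed intervals. The closed and
  the open coordinate box differ, where r is nonnegative, by faces that are null sets.\<close>

lemma lborel_spherical_closed:
  "(lborel :: (real^3) measure) = distr (density lborel (\<lambda>p. ennreal (sph_weight p))) borel sph"
proof -
  have n2': "{b} \<times> (UNIV :: real set) \<in> null_sets lborel" for b :: real
    unfolding lborel_prod[symmetric]
    by (intro null_setsI pair_measureI) (auto simp: lborel.emeasure_pair_measure_Times)
  have n3': "(UNIV :: real set) \<times> {b} \<in> null_sets lborel" for b :: real
    unfolding lborel_prod[symmetric]
    by (intro null_setsI pair_measureI) (auto simp: lborel.emeasure_pair_measure_Times)
  have n23: "(UNIV :: real set) \<times> N \<in> null_sets lborel" if "N \<in> null_sets lborel" for N :: "(real \<times> real) set"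
  proof -
    have "(UNIV :: real set) \<times> N \<in> null_sets (lborel \<Otimes>\<^sub>M lborel)"
      using null_setsD1[OF that] null_setsD2[OF that]
      by (intro null_setsI pair_measureI) (auto simp: lborel.emeasure_pair_measure_Times)
    then show ?thesis by (simp add: lborel_prod)
  qed
  have n1: "{a} \<times> (UNIV :: (real \<times> real) set) \<in> null_sets lborel" for a :: real
  proof -
    have "{a} \<times> (UNIV :: (real \<times> real) set) \<in> null_sets (lborel \<Otimes>\<^sub>M lborel)"
      by (intro null_setsI pair_measureI) (auto simp: lborel.emeasure_pair_measure_Times)
    then show ?thesis by (simp add: lborel_prod)
  qed
  note n2 = n23[OF n2'] and n3 = n23[OF n3']
  have "AE p in (lborel :: (real \<times> real \<times> real) measure). p \<notin> {-1} \<times> UNIV \<union> {1} \<times> UNIV \<union> UNIV \<times> {0} \<times> UNIV \<union> UNIV \<times> UNIV \<times> {0} \<union> UNIV \<times> UNIV \<times> {2*pi}"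
    by (intro AE_not_in null_sets.Un n1 n2 n3)
  then have "AE p in lborel. ennreal (indicator sph_box p * (fst (snd p))\<^sup>2) = ennreal (sph_weight p)"
  proof eventually_elim
    case (elim p)
    obtain a b c where p: "p = (a, b, c)" by (cases p)
    have "a \<noteq> -1" "a \<noteq> 1" "b \<noteq> 0" "c \<noteq> 0" "c \<noteq> 2 * pi" using elim unfolding p by blast+
    then have "p \<in> sph_box \<longleftrightarrow> p \<in> sph_cbox"
      by (simp add: p sph_box_def sph_cbox_def less_le)
    then show ?case by (simp add: indicator_def)
  qed
  then have "density lborel (\<lambda>p. ennreal (indicator sph_box p * (fst (snd p))\<^sup>2)) = density lborel (\<lambda>p. ennreal (sph_weight p))"
    by (intro density_cong) measurable
  moreover have "(\<lambda>(\<zeta>, r, \<beta>). ennreal (indicator sph_box (\<zeta>, r, \<beta>) * r\<^sup>2)) = (\<lambda>p. ennreal (indicator sph_box p * (fst (snd p))\<^sup>2))"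
    by (simp add: fun_eq_iff)
  ultimately show ?thesis using lborel_spherical by (simp only:)
qed

lemma integrable_spherical_iff:
  fixes f :: "real^3 \<Rightarrow> real"
  assumes [measurable]: "f \<in> borel_measurable borel"
  shows "integrable lborel f \<longleftrightarrow> integrable lborel (\<lambda>p. sph_weight p * f (sph p))"
proof -
  have "integrable lborel f \<longleftrightarrow> integrable (density lborel (\<lambda>p. ennreal (sph_weight p))) (\<lambda>p. f (sph p))"
    by (subst lborel_spherical_closed, subst integrable_distr_eq) auto
  also have "\<dots> \<longleftrightarrow> integrable lborel (\<lambda>p. sph_weight p * f (sph p))"
    by (subst integrable_density) auto
  finally show ?thesis .
qed

lemma integral_spherical:
  fixes f :: "real^3 \<Rightarrow> real"
  assumes [measurable]: "f \<in> borel_measurable borel"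
  shows "integral\<^sup>L lborel f = (\<integral>p. sph_weight p * f (sph p) \<partial>lborel)"
proof -
  have "integral\<^sup>L lborel f = (\<integral>p. f (sph p) \<partial>(density lborel (\<lambda>p. ennreal (sph_weight p))))"
    by (subst lborel_spherical_closed, subst integral_distr) auto
  also have "\<dots> = (\<integral>p. sph_weight p * f (sph p) \<partial>lborel)"
    by (subst integral_density) auto
  finally show ?thesis .
qed

lemma integral_lborel_triple:
  fixes F :: "real \<times> real \<times> real \<Rightarrow> real"
  assumes F: "integrable lborel F"
  shows "integral\<^sup>L lborel F = (LBINT a. LBINT b. LBINT c. F (a, b, c))"
proof -
  have F1: "integrable (lborel \<Otimes>\<^sub>M lborel) F" using F by (simp add: lborel_prod)
  then have m[measurable]: "F \<in> borel_measurable (lborel \<Otimes>\<^sub>M lborel)" by (rule borel_measurable_integrable)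
  have "integral\<^sup>L lborel F = (\<integral>a. \<integral>q. F (a, q) \<partial>lborel \<partial>lborel)"
    using lborel_pair.integral_fst'[OF F1] by (simp add: lborel_prod)
  also have "\<dots> = (LBINT a. LBINT b. LBINT c. F (a, b, c))"
  proof (rule integral_cong_AE)
    have m2: "F \<in> borel_measurable (lborel \<Otimes>\<^sub>M (lborel \<Otimes>\<^sub>M lborel))" using m by (simp add: lborel_prod)
    show "(\<lambda>a. \<integral>q. F (a, q) \<partial>lborel) \<in> borel_measurable lborel"
      by (rule lborel.borel_measurable_lebesgue_integral) (use m in simp)
    note m2[measurable]
    show "(\<lambda>a. LBINT b. LBINT c. F (a, b, c)) \<in> borel_measurable lborel"
      by measurable
    have "AE a in lborel. integrable lborel (\<lambda>q. F (a, q))"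
      using lborel_pair.AE_integrable_fst'[OF F1] .
    then show "AE a in lborel. (\<integral>q. F (a, q) \<partial>lborel) = (LBINT b. LBINT c. F (a, b, c))"
    proof eventually_elim
      case (elim a)
      then have "integrable (lborel \<Otimes>\<^sub>M lborel) (\<lambda>q. F (a, q))" by (simp add: lborel_prod)
      from lborel_pair.integral_fst'[OF this] show ?case by (simp add: lborel_prod)
    qed
  qed
  finally show ?thesis .
qed

section \<open>Newtonian potentials of bounded densities supported in a ball\<close>

lemma distr_reflect_lborel: "distr lborel borel (\<lambda>y::'a::euclidean_space. x - y) = lborel"
  using lborel_affine[of "-1" x] by (simp add: density_1)

lemma norm_sph_cbox: "p \<in> sph_cbox \<Longrightarrow> norm (sph p) = fst (snd p)"
  by (auto simp: sph_cbox_def norm_sph)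

text \<open>The weight r^2 turns the singularity 1/r into r, which is at most d on a coordinate box
  of volume 4 * pi * d. The bound obtained in this way is twice the exact value; only its order d^2
  matters later.\<close>

lemma riesz_ball_0:
  fixes d :: real
  assumes "0 \<le> d"
  shows "integrable lborel (\<lambda>y::real^3. indicator (cball 0 d) y / norm y)" (is "integrable _ ?f")
    and "(\<integral>y. indicator (cball 0 d) y / norm y \<partial>(lborel :: (real^3) measure)) \<le> 4 * pi * d\<^sup>2"
proof -
  let ?B = "{-1..1} \<times> {0..d} \<times> {0..2*pi} :: (real \<times> real \<times> real) set"
  have [measurable]: "?f \<in> borel_measurable borel"
    by (intro borel_measurable_divide borel_measurable_norm borel_measurable_indicator measurable_ident_sets) auto
  have B: "?B \<in> sets borel" by (intro borel_closed closed_Times) auto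
  have eB: "emeasure lborel ?B = ennreal (4 * pi * d)"
  proof -
    have "emeasure lborel ?B = emeasure (lborel \<Otimes>\<^sub>M (lborel \<Otimes>\<^sub>M lborel)) ?B" by (simp add: lborel_prod)
    also have "\<dots> = ennreal 2 * (ennreal d * ennreal (2 * pi))"
      using assms by (simp add: lborel.emeasure_pair_measure_Times lborel_prod[symmetric] lborel_pair.emeasure_pair_measure_Times)
    also have "\<dots> = ennreal (2 * (d * (2 * pi)))" using assms by (simp only: ennreal_mult' [symmetric] pi_ge_zero mult_nonneg_nonneg zero_le_numeral)
    finally show ?thesis by (simp add: mult_ac)
  qed
  have iB: "integrable lborel (\<lambda>p. d * indicator ?B p)"
    using B eB by (intro integrable_mult_right integrable_real_indicator) auto
  have le: "sph_weight p * ?f (sph p) \<le> d * indicator ?B p" for p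
  proof (cases p)
    case (fields a b c)
    show ?thesis
    proof (cases "p \<in> sph_cbox")
      case True
      then have "norm (sph p) = b" using norm_sph_cbox[OF True] fields by simp
      then show ?thesis using True assms
        by (auto simp: fields indicator_def sph_cbox_def power2_eq_square)
    qed (use assms in \<open>auto simp: indicator_def\<close>)
  qed
  have nn: "0 \<le> sph_weight p * ?f (sph p)" for p by simp
  have i: "integrable lborel (\<lambda>p. sph_weight p * ?f (sph p))"
  proof (rule Bochner_Integration.integrable_bound[OF iB])
    have "(\<lambda>p. ?f (sph p)) \<in> borel_measurable borel"
      by (rule measurable_compose[OF measurable_sph]) fact
    then show "(\<lambda>p. sph_weight p * ?f (sph p)) \<in> borel_measurable lborel" by measurable
    show "AE p in lborel. norm (sph_weight p * ?f (sph p)) \<le> norm (d * indicator ?B p)"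
      using order_trans[OF le abs_ge_self] nn by (intro AE_I2) (simp only: real_norm_def abs_of_nonneg)
  qed
  then show "integrable lborel ?f" by (simp only: integrable_spherical_iff[OF \<open>?f \<in> _\<close>])
  have "integral\<^sup>L lborel ?f = (\<integral>p. sph_weight p * ?f (sph p) \<partial>lborel)" by (rule integral_spherical) fact
  also have "\<dots> \<le> (\<integral>p. d * indicator ?B p \<partial>lborel)"
    by (rule integral_mono[OF i iB le])
  also have "\<dots> = d * (4 * pi * d)"
    using B eB assms by (simp add: measure_def)
  finally show "integral\<^sup>L lborel ?f \<le> 4 * pi * d\<^sup>2" by (simp add: power2_eq_square mult_ac)
qed

lemma integral_shift_reflect:
  fixes f :: "'a::euclidean_space \<Rightarrow> real"
  assumes [measurable]: "f \<in> borel_measurable borel"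
  shows "integrable lborel (\<lambda>y. f (x - y)) \<longleftrightarrow> integrable lborel f"
    and "(\<integral>y. f (x - y) \<partial>lborel) = (\<integral>y. f y \<partial>lborel)"
proof -
  have m: "(\<lambda>y. x - y) \<in> borel_measurable borel" by measurable
  have "integrable (distr lborel borel (\<lambda>y. x - y)) f \<longleftrightarrow> integrable lborel (\<lambda>y. f (x - y))"
    by (rule integrable_distr_eq) (use m in auto)
  then show "integrable lborel (\<lambda>y. f (x - y)) \<longleftrightarrow> integrable lborel f" by (simp add: distr_reflect_lborel)
  have "integral\<^sup>L (distr lborel borel (\<lambda>y. x - y)) f = (\<integral>y. f (x - y) \<partial>lborel)"
    by (rule integral_distr) (use m in auto)
  then show "(\<integral>y. f (x - y) \<partial>lborel) = (\<integral>y. f y \<partial>lborel)" by (simp add: distr_reflect_lborel)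
qed

lemma integral_orthogonal:
  fixes f :: "real^'n::{finite,wellorder} \<Rightarrow> real" and T :: "real^'n::{finite,wellorder} \<Rightarrow> real^'n::_"
  assumes [measurable]: "f \<in> borel_measurable borel" and T: "orthogonal_transformation T"
  shows "(\<integral>y. f (T y) \<partial>lborel) = (\<integral>y. f y \<partial>lborel)"
proof -
  have m: "T \<in> borel_measurable borel"
    by (intro borel_measurable_continuous_onI linear_continuous_on linear_conv_bounded_linear[THEN iffD1]
        orthogonal_transformation_linear T)
  have "integral\<^sup>L (distr lborel borel T) f = (\<integral>y. f (T y) \<partial>lborel)"
    by (rule integral_distr) (use m in auto)
  then show ?thesis by (simp add: distr_orthogonal_lborel[OF T])
qed

lemma riesz_ball:
  fixes x :: "real^3"
  assumes d: "0 \<le> d"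
  shows "integrable lborel (\<lambda>y. indicator (cball x d) y / norm (x - y))"
    and "(\<integral>y. indicator (cball x d) y / norm (x - y) \<partial>lborel) \<le> 4 * pi * d\<^sup>2"
proof -
  have m: "(\<lambda>y::real^3. indicator (cball 0 d) y / norm y :: real) \<in> borel_measurable borel"
    by (intro borel_measurable_divide borel_measurable_norm borel_measurable_indicator measurable_ident_sets) auto
  have eq: "(\<lambda>y. indicator (cball 0 d) (x - y) / norm (x - y)) = (\<lambda>y. indicator (cball x d) y / norm (x - y) :: real)"
    by (auto simp: fun_eq_iff indicator_def dist_norm norm_minus_commute)
  show "integrable lborel (\<lambda>y. indicator (cball x d) y / norm (x - y) :: real)"
    using integral_shift_reflect(1)[OF m, of x] riesz_ball_0(1)[OF d] unfolding eq by simp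
  show "(\<integral>y. indicator (cball x d) y / norm (x - y) \<partial>lborel) \<le> 4 * pi * d\<^sup>2"
    using integral_shift_reflect(2)[OF m, of x] riesz_ball_0(2)[OF d] unfolding eq by simp
qed

text \<open>The bound M and the radius R are parameters, so that estimates for potentials are
  uniform over whole families of densities, as compactness and contraction require.\<close>

definition dens :: "real \<Rightarrow> real \<Rightarrow> (real^3 \<Rightarrow> real) \<Rightarrow> bool" where
  "dens R M f \<longleftrightarrow> f \<in> borel_measurable borel \<and> (\<forall>y. \<bar>f y\<bar> \<le> M) \<and> (\<forall>y. R < norm y \<longrightarrow> f y = 0)"

lemma densD:
  assumes "dens R M f"
  shows "f \<in> borel_measurable borel" "\<bar>f y\<bar> \<le> M" "R < norm y \<Longrightarrow> f y = 0" "0 \<le> M"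
    "\<bar>f y\<bar> \<le> M * indicator (cball 0 R) y"
proof -
  show *: "f \<in> borel_measurable borel" "\<bar>f y\<bar> \<le> M" "R < norm y \<Longrightarrow> f y = 0" for y using assms by (auto simp: dens_def)
  show "0 \<le> M" using *(2)[of 0] by linarith
  then show "\<bar>f y\<bar> \<le> M * indicator (cball 0 R) y" using *(2,3)[of y] by (auto simp: indicator_def)
qed

definition pot :: "(real^3 \<Rightarrow> real) \<Rightarrow> real^3 \<Rightarrow> real" where
  "pot f x = (\<integral>y. f y / norm (x - y) \<partial>lborel)"

text \<open>Bounds the integral of 1/|x-y| over the ball of radius R, uniformly in x:
  \<open>riesz_ball\<close> contributes 4 * pi from the unit ball around x, and elsewhere the kernel
  is at most 1.\<close>

definition pot_const :: "real \<Rightarrow> real" where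
  "pot_const R = 4 * pi + measure lborel (cball 0 R :: (real^3) set)"

lemma pot_const_pos: "0 < pot_const R"
  unfolding pot_const_def using pi_gt_zero measure_nonneg[of lborel "cball 0 R :: (real^3) set"] by linarith

lemma integrable_cball: "integrable lborel (\<lambda>y. indicator (cball 0 R :: (real^3) set) y :: real)"
  by (intro integrable_real_indicator emeasure_bounded_finite) auto

lemma integrable_dens: "dens R M f \<Longrightarrow> integrable lborel f"
  by (rule Bochner_Integration.integrable_bound[OF integrable_mult_right[OF integrable_cball[of R], of M]])
     (use densD in \<open>force simp: abs_mult intro!: AE_I2\<close>)+

lemma pot_dominated:
  assumes f: "dens R M f"
  shows "norm (f y / norm (x - y)) \<le> M * (indicator (cball x 1) y / norm (x - y) + indicator (cball 0 R) y)"
proof (cases "y \<in> cball 0 R")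
  case True
  have "\<bar>f y\<bar> / norm (x - y) \<le> M / norm (x - y)" using densD(2)[OF f, of y] by (simp add: divide_right_mono)
  also have "\<dots> \<le> M * (indicator (cball x 1) y / norm (x - y) + indicator (cball 0 R) y)"
  proof (cases "y \<in> cball x 1")
    case False
    then have "1 \<le> norm (x - y)" by (auto simp: dist_norm)
    then have "M / norm (x - y) \<le> M" using densD(4)[OF f] by (simp add: divide_le_eq mult_le_cancel_left1)
    then show ?thesis using False True by simp
  qed (use True densD(4)[OF f] in \<open>simp add: distrib_left\<close>)
  finally show ?thesis by simp
next
  case False
  then have "f y = 0" using densD(3)[OF f] by auto
  then show ?thesis using densD(4)[OF f] by simp
qed

lemma measurable_kernel [measurable]:
  "(\<lambda>y. norm (x - y)) \<in> borel_measurable (borel :: (real^3) measure)"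
  by (intro borel_measurable_continuous_onI continuous_intros)

lemma
  assumes f: "dens R M f"
  shows integrable_pot: "integrable lborel (\<lambda>y. f y / norm (x - y))"
    and abs_pot_le: "\<bar>pot f x\<bar> \<le> M * pot_const R"
proof -
  let ?g = "\<lambda>y. M * (indicator (cball x 1) y / norm (x - y) + indicator (cball 0 R) y)"
  have g: "integrable lborel ?g"
    by (intro integrable_mult_right Bochner_Integration.integrable_add riesz_ball integrable_cball) simp
  note [measurable] = densD(1)[OF f]
  show i: "integrable lborel (\<lambda>y. f y / norm (x - y))"
    by (rule Bochner_Integration.integrable_bound[OF g])
       (use order_trans[OF pot_dominated[OF f] abs_ge_self] in \<open>auto intro!: AE_I2 simp del: norm_divide\<close>)
  have "\<bar>pot f x\<bar> \<le> (\<integral>y. norm (f y / norm (x - y)) \<partial>lborel)"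
    unfolding pot_def using integral_norm_bound[of lborel "\<lambda>y. f y / norm (x - y)"] by simp
  also have "\<dots> \<le> integral\<^sup>L lborel ?g"
    by (intro integral_mono integrable_norm i g pot_dominated[OF f])
  also have "\<dots> = M * ((\<integral>y. indicator (cball x 1) y / norm (x - y) \<partial>lborel) + (\<integral>y. indicator (cball 0 R :: (real^3) set) y \<partial>lborel))"
    by (subst integral_mult_right_zero, subst Bochner_Integration.integral_add) (auto intro: riesz_ball integrable_cball)
  also have "\<dots> \<le> M * (4 * pi * 1\<^sup>2 + measure lborel (cball 0 R :: (real^3) set))"
    by (intro mult_left_mono add_mono riesz_ball densD(4)[OF f]) auto
  finally show "\<bar>pot f x\<bar> \<le> M * pot_const R" by (simp add: pot_const_def)
qed

lemma kernel_trunc_lipschitz: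
  fixes a b d :: real
  assumes d: "0 < d"
  shows "\<bar>1 / max d a - 1 / max d b\<bar> \<le> \<bar>a - b\<bar> / d\<^sup>2"
proof -
  define A B where "A = max d a" and "B = max d b"
  have p: "d \<le> A" "d \<le> B" "0 < A" "0 < B" using d by (auto simp: A_def B_def)
  have AB: "\<bar>B - A\<bar> \<le> \<bar>a - b\<bar>" unfolding A_def B_def by (cases "d \<le> a"; cases "d \<le> b") (auto simp: max_def)
  have "1 / A - 1 / B = (B - A) / (A * B)" using p by (simp add: field_simps)
  then have "\<bar>1 / A - 1 / B\<bar> = \<bar>B - A\<bar> / (A * B)" using p by (simp add: abs_mult)
  also have "\<dots> \<le> \<bar>a - b\<bar> / (d * d)"
    by (rule frac_le) (use p d AB in \<open>auto intro: mult_mono\<close>)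
  finally show ?thesis by (simp add: power2_eq_square A_def B_def)
qed

text \<open>Cutting the kernel off at distance d leaves a function that is Lipschitz with constant
  1/d^2. The error of the cutoff lives in balls of radius d, where \<open>riesz_ball\<close> makes
  it of order d^2 after integration.\<close>

lemma kernel_diff_le:
  fixes x x' y :: "real^3"
  assumes d: "0 < d" and ne: "x \<noteq> y" "x' \<noteq> y"
  shows "\<bar>1 / norm (x - y) - 1 / norm (x' - y)\<bar> \<le>
    indicator (cball x d) y / norm (x - y) + indicator (cball x' d) y / norm (x' - y) + norm (x - x') / d\<^sup>2"
proof -
  have *: "\<bar>1 / norm (z - y) - 1 / max d (norm (z - y))\<bar> \<le> indicator (cball z d) y / norm (z - y)" if "z \<noteq> y" for z
  proof (cases "norm (z - y) \<le> d")
    case True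
    have "1 / d \<le> 1 / norm (z - y)" using True that d by (simp add: frac_le)
    moreover have "max d (norm (z - y)) = d" "y \<in> cball z d" using True by (auto simp: dist_norm)
    moreover have "0 < 1 / d" using d by simp
    ultimately show ?thesis by (simp only: indicator_simps)
  next
    case False
    then have "max d (norm (z - y)) = norm (z - y)" "y \<notin> cball z d" by (auto simp: dist_norm)
    then show ?thesis by (simp only: indicator_simps) simp
  qed
  have "\<bar>1 / max d (norm (x - y)) - 1 / max d (norm (x' - y))\<bar> \<le> norm (x - x') / d\<^sup>2"
    by (rule order_trans[OF kernel_trunc_lipschitz[OF d]])
       (use norm_triangle_ineq3[of "x - y" "x' - y"] in \<open>simp add: divide_right_mono\<close>)
  then show ?thesis using *[OF ne(1)] *[OF ne(2)] by linarith
qed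

lemma pot_modulus:
  assumes f: "dens R M f" and d: "0 < d"
  shows "\<bar>pot f x - pot f x'\<bar> \<le> M * (8 * pi * d\<^sup>2 + measure lborel (cball 0 R :: (real^3) set) * norm (x - x') / d\<^sup>2)"
proof -
  let ?A = "\<lambda>z y. indicator (cball z d) y / norm (z - y) :: real"
  let ?g = "\<lambda>y. M * (?A x y + ?A x' y + (norm (x - x') / d\<^sup>2) * indicator (cball 0 R) y)"
  have i: "integrable lborel (?A z)" for z :: "real^3" using riesz_ball(1)[of d z] d by simp
  have g: "integrable lborel ?g"
    by (intro integrable_mult_right Bochner_Integration.integrable_add i integrable_cball)
  have le: "norm (f y / norm (x - y) - f y / norm (x' - y)) \<le> ?g y" if ne: "x \<noteq> y" "x' \<noteq> y" for y
  proof -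
    have "norm (f y / norm (x - y) - f y / norm (x' - y)) = \<bar>f y\<bar> * \<bar>1 / norm (x - y) - 1 / norm (x' - y)\<bar>"
      by (simp add: abs_mult[symmetric] right_diff_distrib)
    also have "\<dots> \<le> (M * indicator (cball 0 R) y) * (?A x y + ?A x' y + norm (x - x') / d\<^sup>2)"
      by (intro mult_mono kernel_diff_le d ne densD(5)[OF f]) (use densD(4)[OF f] in auto)
    also have "\<dots> \<le> ?g y"
      using densD(4)[OF f] by (cases "y \<in> cball 0 R") (auto intro!: mult_left_mono)
    finally show ?thesis .
  qed
  have "pot f x - pot f x' = (\<integral>y. f y / norm (x - y) - f y / norm (x' - y) \<partial>lborel)"
    unfolding pot_def by (intro Bochner_Integration.integral_diff[symmetric] integrable_pot[OF f])
  then have "\<bar>pot f x - pot f x'\<bar> \<le> (\<integral>y. norm (f y / norm (x - y) - f y / norm (x' - y)) \<partial>lborel)"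
    using integral_norm_bound[of lborel "\<lambda>y. f y / norm (x - y) - f y / norm (x' - y)"] by simp
  also have "\<dots> \<le> integral\<^sup>L lborel ?g"
  proof (intro integral_mono_AE integrable_norm Bochner_Integration.integrable_diff integrable_pot[OF f] g)
    show "AE y in lborel. norm (f y / norm (x - y) - f y / norm (x' - y)) \<le> ?g y"
      using AE_lborel_singleton[of x] AE_lborel_singleton[of x'] by eventually_elim (use le in auto)
  qed
  also have "\<dots> = M * (integral\<^sup>L lborel (?A x) + integral\<^sup>L lborel (?A x') + (norm (x - x') / d\<^sup>2) * (\<integral>y. indicator (cball 0 R :: (real^3) set) y \<partial>lborel))"
    by (simp add: Bochner_Integration.integral_add i integrable_cball del: Bochner_Integration.integral_indicator)
  also have "\<dots> \<le> M * (4 * pi * d\<^sup>2 + 4 * pi * d\<^sup>2 + (norm (x - x') / d\<^sup>2) * measure lborel (cball 0 R :: (real^3) set))"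
    by (intro mult_left_mono add_mono riesz_ball densD(4)[OF f]) (use d in auto)
  finally show ?thesis by (simp add: mult_ac)
qed

text \<open>The modulus depends on R, M and e only, not on the density; this is the equicontinuity
  behind the Arzela-Ascoli argument.\<close>

lemma pot_equicontinuous:
  assumes "0 \<le> M" "0 < e"
  obtains d where "0 < d" "\<And>f x x'. dens R M f \<Longrightarrow> norm (x - x') < d \<Longrightarrow> \<bar>pot f x - pot f x'\<bar> < e"
proof -
  define V where "V = measure lborel (cball 0 R :: (real^3) set)"
  have V: "0 \<le> V" by (simp add: V_def)
  define X where "X = M + 1"
  have X: "0 < X" "M \<le> X" using assms by (auto simp: X_def)
  \<comment> \<open>The cutoff radius \<open>\<delta>\<close> makes the singular part of
    \<open>pot_modulus\<close> equal to e/4; afterwards d makes the Lipschitz part e/4. The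
    increments in \<open>X\<close> and in \<open>V + 1\<close> keep the denominators positive when M
    or the volume is 0.\<close>
  define \<delta> where "\<delta> = sqrt (e / (32 * pi * X))"
  have \<delta>: "0 < \<delta>" "\<delta>\<^sup>2 = e / (32 * pi * X)" using assms X by (auto simp: \<delta>_def)
  define d where "d = e * \<delta>\<^sup>2 / (4 * X * (V + 1))"
  have d: "0 < d" using assms V X \<delta>(1) by (simp add: d_def)
  show ?thesis
  proof (rule that[OF d])
    fix f and x x' :: "real^3" assume f: "dens R M f" and xx: "norm (x - x') < d"
    have "\<bar>pot f x - pot f x'\<bar> \<le> M * (8 * pi * \<delta>\<^sup>2) + M * (V * norm (x - x') / \<delta>\<^sup>2)"
      using pot_modulus[OF f \<delta>(1), of x x'] unfolding V_def[symmetric] by (simp only: distrib_left)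
    also have "M * (8 * pi * \<delta>\<^sup>2) \<le> X * (8 * pi * \<delta>\<^sup>2)" using X by (intro mult_right_mono) auto
    also have "X * (8 * pi * \<delta>\<^sup>2) = e / 4" using X by (simp add: \<delta>(2))
    also have "M * (V * norm (x - x') / \<delta>\<^sup>2) \<le> X * ((V + 1) * d / \<delta>\<^sup>2)"
    proof (rule mult_mono)
      show "V * norm (x - x') / \<delta>\<^sup>2 \<le> (V + 1) * d / \<delta>\<^sup>2"
        using V xx by (intro divide_right_mono mult_mono) auto
    qed (use X V in auto)
    also have "X * ((V + 1) * d / \<delta>\<^sup>2) = e / 4"
      using V X \<delta>(1) by (simp add: d_def)
    finally show "\<bar>pot f x - pot f x'\<bar> < e" using assms by simp
  qed
qed

lemma continuous_pot:
  assumes f: "dens R M f"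
  shows "continuous_on UNIV (pot f)"
  unfolding continuous_on_iff
proof clarsimp
  fix x :: "real^3" and e :: real assume "0 < e"
  from pot_equicontinuous[OF densD(4)[OF f] this, of R] obtain d where
    "0 < d" "\<And>x x'. norm (x - x') < d \<Longrightarrow> \<bar>pot f x - pot f x'\<bar> < e" using f by metis
  then show "\<exists>d>0. \<forall>x'. dist x' x < d \<longrightarrow> dist (pot f x') (pot f x) < e"
    by (auto simp: dist_norm)
qed

lemma pot_orthogonal:
  assumes f: "f \<in> borel_measurable borel" and T: "orthogonal_transformation T"
  shows "pot f (T x) = pot (\<lambda>y. f (T y)) x"
proof -
  note [measurable] = f
  have "pot f (T x) = (\<integral>y. f (T y) / norm (T x - T y) \<partial>lborel)"
    unfolding pot_def by (rule integral_orthogonal[OF _ T, symmetric]) measurable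
  also have "\<dots> = pot (\<lambda>y. f (T y)) x"
    unfolding pot_def using T
    by (simp add: orthogonal_transformation_norm linear_diff[symmetric] orthogonal_transformation_linear)
  finally show ?thesis .
qed

text \<open>The kernel is symmetric, so this is Fubini. Absolute integrability holds because the
  potential of |g| is bounded and f is bounded with support in a ball.\<close>

lemma pot_symmetric:
  assumes f: "dens R M f" and g: "dens R N g"
  shows "(\<integral>x. f x * pot g x \<partial>lborel) = (\<integral>x. g x * pot f x \<partial>lborel)"
proof -
  note [measurable] = densD(1)[OF f] densD(1)[OF g]
  have k: "(\<lambda>(x, y). norm (x - y)) \<in> borel_measurable (borel \<Otimes>\<^sub>M borel :: ((real^3) \<times> (real^3)) measure)"
    by measurable
  note [measurable] = k
  let ?F = "\<lambda>x y. f x * g y / norm (x - y)"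
  have m: "(\<lambda>(x, y). ?F x y) \<in> borel_measurable (lborel \<Otimes>\<^sub>M lborel)" by measurable
  have ag: "dens R N (\<lambda>y. \<bar>g y\<bar>)" using g by (auto simp: dens_def)
  have af: "dens R (M * (N * pot_const R)) (\<lambda>x. \<bar>f x\<bar> * pot (\<lambda>y. \<bar>g y\<bar>) x)"
    unfolding dens_def
  proof (intro conjI allI impI)
    have "pot (\<lambda>y. \<bar>g y\<bar>) \<in> borel_measurable borel"
      by (rule borel_measurable_continuous_onI continuous_pot[OF ag])+
    then show "(\<lambda>x. \<bar>f x\<bar> * pot (\<lambda>y. \<bar>g y\<bar>) x) \<in> borel_measurable borel" by measurable
    show "\<bar>\<bar>f y\<bar> * pot (\<lambda>y. \<bar>g y\<bar>) y\<bar> \<le> M * (N * pot_const R)" for y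
      unfolding abs_mult using densD(2,4)[OF f] abs_pot_le[OF ag] by (intro mult_mono) auto
  qed (use densD(3)[OF f] in auto)
  have i: "integrable (lborel \<Otimes>\<^sub>M lborel) (\<lambda>(x, y). ?F x y)"
  proof (rule lborel_pair.Fubini_integrable[OF m])
    have "(\<lambda>x. \<integral>y. norm (case (x, y) of (x, y) \<Rightarrow> ?F x y) \<partial>lborel) = (\<lambda>x. \<bar>f x\<bar> * pot (\<lambda>y. \<bar>g y\<bar>) x)"
      by (simp add: pot_def abs_mult fun_eq_iff flip: integral_mult_right_zero)
    then show "integrable lborel (\<lambda>x. \<integral>y. norm (case (x, y) of (x, y) \<Rightarrow> ?F x y) \<partial>lborel)"
      using integrable_dens[OF af] by (simp only:)
    show "AE x in lborel. integrable lborel (\<lambda>y. case (x, y) of (x, y) \<Rightarrow> ?F x y)"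
      using integrable_mult_right[OF integrable_pot[OF g]] by (auto intro!: AE_I2)
  qed
  have "(\<integral>x. f x * pot g x \<partial>lborel) = (\<integral>x. \<integral>y. ?F x y \<partial>lborel \<partial>lborel)"
    by (simp add: pot_def flip: integral_mult_right_zero)
  also have "\<dots> = (\<integral>y. \<integral>x. ?F x y \<partial>lborel \<partial>lborel)"
    by (rule lborel_pair.Fubini_integral[OF i, symmetric])
  also have "\<dots> = (\<integral>x. g x * pot f x \<partial>lborel)"
    by (simp add: pot_def norm_minus_commute mult_ac flip: integral_mult_right_zero)
  finally show ?thesis .
qed

section \<open>Potentials of radial densities\<close>

lemma pot_spherical_integrable:
  assumes f: "dens R M f"
  shows "integrable lborel (\<lambda>p. sph_weight p * (f (sph p) / norm (x - sph p)))"
    and "pot f x = (\<integral>p. sph_weight p * (f (sph p) / norm (x - sph p)) \<partial>lborel)"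
proof -
  note [measurable] = densD(1)[OF f]
  have m: "(\<lambda>y. f y / norm (x - y)) \<in> borel_measurable borel" by measurable
  show "integrable lborel (\<lambda>p. sph_weight p * (f (sph p) / norm (x - sph p)))"
    using integrable_spherical_iff[OF m] integrable_pot[OF f, of x] by blast
  show "pot f x = (\<integral>p. sph_weight p * (f (sph p) / norm (x - sph p)) \<partial>lborel)"
    unfolding pot_def by (rule integral_spherical[OF m])
qed

text \<open>For integrands constant in the azimuth. The two remaining integrals are swapped so that
  the one over \<zeta> becomes the inner one, where it can be evaluated in closed form.\<close>

lemma integral_triple_const:
  fixes F :: "real \<times> real \<times> real \<Rightarrow> real" and H :: "real \<Rightarrow> real \<Rightarrow> real"
  assumes F: "integrable lborel F" and H: "\<And>a b c. F (a, b, c) = H a b * indicator {0..2*pi} c"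
    and m: "(\<lambda>(a, b). H a b) \<in> borel_measurable borel"
  shows "integrable (lborel \<Otimes>\<^sub>M lborel) (\<lambda>(a, b). H a b)"
    and "integral\<^sup>L lborel F = 2 * pi * (\<integral>b. \<integral>a. H a b \<partial>lborel \<partial>lborel)"
proof -
  have c: "(\<integral>c. h * indicator {0..2*pi} c \<partial>lborel) = 2 * pi * h" for h :: real
    by simp
  have c': "(\<integral>c. \<bar>h * indicator {0..2*pi} c\<bar> \<partial>lborel) = 2 * pi * \<bar>h\<bar>" for h :: real
    by (simp add: abs_mult)
  have F': "integrable (lborel \<Otimes>\<^sub>M lborel) F" using F by (simp add: lborel_prod)
  have q: "(\<integral>q. F (a, q) \<partial>lborel) = 2 * pi * (\<integral>b. H a b \<partial>lborel) \<and> integrable lborel (\<lambda>b. H a b)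
      \<and> (\<integral>q. norm (F (a, q)) \<partial>lborel) = 2 * pi * (\<integral>b. norm (H a b) \<partial>lborel)"
    if "integrable lborel (\<lambda>q. F (a, q))" for a
  proof -
    have i: "integrable (lborel \<Otimes>\<^sub>M lborel) (\<lambda>q. F (a, q))" using that by (simp add: lborel_prod)
    from lborel_pair.integrable_fst'[OF i] have "integrable lborel (\<lambda>b. 2 * pi * H a b)"
      by (simp only: H c)
    then have "integrable lborel (\<lambda>b. H a b)" by simp
    moreover have "(\<integral>q. F (a, q) \<partial>lborel) = 2 * pi * (\<integral>b. H a b \<partial>lborel)"
      using lborel_pair.integral_fst'[OF i] by (simp only: H c lborel_prod) simp
    moreover have "(\<integral>q. norm (F (a, q)) \<partial>lborel) = 2 * pi * (\<integral>b. norm (H a b) \<partial>lborel)"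
      using lborel_pair.integral_fst'[OF integrable_norm[OF i]]
      by (simp only: H c' lborel_prod real_norm_def) simp
    ultimately show ?thesis by blast
  qed
  have ae: "AE a in lborel. integrable lborel (\<lambda>q. F (a, q))"
    using lborel_pair.AE_integrable_fst'[OF F'] .
  have m': "(\<lambda>(a, b). H a b) \<in> borel_measurable (lborel \<Otimes>\<^sub>M lborel)" using m by (simp add: lborel_prod)
  note [measurable] = m'
  have mm: "(\<lambda>a. \<integral>b. H a b \<partial>lborel) \<in> borel_measurable lborel" by measurable
  have mn: "(\<lambda>a. \<integral>b. norm (H a b) \<partial>lborel) \<in> borel_measurable lborel" by measurable
  show i: "integrable (lborel \<Otimes>\<^sub>M lborel) (\<lambda>(a, b). H a b)"
  proof (rule lborel_pair.Fubini_integrable[OF m'])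
    show "AE a in lborel. integrable lborel (\<lambda>b. case (a, b) of (a, b) \<Rightarrow> H a b)"
      using ae by eventually_elim (use q in auto)
    have i1: "integrable lborel (\<lambda>a. \<integral>q. norm (F (a, q)) \<partial>lborel)"
      using lborel_pair.integrable_fst'[OF integrable_norm[OF F']] .
    have i2: "AE a in lborel. (\<integral>q. norm (F (a, q)) \<partial>lborel) = 2 * pi * (\<integral>b. norm (H a b) \<partial>lborel)"
      using ae by eventually_elim (use q in blast)
    have "integrable lborel (\<lambda>a. 2 * pi * (\<integral>b. norm (H a b) \<partial>lborel))"
      by (rule integrable_cong_AE_imp[OF i1 _ i2]) (use mn in measurable)
    then show "integrable lborel (\<lambda>a. \<integral>b. norm (case (a, b) of (a, b) \<Rightarrow> H a b) \<partial>lborel)" by simp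
  qed
  have "integral\<^sup>L lborel F = (\<integral>a. \<integral>q. F (a, q) \<partial>lborel \<partial>lborel)"
    using lborel_pair.integral_fst'[OF F'] by (simp add: lborel_prod)
  also have "\<dots> = (\<integral>a. 2 * pi * (\<integral>b. H a b \<partial>lborel) \<partial>lborel)"
  proof (rule integral_cong_AE)
    show "(\<lambda>a. \<integral>q. F (a, q) \<partial>lborel) \<in> borel_measurable lborel"
      using lborel_pair.integrable_fst'[OF F'] by (rule borel_measurable_integrable)
    show "AE a in lborel. (\<integral>q. F (a, q) \<partial>lborel) = 2 * pi * (\<integral>b. H a b \<partial>lborel)"
      using ae by eventually_elim (use q in blast)
  qed (use mm in measurable)
  also have "\<dots> = 2 * pi * (\<integral>a. \<integral>b. H a b \<partial>lborel \<partial>lborel)" by simp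
  also have "(\<integral>a. \<integral>b. H a b \<partial>lborel \<partial>lborel) = (\<integral>b. \<integral>a. H a b \<partial>lborel \<partial>lborel)"
    by (rule lborel_pair.Fubini_integral[OF i, symmetric])
  finally show "integral\<^sup>L lborel F = 2 * pi * (\<integral>b. \<integral>a. H a b \<partial>lborel \<partial>lborel)" .
qed

text \<open>The mean of the kernel over a sphere, by an explicit antiderivative. Excluding r = s
  keeps the radicand positive up to the endpoint \<zeta> = 1.\<close>

lemma integral_inverse_distance:
  fixes r s :: real
  assumes "0 < r" "0 < s" "r \<noteq> s"
  shows "has_bochner_integral lborel (\<lambda>\<zeta>. 1 / sqrt (r\<^sup>2 + s\<^sup>2 - 2 * r * s * \<zeta>) * indicator {-1..1} \<zeta>) (2 / max r s)"
proof -
  let ?F = "\<lambda>\<zeta>. - sqrt (r\<^sup>2 + s\<^sup>2 - 2 * r * s * \<zeta>) / (r * s)"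
  have pos: "0 < r\<^sup>2 + s\<^sup>2 - 2 * r * s * \<zeta>" if "\<zeta> \<le> 1" for \<zeta>
  proof -
    have "2 * r * s * \<zeta> \<le> 2 * r * s * 1" using that assms by (intro mult_left_mono) auto
    moreover have "0 < (r - s)\<^sup>2" using assms by simp
    ultimately show ?thesis by (simp add: power2_diff)
  qed
  have "has_bochner_integral lborel (\<lambda>\<zeta>. 1 / sqrt (r\<^sup>2 + s\<^sup>2 - 2 * r * s * \<zeta>) * indicator {-1..1} \<zeta>) (?F 1 - ?F (-1))"
  proof (rule has_bochner_integral_FTC_Icc_real)
    fix \<zeta> :: real assume "-1 \<le> \<zeta>" "\<zeta> \<le> 1"
    note p = pos[OF this(2)]
    show "DERIV ?F \<zeta> :> 1 / sqrt (r\<^sup>2 + s\<^sup>2 - 2 * r * s * \<zeta>)"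
      using p assms by (auto intro!: derivative_eq_intros simp: field_simps)
    show "isCont (\<lambda>\<zeta>. 1 / sqrt (r\<^sup>2 + s\<^sup>2 - 2 * r * s * \<zeta>)) \<zeta>"
      using p by (intro continuous_intros) auto
  qed simp
  moreover have "?F 1 - ?F (-1) = 2 / max r s"
  proof -
    have "sqrt (r\<^sup>2 + s\<^sup>2 - 2 * r * s * 1) = \<bar>r - s\<bar>"
      using real_sqrt_abs[of "r - s"] by (simp add: power2_diff)
    moreover have "sqrt (r\<^sup>2 + s\<^sup>2 - 2 * r * s * (-1)) = r + s"
      using real_sqrt_abs[of "r + s"] assms by (simp add: power2_sum)
    ultimately show ?thesis using assms by (simp add: max_def abs_if field_simps)
  qed
  ultimately show ?thesis by (simp only:)
qed

lemma dist_sph: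
  assumes "\<zeta> \<in> {-1..1}" "0 \<le> r" "a \<in> {-1..1}" "0 \<le> b"
  shows "norm (sph (\<zeta>, r, 0) - sph (a, b, c)) =
    sqrt (r\<^sup>2 + b\<^sup>2 - 2 * r * b * (sqrt (1 - \<zeta>\<^sup>2) * sqrt (1 - a\<^sup>2) * cos c + \<zeta> * a))"
proof -
  have "(norm (sph (\<zeta>, r, 0) - sph (a, b, c)))\<^sup>2 = r\<^sup>2 + b\<^sup>2 - 2 * (sph (\<zeta>, r, 0) \<bullet> sph (a, b, c))"
    using assms by (simp add: dot_norm_neg norm_sph field_simps)
  also have "sph (\<zeta>, r, 0) \<bullet> sph (a, b, c) = r * b * (sqrt (1 - \<zeta>\<^sup>2) * sqrt (1 - a\<^sup>2) * cos c + \<zeta> * a)"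
    by (simp add: inner_vec_def sum_3 algebra_simps)
  finally show ?thesis by (metis mult.assoc norm_ge_zero real_sqrt_unique)
qed

text \<open>Newton's theorem. A rotation takes x to the north pole, where the distance no longer
  depends on the azimuth. The \<zeta>-integral of the kernel is 2 / max r s, that of 1/|y| is 2 / s,
  so shells with s > r cancel. The exceptional radii s = 0 and s = r form a null set.\<close>

lemma pot_radial_diff:
  assumes f: "dens R M f" and rad: "\<And>y. f y = \<phi> (norm y)" and [measurable]: "\<phi> \<in> borel_measurable borel"
    and r: "0 < norm x"
  shows "pot f x - pot f 0 = 4 * pi * (LBINT s:{0..norm x}. \<phi> s * (s\<^sup>2 / norm x - s))"
proof -
  define r where "r = norm x"
  have rp: "0 < r" using assms by (simp add: r_def)
  define e where "e = sph (1, r, 0)"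
  have "norm e = norm x" using rp by (simp add: e_def norm_sph r_def)
  then obtain T where T: "orthogonal_transformation T" "T e = x"
    using orthogonal_transformation_exists by blast
  have "pot f x = pot (\<lambda>y. f (T y)) e"
    using pot_orthogonal[OF densD(1)[OF f] T(1), of e] T(2) by simp
  also have "(\<lambda>y. f (T y)) = f" using T(1) by (simp add: fun_eq_iff rad orthogonal_transformation_norm)
  finally have pe: "pot f x = pot f e" .
  let ?w = "sph_weight"
  define F where "F p = ?w p * (f (sph p) / norm (e - sph p)) - ?w p * (f (sph p) / norm (0 - sph p))" for p
  have iF: "integrable lborel F"
    unfolding F_def by (intro Bochner_Integration.integrable_diff pot_spherical_integrable(1)[OF f])
  have 1: "pot f x - pot f 0 = integral\<^sup>L lborel F"
    unfolding pe unfolding pot_spherical_integrable(2)[OF f] F_def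
    by (intro Bochner_Integration.integral_diff[symmetric] pot_spherical_integrable(1)[OF f])
  define H where "H \<zeta> s = indicator {-1..1} \<zeta> * (indicator {0..} s * (s\<^sup>2 * \<phi> s)) * (1 / sqrt (r\<^sup>2 + s\<^sup>2 - 2 * r * s * \<zeta>) - 1 / s)" for \<zeta> s
  have H: "F (\<zeta>, s, \<beta>) = H \<zeta> s * indicator {0..2*pi} \<beta>" for \<zeta> s \<beta>
  proof (cases "(\<zeta>, s, \<beta>) \<in> sph_cbox")
    case True
    then have z: "\<zeta> \<in> {-1..1}" "0 \<le> s" "\<beta> \<in> {0..2*pi}" by (auto simp: sph_cbox_def)
    have n: "norm (sph (\<zeta>, s, \<beta>)) = s" using z by (simp add: norm_sph)
    have "norm (e - sph (\<zeta>, s, \<beta>)) = sqrt (r\<^sup>2 + s\<^sup>2 - 2 * r * s * \<zeta>)"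
      unfolding e_def by (subst dist_sph) (use rp z in auto)
    then show ?thesis using True z n by (simp add: F_def H_def rad right_diff_distrib)
  next
    case False
    then show ?thesis by (auto simp: F_def H_def sph_cbox_def indicator_def)
  qed
  have mH: "(\<lambda>(\<zeta>, s). H \<zeta> s) \<in> borel_measurable borel"
    unfolding H_def borel_prod[symmetric] by measurable
  have 2: "integral\<^sup>L lborel F = 2 * pi * (\<integral>s. \<integral>\<zeta>. H \<zeta> s \<partial>lborel \<partial>lborel)"
    by (rule integral_triple_const(2)[OF iF H mH])
  have in1: "(\<integral>\<zeta>. H \<zeta> s \<partial>lborel) = indicator {0..r} s * (2 * (\<phi> s * (s\<^sup>2 / r - s)))" if "s \<noteq> 0" "s \<noteq> r" for s
  proof (cases "0 < s")
    case True
    have h: "has_bochner_integral lborel (\<lambda>\<zeta>. (s\<^sup>2 * \<phi> s) * (1 / sqrt (r\<^sup>2 + s\<^sup>2 - 2 * r * s * \<zeta>) * indicator {-1..1} \<zeta>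
         - 1 / s * indicator {-1..1} \<zeta>)) ((s\<^sup>2 * \<phi> s) * (2 / max r s - 1 / s * 2))"
    proof (intro has_bochner_integral_mult_right has_bochner_integral_diff integral_inverse_distance)
      have "has_bochner_integral lborel (indicator {-1..1} :: real \<Rightarrow> real) (measure lborel {-1..1::real})"
        by (rule has_bochner_integral_real_indicator) auto
      then show "has_bochner_integral lborel (indicator {-1..1} :: real \<Rightarrow> real) 2" by simp
    qed (use rp True that in auto)
    have "(\<integral>\<zeta>. H \<zeta> s \<partial>lborel) = (s\<^sup>2 * \<phi> s) * (2 / max r s - 1 / s * 2)"
      using True by (subst has_bochner_integral_integral_eq[OF h, symmetric]) (auto simp: H_def algebra_simps)
    also have "\<dots> = indicator {0..r} s * (2 * (\<phi> s * (s\<^sup>2 / r - s)))"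
      using True rp that by (auto simp: indicator_def max_def field_simps power2_eq_square)
    finally show ?thesis .
  next
    case False
    then have "H \<zeta> s = 0" for \<zeta> using that by (simp add: H_def)
    then show ?thesis using False that by simp
  qed
  have "(\<integral>s. \<integral>\<zeta>. H \<zeta> s \<partial>lborel \<partial>lborel) = (\<integral>s. indicator {0..r} s * (2 * (\<phi> s * (s\<^sup>2 / r - s))) \<partial>lborel)"
  proof (rule integral_cong_AE)
    have "(\<lambda>(s, \<zeta>). H \<zeta> s) \<in> borel_measurable (lborel \<Otimes>\<^sub>M lborel)"
      unfolding H_def by measurable
    note [measurable] = this
    show "(\<lambda>s. \<integral>\<zeta>. H \<zeta> s \<partial>lborel) \<in> borel_measurable lborel" by measurable
    show "AE s in lborel. (\<integral>\<zeta>. H \<zeta> s \<partial>lborel) = indicator {0..r} s * (2 * (\<phi> s * (s\<^sup>2 / r - s)))"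
      using AE_lborel_singleton[of 0] AE_lborel_singleton[of r] by eventually_elim (use in1 in auto)
  qed measurable
  also have "\<dots> = 2 * (LBINT s:{0..r}. \<phi> s * (s\<^sup>2 / r - s))"
    unfolding set_lebesgue_integral_def integral_mult_right_zero[symmetric]
    by (rule Bochner_Integration.integral_cong) auto
  finally show ?thesis using 1 2 by (simp add: r_def)
qed

section \<open>The Lane--Emden profile\<close>

abbreviation pos_pow :: "real \<Rightarrow> real \<Rightarrow> real" where
  "pos_pow \<nu> t \<equiv> max 0 t powr \<nu>"

lemma abs_bounded_on_compact:
  fixes f :: "'a::topological_space \<Rightarrow> real"
  assumes "compact S" "continuous_on S f"
  obtains B where "0 < B" "\<And>x. x \<in> S \<Longrightarrow> \<bar>f x\<bar> \<le> B"
proof -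
  from compact_imp_bounded[OF compact_continuous_image[OF assms(2,1)]]
  obtain B where "0 < B" "\<forall>y\<in>f ` S. norm y \<le> B" unfolding bounded_pos by blast
  then show ?thesis by (intro that[of B]) auto
qed

lemma continuous_on_pos_pow:
  "0 < \<nu> \<Longrightarrow> continuous_on S f \<Longrightarrow> continuous_on S (\<lambda>x. pos_pow \<nu> (f x))"
  by (intro continuous_on_powr' continuous_intros) auto

lemma pos_pow_deriv:
  assumes "1 < a" shows "((\<lambda>t. pos_pow a t) has_real_derivative a * pos_pow (a - 1) t) (at t)"
proof -
  consider "0 < t" | "t < 0" | "t = 0" by linarith
  then show ?thesis
  proof cases
    case 1
    have "((\<lambda>t. t powr a) has_real_derivative a * t powr (a - 1)) (at t)"
      using 1 by (rule has_real_derivative_powr)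
    moreover have ev: "eventually (\<lambda>t. t powr a = pos_pow a t) (nhds t)"
      using eventually_nhds_in_open[of "{0<..}" t] 1 by (auto elim!: eventually_mono)
    ultimately have "((\<lambda>t. pos_pow a t) has_real_derivative a * t powr (a - 1)) (at t)"
      using DERIV_cong_ev[OF refl ev refl] by blast
    then show ?thesis using 1 by simp
  next
    case 2
    have "((\<lambda>t::real. 0::real) has_real_derivative 0) (at t)" by simp
    moreover have ev: "eventually (\<lambda>t. 0 = pos_pow a t) (nhds t)"
      using eventually_nhds_in_open[of "{..<0}" t] 2 by (auto elim!: eventually_mono)
    ultimately have "((\<lambda>t. pos_pow a t) has_real_derivative 0) (at t)"
      using DERIV_cong_ev[OF refl ev refl] by blast
    then show ?thesis using 2 by simp
  next
    case 3
    have "((\<lambda>h. (pos_pow a (0 + h) - pos_pow a 0) / h) \<longlongrightarrow> 0) (at 0)"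
    proof (rule Lim_null_comparison)
      show "eventually (\<lambda>h. norm ((pos_pow a (0 + h) - pos_pow a 0) / h) \<le> \<bar>h\<bar> powr (a - 1)) (at 0)"
        unfolding eventually_at_filter
      proof (intro always_eventually allI impI)
        fix h :: real assume "h \<noteq> 0"
        show "norm ((pos_pow a (0 + h) - pos_pow a 0) / h) \<le> \<bar>h\<bar> powr (a - 1)"
        proof (cases "0 < h")
          case True
          then have "h powr a / h = h powr (a - 1)" by (simp add: powr_diff)
          then show ?thesis using True by simp
        qed auto
      qed
      have "((\<lambda>h::real. \<bar>h\<bar> powr (a - 1)) \<longlongrightarrow> \<bar>0\<bar> powr (a - 1)) (at 0)"
        using assms by (intro tendsto_powr' tendsto_intros) auto
      then show "((\<lambda>h::real. \<bar>h\<bar> powr (a - 1)) \<longlongrightarrow> 0) (at 0)" by simp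
    qed
    then show ?thesis using 3 by (simp add: DERIV_def)
  qed
qed

lemma has_deriv_integral:
  assumes g: "continuous_on {0..} g" and r: "0 < r"
  shows "((\<lambda>r. integral {0..r} g) has_real_derivative g r) (at (r::real))"
proof -
  have "((\<lambda>r. integral {0..r} g) has_real_derivative g r) (at r within {0..r+1})"
    using r by (intro integral_has_real_derivative continuous_on_subset[OF g]) auto
  moreover have "at r within {0..r+1} = at r" using r by (intro at_within_interior) auto
  ultimately show ?thesis by simp
qed

locale lane_emden_profile =
  fixes \<nu> \<xi> :: real and \<theta> :: "real \<Rightarrow> real"
  assumes le: "lane_emden \<nu> \<xi> \<theta>" and nu2: "2 \<le> \<nu>"
begin

lemma nu: "0 < \<nu>" using nu2 by simp

lemma xi_pos: "0 < \<xi>" and theta_cont: "continuous_on {0..\<xi>} \<theta>"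
  and theta_pos: "0 < r \<Longrightarrow> r < \<xi> \<Longrightarrow> 0 < \<theta> r" and theta_xi: "\<theta> \<xi> = 0"
  using le by (auto simp: lane_emden_def)

lemma theta_0: "\<theta> 0 = 1"
proof -
  have "(\<lambda>r. \<theta> r - 1) \<in> O[at_right 0](\<lambda>r. r\<^sup>2)" using le by (simp add: lane_emden_def)
  moreover have "(\<lambda>r::real. r\<^sup>2) \<in> o[at_right 0](\<lambda>_. 1)"
    by (intro smalloI_tendsto) (auto intro!: tendsto_eq_intros)
  ultimately have "(\<lambda>r. \<theta> r - 1) \<in> o[at_right 0](\<lambda>_. 1)" by (rule landau_o.big_small_trans)
  from smalloD_tendsto[OF this] have "((\<lambda>r. \<theta> r - 1) \<longlongrightarrow> 0) (at_right 0)" by simp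
  then have "(\<theta> \<longlongrightarrow> 1) (at_right 0)" by (simp add: LIM_zero_iff)
  moreover have "(\<theta> \<longlongrightarrow> \<theta> 0) (at_right 0)"
    using theta_cont xi_pos by (auto simp: continuous_on_Icc_at_rightD)
  ultimately show ?thesis using tendsto_unique[of "at_right (0::real)"] by fastforce
qed

abbreviation lext :: "real \<Rightarrow> real" where "lext \<equiv> lane_emden_ext \<nu> \<xi> \<theta>"

abbreviation lextp :: "real \<Rightarrow> real" where "lextp s \<equiv> pos_pow \<nu> (lext s)"

text \<open>The mass inside radius r. It equals -r^2 times the derivative of the extended profile
  (\<open>lext_deriv\<close>) and is constant beyond \<xi>.\<close>

definition le_mass :: "real \<Rightarrow> real" where
  "le_mass r = integral {0..r} (\<lambda>s. lextp s * s\<^sup>2)"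

lemma mass_nonneg: "0 \<le> lane_emden_mass \<nu> \<xi> \<theta>"
  unfolding lane_emden_mass_def set_lebesgue_integral_def
  by (rule Bochner_Integration.integral_nonneg) (auto simp: indicator_def)

lemma lext_0: "lext 0 = 1" using xi_pos theta_0 by (simp add: lane_emden_ext_def)

lemma lext_pos: "0 \<le> r \<Longrightarrow> r < \<xi> \<Longrightarrow> 0 < lext r"
  using theta_pos[of r] lext_0 by (cases "r = 0") (auto simp: lane_emden_ext_def)

lemma lext_nonpos: "\<xi> \<le> r \<Longrightarrow> lext r \<le> 0"
proof -
  assume r: "\<xi> \<le> r"
  then have "1 / r \<le> 1 / \<xi>" using xi_pos by (simp add: frac_le)
  then show "lext r \<le> 0" using mass_nonneg theta_xi r by (auto simp: lane_emden_ext_def)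
qed

lemma lext_cont: "continuous_on {0..} lext"
proof -
  have "continuous_on ({0..\<xi>} \<union> {\<xi>..}) (\<lambda>r. if r \<le> \<xi> then \<theta> r else - lane_emden_mass \<nu> \<xi> \<theta> * (1 / \<xi> - 1 / r))"
    by (intro continuous_on_cases) (use xi_pos theta_cont theta_xi in \<open>auto intro!: continuous_intros\<close>)
  moreover have "{0..\<xi>} \<union> {\<xi>..} = {0..}" using xi_pos by auto
  ultimately show ?thesis by (simp add: lane_emden_ext_def[abs_def])
qed

lemma lext_pow_cont: "continuous_on {0..} (\<lambda>s. lextp s)"
  by (rule continuous_on_pos_pow[OF nu lext_cont])

lemma le_mass_deriv: "0 < r \<Longrightarrow> (le_mass has_real_derivative lextp r * r\<^sup>2) (at r)"
  unfolding le_mass_def by (intro has_deriv_integral continuous_intros lext_pow_cont)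

text \<open>The right-hand side of the radial integral equation: the normalised potential of the
  profile's own density, plus 1.\<close>

definition le_aux :: "real \<Rightarrow> real" where
  "le_aux r = 1 + le_mass r / r - integral {0..r} (\<lambda>s. lextp s * s)"

lemma le_aux_deriv:
  assumes "0 < r" shows "(le_aux has_real_derivative - le_mass r / r\<^sup>2) (at r)"
proof -
  have 1: "((\<lambda>r. integral {0..r} (\<lambda>s. lextp s * s)) has_real_derivative lextp r * r) (at r)"
    using assms by (intro has_deriv_integral continuous_intros lext_pow_cont)
  have 2: "((\<lambda>r. le_mass r / r) has_real_derivative (lextp r * r\<^sup>2 * r - le_mass r * 1) / (r * r)) (at r)"
    using assms by (intro DERIV_divide le_mass_deriv DERIV_ident) auto
  have "((\<lambda>r. 1 + le_mass r / r - integral {0..r} (\<lambda>s. lextp s * s)) has_real_derivative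
     (0 + (lextp r * r\<^sup>2 * r - le_mass r * 1) / (r * r)) - lextp r * r) (at r)"
    by (intro DERIV_diff DERIV_add DERIV_const 1 2)
  moreover have "(0 + (lextp r * r\<^sup>2 * r - le_mass r * 1) / (r * r)) - lextp r * r = - le_mass r / r\<^sup>2"
    using assms by (simp add: field_simps power2_eq_square)
  ultimately show ?thesis unfolding le_aux_def[abs_def] by (simp only:)
qed

lemma lext_pow_bound:
  assumes "0 \<le> b" obtains B where "0 < B" "\<And>s. s \<in> {0..b} \<Longrightarrow> \<bar>lextp s\<bar> \<le> B"
proof -
  have "continuous_on {0..b} (\<lambda>s. lextp s)" by (rule continuous_on_subset[OF lext_pow_cont]) auto
  from abs_bounded_on_compact[OF compact_Icc this] show ?thesis using that by blast
qed

lemma abs_le_mass: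
  assumes r: "0 < r" and B: "\<And>s. s \<in> {0..r} \<Longrightarrow> \<bar>lextp s\<bar> \<le> B"
  shows "\<bar>le_mass r\<bar> \<le> B * r ^ 3"
    and "\<bar>integral {0..r} (\<lambda>s. lextp s * s)\<bar> \<le> B * r\<^sup>2"
proof -
  have B0: "0 \<le> B" using order_trans[OF abs_ge_zero B[of 0]] r by simp
  have P: "continuous_on {0..r} (\<lambda>s. lextp s)" by (rule continuous_on_subset[OF lext_pow_cont]) auto
  have "norm (le_mass r) \<le> (B * r\<^sup>2) * (r - 0)"
    unfolding le_mass_def
  proof (rule integral_bound)
    show "norm (lextp s * s\<^sup>2) \<le> B * r\<^sup>2" if "s \<in> {0..r}" for s
      unfolding norm_mult using B[OF that] that B0 by (intro mult_mono) (auto intro: power_mono)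
  qed (use r P in \<open>auto intro!: continuous_intros\<close>)
  then show "\<bar>le_mass r\<bar> \<le> B * r ^ 3" by (simp add: power2_eq_square power3_eq_cube mult.assoc)
  have "norm (integral {0..r} (\<lambda>s. lextp s * s)) \<le> (B * r) * (r - 0)"
  proof (rule integral_bound)
    show "norm (lextp s * s) \<le> B * r" if "s \<in> {0..r}" for s
      unfolding norm_mult using B[OF that] that B0 by (intro mult_mono) auto
  qed (use r P in \<open>auto intro!: continuous_intros\<close>)
  then show "\<bar>integral {0..r} (\<lambda>s. lextp s * s)\<bar> \<le> B * r\<^sup>2" by (simp add: power2_eq_square mult.assoc)
qed

lemma le_aux_0: "(le_aux \<longlongrightarrow> 1) (at_right 0)"
proof -
  obtain B where B: "0 < B" "\<And>s. s \<in> {0..1} \<Longrightarrow> \<bar>lextp s\<bar> \<le> B" using lext_pow_bound[of 1] by auto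
  have ev: "eventually (\<lambda>r::real. 0 < r \<and> r < 1) (at_right 0)"
    by (auto simp: eventually_at_right_field intro!: exI[of _ 1])
  have "((\<lambda>r. le_aux r - 1) \<longlongrightarrow> 0) (at_right 0)"
  proof (rule Lim_null_comparison)
    show "eventually (\<lambda>r. norm (le_aux r - 1) \<le> 2 * B * r\<^sup>2) (at_right 0)"
      using ev
    proof eventually_elim
      case (elim r)
      have "\<bar>le_mass r\<bar> \<le> B * r ^ 3" "\<bar>integral {0..r} (\<lambda>s. lextp s * s)\<bar> \<le> B * r\<^sup>2"
        using elim by (auto intro!: abs_le_mass B(2))
      moreover from this(1) have "\<bar>le_mass r / r\<bar> \<le> B * r\<^sup>2"
        using elim by (simp add: field_simps power2_eq_square power3_eq_cube)
      moreover have "le_aux r - 1 = le_mass r / r - integral {0..r} (\<lambda>s. lextp s * s)" by (simp add: le_aux_def)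
      ultimately show ?case unfolding real_norm_def by linarith
    qed
  qed (auto intro!: tendsto_eq_intros)
  then show ?thesis by (simp add: LIM_zero_iff)
qed

text \<open>Multiplied by r^2, the differential equation says that r^2 \<theta>' +
  \<open>le_mass\<close> is a constant c. A nonzero c would put a 1/r singularity into \<theta>,
  which its limit 1 at the centre excludes; the same limit then fixes the remaining constant
  k.\<close>

lemma theta_eq_aux:
  assumes r: "0 < r" "r < \<xi>"
  shows "\<theta> r = le_aux r"
proof -
  obtain d1 d2 where d: "\<And>r. 0 < r \<Longrightarrow> r < \<xi> \<Longrightarrow> (\<theta> has_real_derivative d1 r) (at r) \<and>
        (d1 has_real_derivative d2 r) (at r) \<and> d2 r + 2 / r * d1 r + \<theta> r powr \<nu> = 0"
  proof -
    have "\<exists>d1 d2. \<forall>r\<in>{0<..<\<xi>}. (\<theta> has_real_derivative d1 r) (at r) \<and>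
        (d1 has_real_derivative d2 r) (at r) \<and> d2 r + 2 / r * d1 r + \<theta> r powr \<nu> = 0"
      using le unfolding lane_emden_def by blast
    then show ?thesis using that by (metis greaterThanLessThan_iff)
  qed
  define p where "p r = r\<^sup>2 * d1 r + le_mass r" for r
  have p': "(p has_real_derivative 0) (at r)" if "0 < r" "r < \<xi>" for r
  proof -
    have "lextp r = \<theta> r powr \<nu>" using theta_pos[OF that] that by (simp add: lane_emden_ext_def max_def)
    moreover have "2 * r * d1 r + r\<^sup>2 * d2 r + \<theta> r powr \<nu> * r\<^sup>2 = r\<^sup>2 * (d2 r + 2 / r * d1 r + \<theta> r powr \<nu>)"
      using that by (simp add: distrib_left power2_eq_square)
    ultimately have "2 * r * d1 r + r\<^sup>2 * d2 r + lextp r * r\<^sup>2 = 0"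
      using d[OF that] by simp
    moreover have "(p has_real_derivative 2 * r * d1 r + r\<^sup>2 * d2 r + lextp r * r\<^sup>2) (at r)"
    proof -
      have "((\<lambda>r. r\<^sup>2 * d1 r + le_mass r) has_real_derivative (2 * r) * d1 r + d2 r * r\<^sup>2 + lextp r * r\<^sup>2) (at r)"
        using d[OF that] le_mass_deriv[OF that(1)]
        by (intro DERIV_add DERIV_mult) (auto intro!: derivative_eq_intros)
      then show ?thesis unfolding p_def[abs_def] by (simp add: mult_ac)
    qed
    ultimately show ?thesis by simp
  qed
  define c where "c = p (\<xi> / 2)"
  have pc: "p r = c" if "0 < r" "r < \<xi>" for r
  proof -
    have "\<exists>k. \<forall>x\<in>{0<..<\<xi>}. p x = k"
      by (rule has_field_derivative_zero_constant) (use p' in \<open>auto intro: has_field_derivative_at_within\<close>)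
    then obtain k where k: "\<And>x. x \<in> {0<..<\<xi>} \<Longrightarrow> p x = k" by blast
    have "p r = k" "p (\<xi> / 2) = k" using that xi_pos by (intro k; simp)+
    then show ?thesis by (simp add: c_def)
  qed
  define G where "G r = \<theta> r + c / r" for r
  have G': "(G has_real_derivative - le_mass r / r\<^sup>2) (at r)" if "0 < r" "r < \<xi>" for r
  proof -
    have "d1 r = (c - le_mass r) / r\<^sup>2" using pc[OF that] that by (simp add: p_def field_simps)
    moreover have "(G has_real_derivative d1 r + - (c / r\<^sup>2)) (at r)"
      unfolding G_def[abs_def] using d[OF that] that
      by (intro DERIV_add) (auto intro!: derivative_eq_intros simp: power2_eq_square)
    ultimately show ?thesis by (simp add: diff_divide_distrib)
  qed
  have "\<exists>k. \<forall>x\<in>{0<..<\<xi>}. G x - le_aux x = k"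
  proof (rule has_field_derivative_zero_constant)
    show "((\<lambda>x. G x - le_aux x) has_field_derivative 0) (at x within {0<..<\<xi>})" if "x \<in> {0<..<\<xi>}" for x
      using DERIV_diff[OF G'[of x] le_aux_deriv[of x]] that by (simp add: has_field_derivative_at_within)
  qed auto
  then obtain k where k: "\<And>x. x \<in> {0<..<\<xi>} \<Longrightarrow> G x - le_aux x = k" by blast
  have ev: "eventually (\<lambda>r::real. 0 < r \<and> r < \<xi>) (at_right 0)"
    using xi_pos by (auto simp: eventually_at_right_field)
  have "(\<theta> \<longlongrightarrow> \<theta> 0) (at_right 0)"
    using theta_cont xi_pos by (auto simp: continuous_on_Icc_at_rightD)
  then have lim: "((\<lambda>r. \<theta> r - le_aux r) \<longlongrightarrow> 1 - 1) (at_right 0)"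
    unfolding theta_0 by (intro tendsto_diff le_aux_0)
  \<comment> \<open>Multiplication by r makes the contribution of k vanish in the limit and isolates
    c.\<close>
  have "((\<lambda>r. r * (\<theta> r - le_aux r) + c) \<longlongrightarrow> 0 * (1 - 1) + c) (at_right 0)"
    by (intro tendsto_intros lim)
  moreover have "((\<lambda>r. r * (\<theta> r - le_aux r) + c) \<longlongrightarrow> 0) (at_right 0)"
  proof -
    have "eventually (\<lambda>r. r * (\<theta> r - le_aux r) + c = k * r) (at_right 0)"
      using ev
    proof eventually_elim
      case (elim r)
      then show ?case using k[of r] by (simp add: G_def field_simps)
    qed
    moreover have "((\<lambda>r::real. k * r) \<longlongrightarrow> 0) (at_right 0)" by (auto intro!: tendsto_eq_intros)
    ultimately show ?thesis by (simp add: tendsto_cong)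
  qed
  ultimately have "c = 0" using tendsto_unique[of "at_right (0::real)"] by fastforce
  then have k': "\<theta> x - le_aux x = k" if "0 < x" "x < \<xi>" for x using k[of x] that by (simp add: G_def)
  have "((\<lambda>r. \<theta> r - le_aux r) \<longlongrightarrow> k) (at_right 0)"
    by (rule tendsto_eventually) (use ev k' in \<open>auto elim: eventually_mono\<close>)
  then have "k = 0" using lim tendsto_unique[of "at_right (0::real)"] by fastforce
  then show ?thesis using k'[OF r] by simp
qed

lemma lext_eq_aux_inside:
  assumes r: "0 < r" "r \<le> \<xi>" shows "lext r = le_aux r"
proof -
  show ?thesis
  proof (cases "r = \<xi>")
    case True
    have "(\<theta> \<longlongrightarrow> \<theta> \<xi>) (at_left \<xi>)" using theta_cont xi_pos by (auto simp: continuous_on_Icc_at_leftD)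
    moreover have "eventually (\<lambda>r::real. 0 < r \<and> r < \<xi>) (at_left \<xi>)"
      using xi_pos by (auto simp: eventually_at_left_field)
    then have "eventually (\<lambda>r. \<theta> r = le_aux r) (at_left \<xi>)" by eventually_elim (use theta_eq_aux in auto)
    ultimately have "(le_aux \<longlongrightarrow> \<theta> \<xi>) (at_left \<xi>)" by (simp add: tendsto_cong)
    moreover have "(le_aux \<longlongrightarrow> le_aux \<xi>) (at_left \<xi>)"
      using DERIV_isCont[OF le_aux_deriv[OF xi_pos]] unfolding isCont_def by (rule tendsto_mono[rotated]) (rule at_le, simp)
    ultimately have "\<theta> \<xi> = le_aux \<xi>" using tendsto_unique[of "at_left \<xi>"] by fastforce
    then show ?thesis using True by (simp add: lane_emden_ext_def)
  qed (use theta_eq_aux r in \<open>auto simp: lane_emden_ext_def\<close>)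
qed

lemma mass_eq: "lane_emden_mass \<nu> \<xi> \<theta> = le_mass \<xi>"
proof -
  have "lane_emden_mass \<nu> \<xi> \<theta> = (LBINT s:{0..\<xi>}. lextp s * s\<^sup>2)"
    unfolding lane_emden_mass_def
  proof (rule set_lebesgue_integral_cong)
    have "0 \<le> \<theta> s" if "0 \<le> s" "s \<le> \<xi>" for s
      using theta_pos[of s] theta_0 theta_xi that by (cases "s = 0"; cases "s = \<xi>") auto
    then show "\<forall>s. s \<in> {0..\<xi>} \<longrightarrow> \<theta> s powr \<nu> * s\<^sup>2 = lextp s * s\<^sup>2"
      by (auto simp: lane_emden_ext_def max_def)
  qed auto
  also have "\<dots> = le_mass \<xi>" unfolding le_mass_def
    by (intro set_borel_integral_eq_integral borel_integrable_atLeastAtMost' continuous_intros continuous_on_subset[OF lext_pow_cont]) auto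
  finally show ?thesis .
qed

lemma le_mass_outside: "\<xi> \<le> r \<Longrightarrow> le_mass r = le_mass \<xi>"
proof -
  assume r: "\<xi> \<le> r"
  have i: "(\<lambda>s. lextp s * s\<^sup>2) integrable_on {0..r}"
    by (intro integrable_continuous_real continuous_intros continuous_on_subset[OF lext_pow_cont]) auto
  have "integral {\<xi>..r} (\<lambda>s. lextp s * s\<^sup>2) = integral {\<xi>..r} (\<lambda>s. 0)"
  proof (rule Henstock_Kurzweil_Integration.integral_cong)
    fix s assume "s \<in> {\<xi>..r}"
    then have "max 0 (lext s) = 0" using lext_nonpos[of s] by auto
    then show "lextp s * s\<^sup>2 = 0" by simp
  qed
  then show ?thesis
    using Henstock_Kurzweil_Integration.integral_combine[of 0 \<xi> r, OF _ r i] xi_pos by (simp add: le_mass_def)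
qed

text \<open>Beyond \<xi> the enclosed mass stays equal to \<open>lane_emden_mass\<close>, so both
  sides have the same derivative, and both vanish at \<xi>. One formula thus covers both branches of
  the extension and yields its derivative across \<xi> as well.\<close>

lemma lext_eq_aux: "0 < r \<Longrightarrow> lext r = le_aux r"
proof (cases "r \<le> \<xi>")
  case False
  assume "0 < r"
  have "\<exists>k. \<forall>x\<in>{\<xi>..}. lane_emden_mass \<nu> \<xi> \<theta> * (1 / \<xi> - 1 / x) + le_aux x = k"
  proof (rule has_field_derivative_zero_constant)
    fix x assume x: "x \<in> {\<xi>..}"
    then have "0 < x" using xi_pos by auto
    have "((\<lambda>x. lane_emden_mass \<nu> \<xi> \<theta> * (1 / \<xi> - 1 / x)) has_real_derivative le_mass x / x\<^sup>2) (at x)"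
      using \<open>0 < x\<close> x mass_eq le_mass_outside[of x]
      by (auto intro!: derivative_eq_intros simp: power2_eq_square field_simps)
    from DERIV_add[OF this le_aux_deriv[OF \<open>0 < x\<close>]]
    show "((\<lambda>x. lane_emden_mass \<nu> \<xi> \<theta> * (1 / \<xi> - 1 / x) + le_aux x) has_field_derivative 0) (at x within {\<xi>..})"
      by (auto intro: has_field_derivative_at_within)
  qed auto
  then obtain k where k: "\<And>x. x \<ge> \<xi> \<Longrightarrow> lane_emden_mass \<nu> \<xi> \<theta> * (1 / \<xi> - 1 / x) + le_aux x = k" by auto
  have "le_aux \<xi> = 0" using lext_eq_aux_inside[of \<xi>] xi_pos theta_xi by (simp add: lane_emden_ext_def)
  then have "k = 0" using k[of \<xi>] by simp
  then show ?thesis using k[of r] False by (simp add: lane_emden_ext_def)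
qed (rule lext_eq_aux_inside)

lemma lext_deriv: "0 < r \<Longrightarrow> (lext has_real_derivative - le_mass r / r\<^sup>2) (at r)"
proof -
  assume r: "0 < r"
  then have "eventually (\<lambda>x. 0 < x) (nhds r)" using eventually_nhds_in_open[of "{0<..}" r] by auto
  then have "eventually (\<lambda>x. lext x = le_aux x) (nhds r)" by eventually_elim (rule lext_eq_aux)
  then show ?thesis using DERIV_cong_ev[OF refl _ refl] le_aux_deriv[OF r] by metis
qed

lemma lext_integral_equation: "0 < r \<Longrightarrow> lext r = 1 + (LBINT s:{0..r}. lextp s * (s\<^sup>2 / r - s))"
proof -
  assume r: "0 < r"
  have P: "continuous_on {0..r} (\<lambda>s. lextp s)" by (rule continuous_on_subset[OF lext_pow_cont]) auto
  have i: "(\<lambda>s. lextp s * s\<^sup>2) integrable_on {0..r}" "(\<lambda>s. lextp s * s) integrable_on {0..r}"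
    by (intro integrable_continuous_real continuous_intros P)+
  have "(LBINT s:{0..r}. lextp s * (s\<^sup>2 / r - s)) = integral {0..r} (\<lambda>s. lextp s * (s\<^sup>2 / r - s))"
    using r by (intro set_borel_integral_eq_integral borel_integrable_atLeastAtMost' continuous_intros P) auto
  also have "\<dots> = integral {0..r} (\<lambda>s. (1 / r) * (lextp s * s\<^sup>2) - lextp s * s)"
    by (rule Henstock_Kurzweil_Integration.integral_cong) (simp add: field_simps)
  also have "\<dots> = le_mass r / r - integral {0..r} (\<lambda>s. lextp s * s)"
    using i by (subst Henstock_Kurzweil_Integration.integral_diff[OF integrable_on_mult_right]) (simp_all add: le_mass_def)
  finally show ?thesis using lext_eq_aux[OF r] by (simp add: le_aux_def)
qed

lemma le_mass_pos: "0 < r \<Longrightarrow> r \<le> \<xi> \<Longrightarrow> 0 < le_mass r"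
proof -
  assume r: "0 < r" "r \<le> \<xi>"
  have c: "continuous_on {0..r} le_mass"
    unfolding le_mass_def
    by (intro indefinite_integral_continuous_1 integrable_continuous_real continuous_intros continuous_on_subset[OF lext_pow_cont]) auto
  have "le_mass 0 < le_mass r"
  proof (rule DERIV_pos_imp_increasing_open[OF r(1)])
    fix x assume "0 < x" "x < r"
    moreover from this have "0 < lextp x * x\<^sup>2" using lext_pos[of x] r by simp
    ultimately show "\<exists>y. (le_mass has_real_derivative y) (at x) \<and> 0 < y"
      using le_mass_deriv[of x] by blast
  qed (rule c)
  then show ?thesis by (simp add: le_mass_def)
qed

end

section \<open>The profile as a function on three-space and its directional derivatives\<close>

lemma continuous_norm_fun:
  fixes f :: "real \<Rightarrow> real"
  assumes "continuous_on {0..} f"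
  shows "continuous_on UNIV (\<lambda>x::real^3. f (norm x))" "continuous_on UNIV (\<lambda>s. f (max 0 s))"
  by (rule continuous_on_compose2[OF assms]; auto intro!: continuous_intros)+

lemma dens_mult_bounded:
  assumes f: "dens R M f" and g: "g \<in> borel_measurable borel" and N: "\<And>y. norm y \<le> R \<Longrightarrow> \<bar>g y\<bar> \<le> N" "0 \<le> N"
  shows "dens R (M * N) (\<lambda>y. f y * g y)"
  unfolding dens_def
proof (intro conjI allI impI)
  note [measurable] = densD(1)[OF f] g
  show "(\<lambda>y. f y * g y) \<in> borel_measurable borel" by measurable
  show "\<bar>f y * g y\<bar> \<le> M * N" for y
  proof (cases "norm y \<le> R")
    case True
    then show ?thesis unfolding abs_mult using densD(2,4)[OF f] N by (intro mult_mono) auto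
  qed (use densD(3,4)[OF f] N in auto)
qed (use densD(3)[OF f] in auto)

text \<open>With x moved into the density, differentiation in x leaves the singular kernel
  untouched.\<close>

lemma pot_shift: "pot f x = (\<integral>y. f (x - y) / norm y \<partial>lborel)" if "f \<in> borel_measurable borel"
proof -
  note [measurable] = that
  have "(\<integral>y. f (x - y) / norm (x - (x - y)) \<partial>lborel) = (\<integral>y. f y / norm (x - y) \<partial>lborel)"
    by (rule integral_shift_reflect(2)) measurable
  then show ?thesis by (simp add: pot_def)
qed

lemma directional_deriv_norm:
  fixes y n :: "real^3"
  assumes "y \<noteq> 0" and g: "(g has_real_derivative g') (at (norm y))"
  shows "((\<lambda>s. g (norm (y + s *\<^sub>R n))) has_real_derivative g' * ((y \<bullet> n) / norm y)) (at 0)"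
proof -
  have 1: "((\<lambda>s. y + s *\<^sub>R n) has_derivative (\<lambda>s. s *\<^sub>R n)) (at 0)"
    by (auto intro!: derivative_eq_intros)
  have 2: "(norm has_derivative (\<lambda>h. sgn y \<bullet> h)) (at (y + 0 *\<^sub>R n))"
    using has_derivative_norm[of y] assms by (simp add: inner_commute)
  have "((\<lambda>s. norm (y + s *\<^sub>R n)) has_derivative (\<lambda>s. sgn y \<bullet> (s *\<^sub>R n))) (at 0)"
    using diff_chain_at[OF 1 2] by (simp add: o_def)
  then have 3: "((\<lambda>s. norm (y + s *\<^sub>R n)) has_real_derivative (y \<bullet> n) / norm y) (at 0)"
  proof -
    have "(\<lambda>s. sgn y \<bullet> (s *\<^sub>R n)) = (*) ((y \<bullet> n) / norm y)"
      by (auto simp: fun_eq_iff sgn_div_norm divide_inverse)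
    then show ?thesis using \<open>((\<lambda>s. norm (y + s *\<^sub>R n)) has_derivative _) (at 0)\<close>
      unfolding has_field_derivative_def by (simp only:)
  qed
  show ?thesis by (rule DERIV_chain2[OF _ 3]) (use g in simp)
qed

lemma dens_cont:
  assumes c: "continuous_on UNIV f" and z: "\<And>y. R < norm y \<Longrightarrow> f y = 0"
  obtains M where "dens R M f"
proof -
  obtain M where M: "0 < M" "\<And>y. y \<in> cball 0 R \<Longrightarrow> \<bar>f y\<bar> \<le> M"
    using abs_bounded_on_compact[OF compact_cball continuous_on_subset[OF c subset_UNIV]] by blast
  have "dens R M f" unfolding dens_def
  proof (intro conjI allI impI)
    show "f \<in> borel_measurable borel" using c by (rule borel_measurable_continuous_onI)
    show "\<bar>f y\<bar> \<le> M" for y using M z[of y] by (cases "norm y \<le> R") auto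
  qed (use z in auto)
  then show ?thesis by (rule that)
qed

context lane_emden_profile
begin

definition P3 :: "real^3 \<Rightarrow> real" where "P3 y = lextp (norm y)"

definition q3 :: "real^3 \<Rightarrow> real" where "q3 y = \<nu> * pos_pow (\<nu> - 1) (lext (norm y))"

abbreviation qm :: "(real^3 \<Rightarrow> real) \<Rightarrow> real^3 \<Rightarrow> real" where
  "qm h \<equiv> \<lambda>y. q3 y * h y"

text \<open>Minus the derivative of \<open>lext (norm y)\<close> in direction n: the radial
  derivative from \<open>lext_deriv\<close> times the cosine (y \<bullet> n) / |y|. At the origin
  division by zero gives 0, which agrees with the limit.\<close>

definition w3 :: "real^3 \<Rightarrow> real^3 \<Rightarrow> real" where
  "w3 n y = le_mass (norm y) / norm y ^ 3 * (y \<bullet> n)"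

lemma P3_cont: "continuous_on UNIV P3"
  unfolding P3_def[abs_def] by (rule continuous_norm_fun[OF lext_pow_cont])

lemma lext_pow_cont1: "continuous_on {0..} (\<lambda>s. pos_pow (\<nu> - 1) (lext s))"
  by (rule continuous_on_pos_pow[OF _ lext_cont]) (use nu2 in simp)

lemma q3_cont: "continuous_on UNIV q3"
  unfolding q3_def[abs_def] by (intro continuous_intros continuous_norm_fun lext_pow_cont1)

lemma q3_nonneg: "0 \<le> q3 y" using nu by (simp add: q3_def)

lemma q3_pos: "norm y < \<xi> \<Longrightarrow> 0 < q3 y"
  using lext_pos[of "norm y"] nu by (simp add: q3_def)

lemma P3_0: "\<xi> < norm y \<Longrightarrow> P3 y = 0" and q3_0: "\<xi> \<le> norm y \<Longrightarrow> q3 y = 0"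
  using lext_nonpos[of "norm y"] by (auto simp: P3_def q3_def max_def)

text \<open>The unperturbed equation on all of three-space: \<open>lext_integral_equation\<close>
  has exactly the form in which Newton's theorem delivers the potential.\<close>

lemma P3_potential: "pot P3 x - pot P3 0 = 4 * pi * (lext (norm x) - 1)"
proof (cases "x = 0")
  case False
  then have r: "0 < norm x" by simp
  obtain M where M: "dens \<xi> M P3" using dens_cont[OF P3_cont P3_0] .
  let ?\<phi> = "\<lambda>s. lextp (max 0 s)"
  have "pot P3 x - pot P3 0 = 4 * pi * (LBINT s:{0..norm x}. ?\<phi> s * (s\<^sup>2 / norm x - s))"
  proof (rule pot_radial_diff[OF M _ _ r])
    show "?\<phi> \<in> borel_measurable borel"
      by (intro borel_measurable_continuous_onI continuous_norm_fun[OF lext_pow_cont])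
  qed (simp add: P3_def)
  also have "(LBINT s:{0..norm x}. ?\<phi> s * (s\<^sup>2 / norm x - s)) = (LBINT s:{0..norm x}. lextp s * (s\<^sup>2 / norm x - s))"
    by (rule set_lebesgue_integral_cong) auto
  also have "\<dots> = lext (norm x) - 1" using lext_integral_equation[OF r] by simp
  finally show ?thesis .
qed (simp add: lext_0)

lemma lext_pow_deriv:
  assumes "0 < t"
  shows "((\<lambda>t. lextp t) has_real_derivative
     \<nu> * pos_pow (\<nu> - 1) (lext t) * (- le_mass t / t\<^sup>2)) (at t)"
  using DERIV_chain2[OF pos_pow_deriv lext_deriv[OF assms], of \<nu>] nu2 by simp

text \<open>The mass is at most B t^3, so the derivative of the profile stays bounded near the
  centre; beyond \<xi> the positive part is zero. The Lipschitz constant dominates the difference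
  quotients in \<open>w3_eigen\<close>.\<close>

lemma lext_pow_lipschitz:
  obtains \<Lambda> where "0 < \<Lambda>" "\<And>a b. 0 \<le> a \<Longrightarrow> 0 \<le> b \<Longrightarrow> \<bar>lextp a - lextp b\<bar> \<le> \<Lambda> * \<bar>a - b\<bar>"
proof -
  obtain B where B: "0 < B" "\<And>s. s \<in> {0..\<xi>} \<Longrightarrow> \<bar>lextp s\<bar> \<le> B"
    using lext_pow_bound[of \<xi>] xi_pos by auto
  have "continuous_on {0..\<xi>} (\<lambda>s. \<nu> * pos_pow (\<nu> - 1) (lext s))"
    by (intro continuous_intros continuous_on_subset[OF lext_pow_cont1]) auto
  from abs_bounded_on_compact[OF compact_Icc this]
  obtain C where C: "0 < C" "\<And>s. s \<in> {0..\<xi>} \<Longrightarrow> \<bar>\<nu> * pos_pow (\<nu> - 1) (lext s)\<bar> \<le> C" by blast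
  define \<Lambda> where "\<Lambda> = C * (B * \<xi>)"
  have \<Lambda>: "0 < \<Lambda>" using B(1) C(1) xi_pos by (simp add: \<Lambda>_def)
  have bd: "\<bar>\<nu> * pos_pow (\<nu> - 1) (lext t) * (- le_mass t / t\<^sup>2)\<bar> \<le> \<Lambda>" if t: "0 < t" for t
  proof (cases "t \<le> \<xi>")
    case True
    have "\<bar>le_mass t\<bar> \<le> B * t ^ 3" by (rule abs_le_mass(1)) (use B(2) t True in auto)
    then have "\<bar>- le_mass t / t\<^sup>2\<bar> \<le> B * t" using t
      by (simp add: field_simps power2_eq_square power3_eq_cube)
    also have "\<dots> \<le> B * \<xi>" using True B by simp
    finally show ?thesis unfolding \<Lambda>_def abs_mult[of "\<nu> * _"] using C t True
      by (intro mult_mono) auto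
  next
    case False
    then have "max 0 (lext t) = 0" using lext_nonpos[of t] by auto
    then show ?thesis using \<Lambda> by simp
  qed
  have *: "\<bar>lextp b - lextp a\<bar> \<le> \<Lambda> * (b - a)" if ab: "0 \<le> a" "a < b" for a b
  proof -
    have c: "continuous_on {a..b} (\<lambda>t. lextp t)" by (rule continuous_on_subset[OF lext_pow_cont]) (use ab in auto)
    have d: "((\<lambda>t. lextp t) has_derivative (\<lambda>h. (\<nu> * pos_pow (\<nu> - 1) (lext t) * (- le_mass t / t\<^sup>2)) * h)) (at t)"
      if "a < t" "t < b" for t
    proof -
      have "0 < t" using that ab by simp
      from lext_pow_deriv[OF this] show ?thesis unfolding has_field_derivative_def .
    qed
    from mvt[OF ab(2) c d] obtain t where t: "a < t" "t < b" "lextp b - lextp a =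
        (\<nu> * pos_pow (\<nu> - 1) (lext t) * (- le_mass t / t\<^sup>2)) * (b - a)"
      by blast
    show ?thesis unfolding t(3) abs_mult[of _ "b - a"] using bd[of t] t ab \<Lambda> by (intro mult_mono) auto
  qed
  show ?thesis
  proof (rule that[OF \<Lambda>])
    fix a b :: real assume "0 \<le> a" "0 \<le> b"
    then show "\<bar>lextp a - lextp b\<bar> \<le> \<Lambda> * \<bar>a - b\<bar>"
      using *[of a b] *[of b a] by (cases a b rule: linorder_cases) (auto simp: abs_minus_commute)
  qed
qed

text \<open>The cubic decay of the mass at the centre cancels the denominator |y|^3.\<close>

lemma w3_bound:
  obtains N where "0 < N" "\<And>n y. norm n = 1 \<Longrightarrow> norm y \<le> \<xi> \<Longrightarrow> \<bar>w3 n y\<bar> \<le> N"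
proof -
  obtain B where B: "0 < B" "\<And>s. s \<in> {0..\<xi>} \<Longrightarrow> \<bar>lextp s\<bar> \<le> B"
    using lext_pow_bound[of \<xi>] xi_pos by auto
  show ?thesis
  proof (rule that)
    show "0 < B * \<xi>" using B xi_pos by simp
    fix n y :: "real^3" assume n: "norm n = 1" and y: "norm y \<le> \<xi>"
    show "\<bar>w3 n y\<bar> \<le> B * \<xi>"
    proof (cases "y = 0")
      case False
      then have r: "0 < norm y" by simp
      have "\<bar>le_mass (norm y)\<bar> \<le> B * norm y ^ 3" by (rule abs_le_mass(1)[OF r]) (use B(2) y in auto)
      then have "\<bar>le_mass (norm y) / norm y ^ 3\<bar> \<le> B" using r by (simp add: field_simps)
      moreover have "\<bar>y \<bullet> n\<bar> \<le> \<xi>" using Cauchy_Schwarz_ineq2[of y n] n y by simp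
      ultimately show ?thesis unfolding w3_def abs_mult[of _ "y \<bullet> n"] using B by (intro mult_mono) auto
    qed (use B xi_pos in \<open>simp add: w3_def\<close>)
  qed
qed

lemma le_mass_cont: "continuous_on {0..} (\<lambda>r. le_mass r)"
proof -
  have "continuous (at x within {0..}) le_mass" if "0 \<le> x" for x
  proof -
    have "continuous_on {0..x+1} le_mass" unfolding le_mass_def
      by (intro indefinite_integral_continuous_1 integrable_continuous_real continuous_intros continuous_on_subset[OF lext_pow_cont]) auto
    then have "continuous (at x within {0..x+1}) le_mass" using that by (simp add: continuous_on_eq_continuous_within)
    moreover have "at x within {0..x+1} = at x within {0..}"
      by (rule at_within_nhd[of x "{..<x+1}"]) auto
    ultimately show ?thesis by (simp add: continuous_within)
  qed
  then show ?thesis by (simp add: continuous_on_eq_continuous_within)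
qed

lemma w3_measurable: "w3 n \<in> borel_measurable borel"
proof -
  have [measurable]: "(\<lambda>y::real^3. le_mass (norm y)) \<in> borel_measurable borel" "(\<lambda>y::real^3. y \<bullet> n) \<in> borel_measurable borel"
    by (intro borel_measurable_continuous_onI continuous_norm_fun le_mass_cont continuous_intros)+
  show ?thesis unfolding w3_def[abs_def] by measurable
qed

lemma dens_q3_w3: obtains M where "\<And>n. norm n = 1 \<Longrightarrow> dens \<xi> M (qm (w3 n))"
proof -
  obtain M where M: "dens \<xi> M q3" using dens_cont[OF q3_cont] q3_0 by (metis less_imp_le)
  obtain N where N: "0 < N" "\<And>n y. norm n = 1 \<Longrightarrow> norm y \<le> \<xi> \<Longrightarrow> \<bar>w3 n y\<bar> \<le> N" using w3_bound by blast
  show ?thesis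
    by (rule that[of "M * N"], rule dens_mult_bounded[OF M w3_measurable]) (use N in auto)
qed

text \<open>Translation invariance of the potential turns the directional derivative of the
  Lane--Emden identity into the statement that minus the directional derivative of the profile is a
  fixed point of the linearised operator (the spherical harmonics of degree one).\<close>

lemma w3_eigen:
  assumes n: "norm n = 1" and x: "x \<noteq> 0"
  shows "pot (qm (w3 n)) x = 4 * pi * w3 n x"
proof -
  obtain \<Lambda> where \<Lambda>: "0 < \<Lambda>" "\<And>a b. 0 \<le> a \<Longrightarrow> 0 \<le> b \<Longrightarrow> \<bar>lextp a - lextp b\<bar> \<le> \<Lambda> * \<bar>a - b\<bar>"
    using lext_pow_lipschitz by blast
  obtain M where M: "dens \<xi> M P3" using dens_cont[OF P3_cont P3_0] .
  obtain N where N: "dens \<xi> N (qm (w3 n))" using dens_q3_w3 n by metis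
  note [measurable] = densD(1)[OF M] densD(1)[OF N]
  define s :: "nat \<Rightarrow> real" where "s k = 1 / real (Suc k)" for k
  have s: "0 < s k" "s k \<le> 1" for k by (auto simp: s_def)
  have s0: "s \<longlonglongrightarrow> 0" unfolding s_def using LIMSEQ_Suc[OF lim_1_over_n[where 'a=real]] by simp
  have sat: "filterlim s (at 0) sequentially"
    unfolding filterlim_at using s0 s by (auto simp: less_imp_neq[OF s(1), symmetric])
  \<comment> \<open>Large enough for the supports of both translated densities, because the steps
    \<open>s k\<close> are at most 1.\<close>
  define \<rho> where "\<rho> = \<xi> + norm x + 1"
  have \<rho>: "0 \<le> \<rho>" using xi_pos by (simp add: \<rho>_def)
  \<comment> \<open>The difference quotient sits on the Lipschitz density and the kernel 1/|y| stays
    fixed, so dominated convergence applies. The derivative of the density may fail to exist at y =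
    x, a single point.\<close>
  let ?d = "\<lambda>k y. (P3 (x + s k *\<^sub>R n - y) - P3 (x - y)) / s k / norm y"
  let ?g = "\<lambda>y::real^3. \<Lambda> * (indicator (cball 0 \<rho>) y / norm y)"
  have dom: "norm (?d k y) \<le> ?g y" for k y
  proof (cases "y \<in> cball 0 \<rho>")
    case True
    have "\<bar>P3 (x + s k *\<^sub>R n - y) - P3 (x - y)\<bar> \<le> \<Lambda> * \<bar>norm (x + s k *\<^sub>R n - y) - norm (x - y)\<bar>"
      unfolding P3_def by (rule \<Lambda>(2)) auto
    also have "\<bar>norm (x + s k *\<^sub>R n - y) - norm (x - y)\<bar> \<le> s k"
      using norm_triangle_ineq3[of "x + s k *\<^sub>R n - y" "x - y"] n s[of k] by (simp add: algebra_simps)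
    finally have "\<bar>P3 (x + s k *\<^sub>R n - y) - P3 (x - y)\<bar> / s k \<le> \<Lambda>"
      using \<Lambda>(1) s[of k] by (simp add: divide_le_eq)
    then have "\<bar>P3 (x + s k *\<^sub>R n - y) - P3 (x - y)\<bar> / s k / norm y \<le> \<Lambda> / norm y"
      by (rule divide_right_mono) simp
    then show ?thesis using True s[of k] by simp
  next
    case False
    then have y: "norm y > \<xi> + norm x + 1" by (simp add: \<rho>_def)
    have "norm y \<le> norm (x - y) + norm x" using norm_triangle_ineq4[of x "x - y"] by simp
    moreover have "norm y \<le> norm (x + s k *\<^sub>R n - y) + norm (x + s k *\<^sub>R n)"
      using norm_triangle_ineq4[of "x + s k *\<^sub>R n" "x + s k *\<^sub>R n - y"] by simp
    moreover have "norm (x + s k *\<^sub>R n) \<le> norm x + 1"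
      using norm_triangle_ineq[of x "s k *\<^sub>R n"] n s[of k] by simp
    ultimately have "P3 (x + s k *\<^sub>R n - y) = 0" "P3 (x - y) = 0" using y by (auto intro!: P3_0)
    then show ?thesis using \<Lambda>(1) by simp
  qed
  have lim: "(\<lambda>k. ?d k y) \<longlonglongrightarrow> - (q3 (x - y) * w3 n (x - y)) / norm y" if "y \<noteq> x" for y
  proof -
    let ?z = "x - y"
    have z: "?z \<noteq> 0" using that by simp
    have "((\<lambda>s. pos_pow \<nu> (lext (norm (?z + s *\<^sub>R n)))) has_real_derivative
       (\<nu> * pos_pow (\<nu> - 1) (lext (norm ?z)) * (- le_mass (norm ?z) / (norm ?z)\<^sup>2)) * ((?z \<bullet> n) / norm ?z)) (at 0)"
      by (rule directional_deriv_norm[OF z lext_pow_deriv]) (use z in simp)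
    also have "(\<nu> * pos_pow (\<nu> - 1) (lext (norm ?z)) * (- le_mass (norm ?z) / (norm ?z)\<^sup>2)) * ((?z \<bullet> n) / norm ?z) = - (q3 ?z * w3 n ?z)"
      by (simp add: q3_def w3_def power2_eq_square power3_eq_cube)
    finally have "((\<lambda>s. (P3 (?z + s *\<^sub>R n) - P3 ?z) / s) \<longlongrightarrow> - (q3 ?z * w3 n ?z)) (at 0)"
      by (simp add: DERIV_def P3_def)
    from filterlim_compose[OF this sat]
    have "(\<lambda>k. (P3 (?z + s k *\<^sub>R n) - P3 ?z) / s k) \<longlonglongrightarrow> - (q3 ?z * w3 n ?z)" .
    from tendsto_mult[OF this tendsto_const[of "1 / norm y"]]
    have "(\<lambda>k. (P3 (?z + s k *\<^sub>R n) - P3 ?z) / s k / norm y) \<longlonglongrightarrow> - (q3 ?z * w3 n ?z) / norm y" by simp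
    then show ?thesis by (simp add: algebra_simps)
  qed
  have conv: "(\<lambda>k. integral\<^sup>L lborel (?d k)) \<longlonglongrightarrow> (\<integral>y. - (q3 (x - y) * w3 n (x - y)) / norm y \<partial>lborel)"
  proof (rule integral_dominated_convergence[where w="?g"])
    show "integrable lborel ?g" by (intro integrable_mult_right riesz_ball_0 \<rho>)
    show "AE y in lborel. (\<lambda>k. ?d k y) \<longlonglongrightarrow> - (q3 (x - y) * w3 n (x - y)) / norm y"
      using AE_lborel_singleton[of x] by eventually_elim (rule lim)
    show "AE y in lborel. norm (?d k y) \<le> ?g y" for k by (intro AE_I2 dom)
  qed measurable
  have int: "integral\<^sup>L lborel (?d k) = (pot P3 (x + s k *\<^sub>R n) - pot P3 x) / s k" for k
  proof -
    have i: "integrable lborel (\<lambda>y. P3 (z - y) / norm y)" for z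
    proof -
      have m: "(\<lambda>y. P3 y / norm (z - y)) \<in> borel_measurable borel" by measurable
      show ?thesis using integral_shift_reflect(1)[OF m, of z] integrable_pot[OF M, of z] by simp
    qed
    have "integral\<^sup>L lborel (?d k) = (\<integral>y. (P3 (x + s k *\<^sub>R n - y) / norm y - P3 (x - y) / norm y) / s k \<partial>lborel)"
      by (rule Bochner_Integration.integral_cong) (simp_all add: diff_divide_distrib mult.commute)
    also have "\<dots> = ((\<integral>y. P3 (x + s k *\<^sub>R n - y) / norm y \<partial>lborel) - (\<integral>y. P3 (x - y) / norm y \<partial>lborel)) / s k"
      by (simp only: integral_divide_zero Bochner_Integration.integral_diff[OF i i])
    finally show ?thesis by (simp only: pot_shift[OF densD(1)[OF M], symmetric])
  qed
  have "pot P3 (x + s k *\<^sub>R n) - pot P3 x = 4 * pi * (lext (norm (x + s k *\<^sub>R n)) - lext (norm x))" for k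
    using P3_potential[of "x + s k *\<^sub>R n"] P3_potential[of x] by (simp add: right_diff_distrib)
  then have eq: "integral\<^sup>L lborel (?d k) = 4 * pi * ((lext (norm (x + s k *\<^sub>R n)) - lext (norm x)) / s k)" for k
    unfolding int by simp
  have "((\<lambda>s. lext (norm (x + s *\<^sub>R n))) has_real_derivative (- le_mass (norm x) / (norm x)\<^sup>2) * ((x \<bullet> n) / norm x)) (at 0)"
    by (rule directional_deriv_norm[OF x lext_deriv]) (use x in simp)
  also have "(- le_mass (norm x) / (norm x)\<^sup>2) * ((x \<bullet> n) / norm x) = - w3 n x"
    by (simp add: w3_def power2_eq_square power3_eq_cube)
  finally have "((\<lambda>s. (lext (norm (x + s *\<^sub>R n)) - lext (norm x)) / s) \<longlongrightarrow> - w3 n x) (at 0)"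
    by (simp add: DERIV_def)
  from filterlim_compose[OF this sat]
  have "(\<lambda>k. 4 * pi * ((lext (norm (x + s k *\<^sub>R n)) - lext (norm x)) / s k)) \<longlonglongrightarrow> 4 * pi * (- w3 n x)"
    by (intro tendsto_mult tendsto_const)
  then have "(\<lambda>k. integral\<^sup>L lborel (?d k)) \<longlonglongrightarrow> 4 * pi * (- w3 n x)" by (simp only: eq)
  from LIMSEQ_unique[OF conv this]
  have "(\<integral>y. - (q3 (x - y) * w3 n (x - y)) / norm y \<partial>lborel) = 4 * pi * (- w3 n x)" .
  then have "- (\<integral>y. (q3 (x - y) * w3 n (x - y)) / norm y \<partial>lborel) = 4 * pi * (- w3 n x)"
    by (simp only: minus_divide_left[symmetric] Bochner_Integration.integral_minus)
  moreover have "pot (qm (w3 n)) x = (\<integral>y. (q3 (x - y) * w3 n (x - y)) / norm y \<partial>lborel)"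
    using pot_shift[OF densD(1)[OF N], of x] .
  ultimately show ?thesis by simp
qed

end

section \<open>Injectivity of the linearisation\<close>

lemma integral_pos_open:
  fixes G :: "'a::euclidean_space \<Rightarrow> real"
  assumes i: "integrable lborel G" and nn: "AE y in lborel. 0 \<le> G y"
    and U: "open U" "U \<noteq> {}" and pos: "AE y in lborel. y \<in> U \<longrightarrow> 0 < G y"
  shows "0 < integral\<^sup>L lborel G"
proof -
  have "0 \<le> integral\<^sup>L lborel G" by (rule integral_nonneg_AE[OF nn])
  moreover have "integral\<^sup>L lborel G \<noteq> 0"
  proof
    assume "integral\<^sup>L lborel G = 0"
    then have "AE y in lborel. G y = 0" using integral_nonneg_eq_0_iff_AE[OF i nn] by simp
    with pos have "AE y in lborel. y \<notin> U" by eventually_elim auto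
    then have "U \<in> null_sets lborel" using AE_iff_null_sets[of U lborel] U(1) by simp
    then have "negligible U" by (simp add: negligible_iff_null_sets null_sets_completionI)
    then show False using open_not_negligible[OF U] by simp
  qed
  ultimately show ?thesis by linarith
qed

section \<open>Reflections in planes and potentials of odd densities\<close>

definition mirror :: "real^3 \<Rightarrow> real^3 \<Rightarrow> real^3" where
  "mirror n x = x - (2 * (x \<bullet> n)) *\<^sub>R n"

lemma mirror_inner:
  assumes "norm n = 1" shows "mirror n x \<bullet> n = - (x \<bullet> n)"
proof -
  have "n \<bullet> n = 1" using assms by (simp add: norm_eq_1)
  then show ?thesis by (simp add: mirror_def inner_diff_left)
qed

lemma mirror_mirror: "norm n = 1 \<Longrightarrow> mirror n (mirror n x) = x"
  using mirror_inner[of n x] by (simp add: mirror_def)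

lemma inner_mirror_mirror:
  assumes "norm n = 1" shows "mirror n x \<bullet> mirror n y = x \<bullet> y"
proof -
  have "n \<bullet> n = 1" using assms by (simp add: norm_eq_1)
  then show ?thesis by (simp add: mirror_def inner_diff_left inner_diff_right inner_commute[of n y])
qed

lemma orthogonal_mirror:
  assumes "norm n = 1" shows "orthogonal_transformation (mirror n)"
  unfolding orthogonal_transformation_def
proof (intro conjI allI linearI)
  show "mirror n v \<bullet> mirror n w = v \<bullet> w" for v w by (rule inner_mirror_mirror[OF assms])
qed (simp_all add: mirror_def inner_add_left algebra_simps)

lemma norm_mirror: "norm n = 1 \<Longrightarrow> norm (mirror n x) = norm x"
  using orthogonal_mirror[of n] by (simp add: orthogonal_transformation_norm)

lemma continuous_mirror: "continuous_on UNIV (mirror n)"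
  unfolding mirror_def[abs_def] by (intro continuous_intros)

text \<open>Two distinct points on a sphere are exchanged by the reflection whose normal is their
  difference. Radial and axial symmetry can therefore both be tested by reflections alone.\<close>

lemma mirror_swap:
  fixes x y :: "real^3"
  assumes xy: "norm x = norm y" "x \<noteq> y"
  defines "n \<equiv> (x - y) /\<^sub>R norm (x - y)"
  shows "norm n = 1" "mirror n x = y"
proof -
  have d: "0 < norm (x - y)" using assms by simp
  show n: "norm n = 1" using d by (simp add: n_def)
  have "(norm (x - y))\<^sup>2 = 2 * (x \<bullet> (x - y))"
    using xy by (simp add: power2_norm_eq_inner inner_diff_left inner_diff_right inner_commute norm_eq)
  moreover have "x \<bullet> n = (x \<bullet> (x - y)) / norm (x - y)" by (simp add: n_def divide_inverse)
  ultimately have "norm (x - y) * norm (x - y) = (2 * (x \<bullet> n)) * norm (x - y)" using d by (simp add: power2_eq_square)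
  then have "2 * (x \<bullet> n) = norm (x - y)" using d by (metis less_numeral_extra(3) mult_right_cancel)
  then show "mirror n x = y" using d by (simp add: mirror_def n_def)
qed

text \<open>The sign of (x \<bullet> n) * (y \<bullet> n) decides whether y or its mirror image is
  closer to x; this is the positivity of the kernel on odd functions.\<close>

lemma mirror_dist:
  assumes n: "norm n = 1"
  shows "(norm (x - mirror n y))\<^sup>2 - (norm (x - y))\<^sup>2 = 4 * (x \<bullet> n) * (y \<bullet> n)"
proof -
  have "(norm (x - mirror n y))\<^sup>2 - (norm (x - y))\<^sup>2 = 2 * (x \<bullet> y) - 2 * (x \<bullet> mirror n y)"
    using norm_mirror[OF n, of y] by (simp add: dot_norm_neg field_simps)
  then show ?thesis by (simp add: mirror_def inner_diff_right)
qed

text \<open>By oddness, twice the potential at x is the integral of f(y) times the difference of the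
  kernels centred at x and at its mirror image. On each side of the plane f and that difference have
  compatible signs, so the integrand is nonnegative, and it is strictly positive almost everywhere
  on U.\<close>

lemma pot_odd_pos:
  assumes f: "dens R M f" and n: "norm n = 1" and odd: "\<And>y. f (mirror n y) = - f y"
    and nn: "\<And>y. 0 < y \<bullet> n \<Longrightarrow> 0 \<le> f y"
    and U: "open U" "U \<noteq> {}" "\<And>y. y \<in> U \<Longrightarrow> 0 < y \<bullet> n \<and> 0 < f y" and x: "0 < x \<bullet> n"
  shows "0 < pot f x"
proof -
  define G where "G y = f y / norm (x - y) - f y / norm (mirror n x - y)" for y
  have i: "integrable lborel G" unfolding G_def[abs_def]
    by (intro Bochner_Integration.integrable_diff integrable_pot[OF f])
  have nr: "norm (mirror n x - y) = norm (x - mirror n y)" for y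
    using norm_mirror[OF n, of "x - mirror n y"] mirror_mirror[OF n, of y]
      linear_diff[OF orthogonal_transformation_linear[OF orthogonal_mirror[OF n]], of x "mirror n y"] by simp
  have lt: "norm (x - y) < norm (mirror n x - y)" if "0 < y \<bullet> n" for y
  proof -
    have "(norm (x - y))\<^sup>2 < (norm (x - mirror n y))\<^sup>2" using mirror_dist[OF n, of x y] mult_pos_pos[OF x that] by (simp only: mult.assoc)
    then show ?thesis unfolding nr by (rule power2_less_imp_less) simp
  qed
  have gt: "norm (mirror n x - y) < norm (x - y)" if "y \<bullet> n < 0" for y
  proof -
    have "(x \<bullet> n) * (y \<bullet> n) < 0" using x that by (rule mult_pos_neg)
    then have "(norm (x - mirror n y))\<^sup>2 < (norm (x - y))\<^sup>2" using mirror_dist[OF n, of x y] by (simp only: mult.assoc)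
    then show ?thesis unfolding nr by (rule power2_less_imp_less) simp
  qed
  have "0 < integral\<^sup>L lborel G"
  proof (rule integral_pos_open[OF i _ U(1,2)])
    show "AE y in lborel. 0 \<le> G y"
      using AE_lborel_singleton[of x] AE_lborel_singleton[of "mirror n x"]
    proof eventually_elim
      case (elim y)
      consider "0 < y \<bullet> n" | "y \<bullet> n < 0" | "y \<bullet> n = 0" by linarith
      then show ?case
      proof cases
        case 1
        then show ?thesis unfolding G_def using nn[OF 1] lt[OF 1] elim by (simp add: divide_left_mono)
      next
        case 2
        have "0 < mirror n y \<bullet> n" using 2 mirror_inner[OF n, of y] by simp
        then have "f y \<le> 0" using nn[of "mirror n y"] odd[of y] by simp
        moreover have "1 / norm (x - y) \<le> 1 / norm (mirror n x - y)" using gt[OF 2] elim by (intro frac_le) auto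
        ultimately have "f y * (1 / norm (mirror n x - y)) \<le> f y * (1 / norm (x - y))" by (rule mult_left_mono_neg[rotated])
        then show ?thesis by (simp add: G_def)
      next
        case 3
        then have "mirror n y = y" by (simp add: mirror_def)
        then have "f y = 0" using odd[of y] by simp
        then show ?thesis by (simp add: G_def)
      qed
    qed
    show "AE y in lborel. y \<in> U \<longrightarrow> 0 < G y"
      using AE_lborel_singleton[of x]
    proof eventually_elim
      case (elim y)
      show ?case
      proof
        assume "y \<in> U"
        then have y: "0 < y \<bullet> n" "0 < f y" using U(3) by auto
        have "f y / norm (mirror n x - y) < f y / norm (x - y)"
        proof (intro divide_strict_left_mono mult_pos_pos)
          show "0 < norm (x - y)" using elim by simp
          then show "0 < norm (mirror n x - y)" using lt[OF y(1)] by linarith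
        qed (use y lt[OF y(1)] in auto)
        then show "0 < G y" by (simp add: G_def)
      qed
    qed
  qed
  also have "integral\<^sup>L lborel G = pot f x - pot f (mirror n x)"
    unfolding G_def[abs_def] pot_def by (intro Bochner_Integration.integral_diff integrable_pot[OF f])
  also have "pot f (mirror n x) = pot (\<lambda>y. f (mirror n y)) x"
    by (rule pot_orthogonal[OF densD(1)[OF f] orthogonal_mirror[OF n]])
  also have "\<dots> = - pot f x" by (simp add: odd pot_def)
  finally show ?thesis by simp
qed

definition npot :: "(real^3 \<Rightarrow> real) \<Rightarrow> real^3 \<Rightarrow> real" where
  "npot f x = (pot f x - pot f 0) / (4 * pi)"

lemma pot_add: "dens R M f \<Longrightarrow> dens R' M' g \<Longrightarrow> pot (\<lambda>y. f y + g y) x = pot f x + pot g x"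
  unfolding pot_def by (simp add: add_divide_distrib integrable_pot)

lemma pot_diff: "dens R M f \<Longrightarrow> dens R' M' g \<Longrightarrow> pot (\<lambda>y. f y - g y) x = pot f x - pot g x"
  unfolding pot_def by (simp add: diff_divide_distrib integrable_pot)

lemma dens_add: "dens R M f \<Longrightarrow> dens R M' g \<Longrightarrow> dens R (M + M') (\<lambda>y. f y + g y)"
  unfolding dens_def by (auto intro!: order_trans[OF abs_triangle_ineq] add_mono)

lemma dens_diff: "dens R M f \<Longrightarrow> dens R M' g \<Longrightarrow> dens R (M + M') (\<lambda>y. f y - g y)"
  unfolding dens_def by (auto intro!: order_trans[OF abs_triangle_ineq4] add_mono)

text \<open>Weight |\<eta>| by exp (-2 C s) and let m be a maximum point of the result k. The bound
  k m * exp (2 C s) for |\<eta>| integrates to at most k m * exp (2 C m) / (2 C), so the hypothesis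
  at m gives k m \<le> k m / 2.\<close>

lemma gronwall_zero:
  fixes \<eta> :: "real \<Rightarrow> real"
  assumes c: "continuous_on {0..b} \<eta>" and b: "0 \<le> b" and C: "0 < C"
    and le: "\<And>r. r \<in> {0..b} \<Longrightarrow> \<bar>\<eta> r\<bar> \<le> C * integral {0..r} (\<lambda>s. \<bar>\<eta> s\<bar>)"
    and r: "r \<in> {0..b}"
  shows "\<eta> r = 0"
proof -
  define k where "k s = \<bar>\<eta> s\<bar> * exp (- (2 * C) * s)" for s
  have "continuous_on {0..b} k" unfolding k_def[abs_def] by (intro continuous_intros c)
  then obtain m where m: "m \<in> {0..b}" "\<And>s. s \<in> {0..b} \<Longrightarrow> k s \<le> k m"
    using continuous_attains_sup[of "{0..b}" k] b by auto
  have bd: "\<bar>\<eta> s\<bar> \<le> k m * exp (2 * C * s)" if "s \<in> {0..b}" for s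
  proof -
    have "\<bar>\<eta> s\<bar> = k s * exp (2 * C * s)" by (simp add: k_def mult.assoc exp_add[symmetric])
    then show ?thesis using m(2)[OF that] by simp
  qed
  have "((\<lambda>s. k m * exp (2 * C * s)) has_integral (k m / (2 * C) * exp (2 * C * m) - k m / (2 * C) * exp (2 * C * 0))) {0..m}"
    using m C by (intro fundamental_theorem_of_calculus)
      (auto intro!: derivative_eq_intros simp: has_real_derivative_iff_has_vector_derivative[symmetric])
  then have "integral {0..m} (\<lambda>s. k m * exp (2 * C * s)) = k m / (2 * C) * exp (2 * C * m) - k m / (2 * C) * exp (2 * C * 0)"
    by (rule integral_unique)
  moreover have "integral {0..m} (\<lambda>s. \<bar>\<eta> s\<bar>) \<le> integral {0..m} (\<lambda>s. k m * exp (2 * C * s))"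
    using m bd by (intro integral_le integrable_continuous_real continuous_intros continuous_on_subset[OF c]) auto
  ultimately have "integral {0..m} (\<lambda>s. \<bar>\<eta> s\<bar>) \<le> k m / (2 * C) * exp (2 * C * m) - k m / (2 * C)"
    by (simp del: Henstock_Kurzweil_Integration.integral_mult_right)
  moreover have "0 \<le> k m" by (simp add: k_def)
  ultimately have "integral {0..m} (\<lambda>s. \<bar>\<eta> s\<bar>) \<le> k m / (2 * C) * exp (2 * C * m)" using C
    by (smt (verit) divide_nonneg_pos)
  then have "\<bar>\<eta> m\<bar> \<le> C * (k m / (2 * C) * exp (2 * C * m))"
    using le[OF m(1)] C by (meson mult_left_mono less_imp_le order_trans)
  also have "\<dots> = k m / 2 * exp (2 * C * m)" using C by simp
  finally have "k m \<le> k m / 2 * exp (2 * C * m) * exp (- (2 * C) * m)"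
    unfolding k_def by (intro mult_right_mono) (auto simp: k_def)
  also have "\<dots> = k m / 2" by (simp add: mult.assoc exp_add[symmetric])
  finally have "k m \<le> 0" by simp
  then show ?thesis using bd[OF r] by (smt (verit) exp_gt_zero mult_nonpos_nonneg)
qed

context lane_emden_profile
begin

definition Lop :: "(real^3 \<Rightarrow> real) \<Rightarrow> real^3 \<Rightarrow> real" where
  "Lop h = npot (qm h)"

lemma dens_q3_mult:
  assumes "h \<in> borel_measurable borel" "\<And>y. norm y \<le> \<xi> \<Longrightarrow> \<bar>h y\<bar> \<le> N"
  obtains M where "dens \<xi> M (qm h)"
proof -
  obtain M where M: "dens \<xi> M q3" using dens_cont[OF q3_cont] q3_0 by (metis less_imp_le)
  have "0 \<le> N" using assms(2)[of 0] xi_pos by simp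
  then show ?thesis using that dens_mult_bounded[OF M assms] by blast
qed

lemma dens_q3_cont:
  assumes h: "continuous_on UNIV h"
  obtains M where "dens \<xi> M (qm h)"
  by (rule dens_cont[of "\<lambda>y. q3 y * h y"]) (use h q3_cont q3_0 in \<open>auto intro!: continuous_intros\<close>)

lemma q3_mirror: "norm n = 1 \<Longrightarrow> q3 (mirror n y) = q3 y"
  by (simp add: q3_def norm_mirror)

lemma w3_sign:
  assumes "0 < y \<bullet> n" shows "0 \<le> w3 n y" and "norm y < \<xi> \<Longrightarrow> 0 < w3 n y"
proof -
  have y: "y \<noteq> 0" using assms by auto
  have m: "0 \<le> le_mass r" if "0 < r" for r
  proof (cases "r \<le> \<xi>")
    case False
    then show ?thesis using le_mass_outside[of r] le_mass_pos[of \<xi>] xi_pos by simp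
  qed (use le_mass_pos[of r] that in simp)
  show "0 \<le> w3 n y" using m[of "norm y"] y assms by (simp add: w3_def)
  show "0 < w3 n y" if "norm y < \<xi>" using le_mass_pos[of "norm y"] y assms that by (simp add: w3_def)
qed

lemma w3_odd: "norm n = 1 \<Longrightarrow> w3 n (mirror n y) = - w3 n y"
  by (simp add: w3_def norm_mirror mirror_inner)

text \<open>If \<open>g = h - h \<circ> mirror n\<close> did not vanish, then \<open>\<bar>g\<bar>\<close> would be a strict subsolution on the
  half space, which contradicts the symmetry of the potential when tested against \<open>q3 * w3 n\<close>.\<close>

lemma Lop_reflection_symmetric:
  assumes h: "continuous_on UNIV h" and even: "\<And>x. h (- x) = h x"
    and t: "0 \<le> t" "t \<le> 1" and eq: "\<And>x. h x = t * Lop h x" and n: "norm n = 1" and x: "norm x < \<xi>"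
  shows "h (mirror n x) = h x"
proof (rule ccontr)
  assume ne: "h (mirror n x) \<noteq> h x"
  define g where "g x = h x - h (mirror n x)" for x
  have gc: "continuous_on UNIV g" unfolding g_def[abs_def]
    by (intro continuous_intros h continuous_on_compose2[OF h continuous_mirror]) auto
  have g_odd: "g (mirror n y) = - g y" for y by (simp add: g_def mirror_mirror[OF n])
  have mirror_minus: "mirror n (- y) = - mirror n y" for y by (simp add: mirror_def algebra_simps)
  \<comment> \<open>The map -\<open>mirror n\<close> is the half-turn about n. It preserves the half
    space y \<bullet> n > 0, and evenness of h makes g change sign under it. Hence a nonzero g takes
    both signs on the half space.\<close>
  have g_turn: "g (- mirror n y) = - g y" for y
    by (simp add: g_def mirror_minus mirror_mirror[OF n] even)
  \<comment> \<open>The odd extension of |g| from the half space, so that \<open>pot_odd_pos\<close>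
    applies to sums of \<open>a\<close> with g or -g.\<close>
  define a where "a y = sgn (y \<bullet> n) * \<bar>g y\<bar>" for y
  have a_odd: "a (mirror n y) = - a y" for y
    by (simp add: a_def g_odd mirror_inner[OF n] sgn_minus)
  have gm: "g \<in> borel_measurable borel" using gc by (rule borel_measurable_continuous_onI)
  have am: "a \<in> borel_measurable borel"
  proof -
    note [measurable] = gm
    have "(\<lambda>y. y \<bullet> n) \<in> borel_measurable borel" by (intro borel_measurable_continuous_onI continuous_intros)
    note [measurable] = this
    have "a = (\<lambda>y. if 0 < y \<bullet> n then \<bar>g y\<bar> else if y \<bullet> n < 0 then - \<bar>g y\<bar> else 0)"
      by (auto simp: a_def sgn_if fun_eq_iff)
    also have "\<dots> \<in> borel_measurable borel" by measurable
    finally show ?thesis .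
  qed
  obtain N where N: "\<And>y. norm y \<le> \<xi> \<Longrightarrow> \<bar>g y\<bar> \<le> N"
  proof -
    from abs_bounded_on_compact[OF compact_cball continuous_on_subset[OF gc subset_UNIV]]
    obtain B where "\<And>y. y \<in> cball 0 \<xi> \<Longrightarrow> \<bar>g y\<bar> \<le> B" by blast
    then show ?thesis using that[of B] by simp
  qed
  have aN: "\<bar>a y\<bar> \<le> N" if "norm y \<le> \<xi>" for y
    using N[OF that] by (auto simp: a_def abs_mult sgn_if)
  obtain Mg where Mg: "dens \<xi> Mg (qm g)" using dens_q3_mult[OF gm N] .
  obtain Ma where Ma: "dens \<xi> Ma (qm a)" using dens_q3_mult[OF am aN] .
  obtain Mh where Mh: "dens \<xi> Mh (qm h)" using dens_q3_cont[OF h] .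
  have hr: "continuous_on UNIV (\<lambda>y. h (mirror n y))" by (rule continuous_on_compose2[OF h continuous_mirror]) auto
  obtain Mr where Mr: "dens \<xi> Mr (\<lambda>y. q3 y * h (mirror n y))" using dens_q3_cont[OF hr] .
  have g_eq: "4 * pi * g y = t * pot (qm g) y" for y
  proof -
    have "pot (qm h) (mirror n y) = pot (\<lambda>y. q3 y * h (mirror n y)) y"
      using pot_orthogonal[OF densD(1)[OF Mh] orthogonal_mirror[OF n], of y] by (simp add: q3_mirror[OF n])
    then have "4 * pi * g y = t * (pot (qm h) y - pot (\<lambda>y. q3 y * h (mirror n y)) y)"
      unfolding g_def eq[of y] eq[of "mirror n y"] Lop_def npot_def by (simp add: field_simps)
    also have "pot (qm h) y - pot (\<lambda>y. q3 y * h (mirror n y)) y = pot (qm g) y"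
      unfolding pot_diff[OF Mh Mr, symmetric] by (simp add: g_def right_diff_distrib)
    finally show ?thesis .
  qed
  have x_ne: "g x \<noteq> 0" using ne by (simp add: g_def)
  have "\<exists>y. 0 < y \<bullet> n \<and> norm y < \<xi> \<and> g y \<noteq> 0"
  proof -
    consider "0 < x \<bullet> n" | "x \<bullet> n < 0" | "x \<bullet> n = 0" by linarith
    then show ?thesis
    proof cases
      case 2
      then show ?thesis using x x_ne by (intro exI[of _ "mirror n x"]) (simp add: mirror_inner[OF n] norm_mirror[OF n] g_odd)
    next
      case 3
      then have "mirror n x = x" by (simp add: mirror_def)
      then show ?thesis using x_ne by (simp add: g_def)
    qed (use x x_ne in blast)
  qed
  then obtain y0 where y0: "0 < y0 \<bullet> n" "norm y0 < \<xi>" "g y0 \<noteq> 0" by blast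
  have y0': "0 < (- mirror n y0) \<bullet> n" "norm (- mirror n y0) < \<xi>" "g (- mirror n y0) = - g y0"
    using y0 by (simp_all add: mirror_inner[OF n] norm_mirror[OF n] g_turn)
  have op: "open {y. 0 < y \<bullet> n \<and> norm y < \<xi> \<and> 0 < f y}" if f: "continuous_on UNIV f" for f :: "real^3 \<Rightarrow> real"
    by (intro open_Collect_conj open_Collect_less continuous_intros f)
  have ne12: "{y. 0 < y \<bullet> n \<and> norm y < \<xi> \<and> 0 < g y} \<noteq> {} \<and> {y. 0 < y \<bullet> n \<and> norm y < \<xi> \<and> 0 < - g y} \<noteq> {}"
  proof (cases "0 < g y0")
    case True
    then have "y0 \<in> {y. 0 < y \<bullet> n \<and> norm y < \<xi> \<and> 0 < g y}"
      "- mirror n y0 \<in> {y. 0 < y \<bullet> n \<and> norm y < \<xi> \<and> 0 < - g y}" using y0 y0' by auto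
    then show ?thesis by blast
  next
    case False
    then have "- mirror n y0 \<in> {y. 0 < y \<bullet> n \<and> norm y < \<xi> \<and> 0 < g y}"
      "y0 \<in> {y. 0 < y \<bullet> n \<and> norm y < \<xi> \<and> 0 < - g y}" using y0 y0' by auto
    then show ?thesis by blast
  qed
  note ne1 = ne12[THEN conjunct1] and ne2 = ne12[THEN conjunct2]
  \<comment> \<open>Taken with G = g and G = -g, this says that the potential of q |g|, extended
    oddly, strictly exceeds the absolute value of the potential of q g. The two nonempty sets above
    make both applications strict.\<close>
  have pos: "0 < pot (qm a) z + pot (qm G) z"
    if G: "continuous_on UNIV G" "\<And>y. G (mirror n y) = - G y" "\<And>y. \<bar>G y\<bar> = \<bar>g y\<bar>"
      "{y. 0 < y \<bullet> n \<and> norm y < \<xi> \<and> 0 < G y} \<noteq> {}" and z: "0 < z \<bullet> n" for G z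
  proof -
    obtain MG where MG: "dens \<xi> MG (qm G)" using dens_q3_cont[OF G(1)] .
    have a_eq: "a y = \<bar>G y\<bar>" if "0 < y \<bullet> n" for y using that by (simp add: a_def G(3))
    have "0 < pot (\<lambda>y. q3 y * a y + q3 y * G y) z"
    proof (rule pot_odd_pos[OF dens_add[OF Ma MG] n _ _ op[OF G(1)] G(4) _ z])
      show "0 \<le> q3 y * a y + q3 y * G y" if "0 < y \<bullet> n" for y
        using q3_nonneg[of y] by (simp add: a_eq[OF that] flip: distrib_left)
      show "0 < y \<bullet> n \<and> 0 < q3 y * a y + q3 y * G y" if "y \<in> {y. 0 < y \<bullet> n \<and> norm y < \<xi> \<and> 0 < G y}" for y
        using q3_pos[of y] that by (auto simp: a_eq distrib_left[symmetric])
    qed (simp add: q3_mirror[OF n] a_odd G(2))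
    then show ?thesis by (simp add: pot_add[OF Ma MG])
  qed
  note pos1 = pos[OF gc g_odd refl ne1]
  have pos2: "0 < pot (qm a) z - pot (qm g) z" if z: "0 < z \<bullet> n" for z
    using pos[of "\<lambda>y. - g y", OF _ _ _ ne2 z] gc by (simp add: continuous_on_minus g_odd pot_def)
  \<comment> \<open>The defect in the eigenvalue inequality for |g|. It is positive on the half
    space for every t \<le> 1, including t = 1, by the preceding strict domination.\<close>
  define b where "b z = pot (qm a) z - 4 * pi * a z" for z
  have b_pos: "0 < b z" if z: "0 < z \<bullet> n" for z
  proof -
    have "4 * pi * \<bar>g z\<bar> = t * \<bar>pot (qm g) z\<bar>"
      using arg_cong[OF g_eq[of z], of abs] t by (simp add: abs_mult)
    also have "\<dots> \<le> 1 * \<bar>pot (qm g) z\<bar>" using t by (intro mult_right_mono) auto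
    also have "\<dots> < pot (qm a) z" using pos1[OF z] pos2[OF z] by linarith
    finally show ?thesis using z by (simp add: b_def a_def)
  qed
  have b_odd: "b (mirror n z) = - b z" for z
  proof -
    have "pot (qm a) (mirror n z) = pot (\<lambda>y. q3 (mirror n y) * a (mirror n y)) z"
      by (rule pot_orthogonal[OF densD(1)[OF Ma] orthogonal_mirror[OF n]])
    also have "\<dots> = - pot (qm a) z" by (simp add: q3_mirror[OF n] a_odd pot_def)
    finally show ?thesis by (simp add: b_def a_odd)
  qed
  obtain Mw where Mw: "dens \<xi> Mw (qm (w3 n))" using dens_q3_w3 n by metis
  have pm: "pot (qm a) \<in> borel_measurable borel"
    by (rule borel_measurable_continuous_onI[OF continuous_pot[OF Ma]])
  have d1: "integrable lborel (\<lambda>y. (q3 y * w3 n y) * pot (qm a) y)"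
    by (rule integrable_dens[OF dens_mult_bounded[OF Mw pm abs_pot_le[OF Ma]]])
       (use densD(4)[OF Ma] pot_const_pos[of \<xi>] in \<open>simp add: less_imp_le\<close>)
  have N0: "0 \<le> N" using N[of 0] xi_pos by simp
  have d2: "integrable lborel (\<lambda>y. (q3 y * w3 n y) * a y)"
    by (rule integrable_dens[OF dens_mult_bounded[OF Mw am aN N0]])
  have Z_eq: "(\<lambda>y. (q3 y * w3 n y) * b y) = (\<lambda>y. (q3 y * w3 n y) * pot (qm a) y - 4 * pi * ((q3 y * w3 n y) * a y))"
    by (simp add: b_def fun_eq_iff algebra_simps)
  have Zi: "integrable lborel (\<lambda>y. (q3 y * w3 n y) * b y)"
    unfolding Z_eq by (intro Bochner_Integration.integrable_diff d1 integrable_mult_right d2)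
  have "(\<integral>y. (q3 y * w3 n y) * b y \<partial>lborel) =
    (\<integral>y. (q3 y * w3 n y) * pot (qm a) y \<partial>lborel) - (\<integral>y. 4 * pi * ((q3 y * w3 n y) * a y) \<partial>lborel)"
    unfolding Z_eq by (intro Bochner_Integration.integral_diff d1 integrable_mult_right d2)
  \<comment> \<open>Symmetry transfers the potential to \<open>w3 n\<close>, for which it is
    multiplication by 4 * pi away from the origin. The pairing with the defect therefore vanishes,
    although its integrand is nonnegative and positive on an open set.\<close>
  also have "(\<integral>y. (q3 y * w3 n y) * pot (qm a) y \<partial>lborel) = (\<integral>y. (q3 y * a y) * pot (qm (w3 n)) y \<partial>lborel)"
    by (rule pot_symmetric[OF Mw Ma])
  also have "\<dots> = (\<integral>y. 4 * pi * ((q3 y * w3 n y) * a y) \<partial>lborel)"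
  proof (rule integral_cong_AE)
    note [measurable] = densD(1)[OF Ma] borel_measurable_continuous_onI[OF continuous_pot[OF Mw]] densD(1)[OF Mw] am
    show "(\<lambda>y. (q3 y * a y) * pot (qm (w3 n)) y) \<in> borel_measurable lborel" by measurable
    show "(\<lambda>y. 4 * pi * ((q3 y * w3 n y) * a y)) \<in> borel_measurable lborel" by measurable
    show "AE y in lborel. (q3 y * a y) * pot (qm (w3 n)) y = 4 * pi * ((q3 y * w3 n y) * a y)"
      using AE_lborel_singleton[of 0] by eventually_elim (simp add: w3_eigen[OF n])
  qed
  finally have Z0: "(\<integral>y. (q3 y * w3 n y) * b y \<partial>lborel) = 0" by simp
  have "0 < (\<integral>y. (q3 y * w3 n y) * b y \<partial>lborel)"
  proof (rule integral_pos_open[OF Zi])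
    show "open {y. 0 < y \<bullet> n \<and> norm y < \<xi>}" by (intro open_Collect_conj open_Collect_less continuous_intros)
    show "{y. 0 < y \<bullet> n \<and> norm y < \<xi>} \<noteq> {}" using y0 by blast
    show "AE y in lborel. y \<in> {y. 0 < y \<bullet> n \<and> norm y < \<xi>} \<longrightarrow> 0 < (q3 y * w3 n y) * b y"
      using q3_pos w3_sign(2) b_pos by (intro AE_I2) auto
    show "AE y in lborel. 0 \<le> (q3 y * w3 n y) * b y"
    proof (rule AE_I2)
      fix y
      consider "0 < y \<bullet> n" | "y \<bullet> n < 0" | "y \<bullet> n = 0" by linarith
      then show "0 \<le> (q3 y * w3 n y) * b y"
      proof cases
        case 1
        then show ?thesis using q3_nonneg[of y] w3_sign(1)[of y n] b_pos[of y] by simp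
      next
        case 2
        then have "0 < mirror n y \<bullet> n" by (simp add: mirror_inner[OF n])
        then have "w3 n y \<le> 0" "b y \<le> 0"
          using w3_sign(1)[of "mirror n y" n] b_pos[of "mirror n y"] by (simp_all add: w3_odd[OF n] b_odd)
        then have "0 \<le> w3 n y * b y" by (rule mult_nonpos_nonpos)
        then show ?thesis using q3_nonneg[of y] by (simp add: mult.assoc)
      qed (simp add: w3_def)
    qed
  qed
  then show False using Z0 by simp
qed

lemma Lop_radial:
  assumes h: "continuous_on UNIV h" and even: "\<And>x. h (- x) = h x"
    and t: "0 \<le> t" "t \<le> 1" and eq: "\<And>x. h x = t * Lop h x" and x: "norm x < \<xi>" and xy: "norm x = norm y"
  shows "h x = h y"
proof (cases "x = y")
  case False
  show ?thesis
    using Lop_reflection_symmetric[OF h even t eq mirror_swap(1)[OF xy False] x] mirror_swap(2)[OF xy False] by simp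
qed simp

text \<open>Only values of h where q is nonzero enter \<open>Lop h\<close>, and there h is radial,
  hence given by its profile \<eta> along one ray. Newton's theorem bounds \<eta> by its own
  integral from 0 on [0, \<xi>], which forces \<eta> = 0.\<close>

lemma Lop_injective:
  assumes h: "continuous_on UNIV h" and even: "\<And>x. h (- x) = h x"
    and t: "0 \<le> t" "t \<le> 1" and eq: "\<And>x. h x = t * Lop h x"
  shows "h x = 0"
proof -
  obtain e :: "real^3" where e: "norm e = 1" using vector_choose_size[of 1] by (metis zero_le_one)
  define \<eta> where "\<eta> s = h (s *\<^sub>R e)" for s
  have \<eta>c: "continuous_on S \<eta>" for S unfolding \<eta>_def[abs_def]
    by (rule continuous_on_compose2[OF h]) (auto intro!: continuous_intros)
  have h_rad: "q3 y * h y = q3 y * \<eta> (norm y)" for y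
  proof (cases "norm y < \<xi>")
    case True
    have "h y = h (norm y *\<^sub>R e)" by (rule Lop_radial[OF h even t eq True]) (simp add: e)
    then show ?thesis by (simp add: \<eta>_def)
  qed (use q3_0[of y] in simp)
  define p where "p s = \<nu> * pos_pow (\<nu> - 1) (lext s)" for s
  have pc: "continuous_on {0..} p" unfolding p_def[abs_def] by (intro continuous_intros lext_pow_cont1)
  obtain Mh where Mh: "dens \<xi> Mh (qm h)" using dens_q3_cont[OF h] .
  have "continuous_on {0..\<xi>} p" by (rule continuous_on_subset[OF pc]) auto
  from abs_bounded_on_compact[OF compact_Icc this]
  obtain Q where Q: "0 < Q" "\<And>s. s \<in> {0..\<xi>} \<Longrightarrow> \<bar>p s\<bar> \<le> Q" by blast
  have zero: "\<eta> r = 0" if r: "r \<in> {0..\<xi>}" for r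
  proof (rule gronwall_zero[OF \<eta>c _ _ _ r])
    \<comment> \<open>In the constant, Q bounds the radial form of q on [0, \<xi>], and the factor
      |s^2 / r - s| is at most \<xi> for s \<le> r \<le> \<xi>.\<close>
    show "0 \<le> \<xi>" "0 < Q * \<xi>" using xi_pos Q by auto
    fix r assume r: "r \<in> {0..\<xi>}"
    show "\<bar>\<eta> r\<bar> \<le> Q * \<xi> * integral {0..r} (\<lambda>s. \<bar>\<eta> s\<bar>)"
    proof (cases "r = 0")
      case True
      then show ?thesis using eq[of 0] by (simp add: \<eta>_def Lop_def npot_def)
    next
      case False
      then have rp: "0 < r" using r by simp
      let ?\<phi> = "\<lambda>s. p (max 0 s) * \<eta> (max 0 s)"
      let ?x = "r *\<^sub>R e"
      have nx: "norm ?x = r" using rp e by simp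
      have rad: "pot (qm h) ?x - pot (qm h) 0 = 4 * pi * (LBINT s:{0..norm ?x}. ?\<phi> s * (s\<^sup>2 / norm ?x - s))"
      proof (rule pot_radial_diff[OF Mh])
        show "q3 y * h y = ?\<phi> (norm y)" for y unfolding h_rad by (simp add: q3_def p_def)
        show "?\<phi> \<in> borel_measurable borel"
          by (intro borel_measurable_continuous_onI continuous_intros continuous_norm_fun[OF pc] continuous_on_compose2[OF \<eta>c]) auto
      qed (use nx rp in simp)
      let ?f = "\<lambda>s. p s * \<eta> s * (s\<^sup>2 / r - s)"
      have fc: "continuous_on {0..r} ?f"
        using rp by (intro continuous_intros \<eta>c continuous_on_subset[OF pc]) auto
      have "(LBINT s:{0..r}. ?\<phi> s * (s\<^sup>2 / r - s)) = (LBINT s:{0..r}. ?f s)"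
        by (rule set_lebesgue_integral_cong) auto
      also have "\<dots> = integral {0..r} ?f"
        by (intro set_borel_integral_eq_integral borel_integrable_atLeastAtMost' fc)
      finally have "\<eta> r = t * integral {0..r} ?f"
        using eq[of ?x] rad unfolding nx by (simp add: \<eta>_def Lop_def npot_def)
      then have "\<bar>\<eta> r\<bar> = t * \<bar>integral {0..r} ?f\<bar>" using t by (simp add: abs_mult)
      also have "\<dots> \<le> 1 * \<bar>integral {0..r} ?f\<bar>" using t by (intro mult_right_mono) auto
      also have "\<dots> \<le> integral {0..r} (\<lambda>s. Q * \<xi> * \<bar>\<eta> s\<bar>)"
        unfolding mult_1 real_norm_def[symmetric]
      proof (rule integral_norm_bound_integral)
        show "?f integrable_on {0..r}" by (rule integrable_continuous_real[OF fc])
        show "(\<lambda>s. Q * \<xi> * norm (\<eta> s)) integrable_on {0..r}" by (intro integrable_continuous_real continuous_intros \<eta>c)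
        fix s assume s: "s \<in> {0..r}"
        have "s\<^sup>2 / r \<le> s" using s rp by (simp add: power2_eq_square divide_le_eq mult_left_mono)
        moreover have "0 \<le> s\<^sup>2 / r" using rp by simp
        ultimately have "\<bar>s\<^sup>2 / r - s\<bar> \<le> \<xi>" using s r by auto
        then have "\<bar>p s\<bar> * \<bar>s\<^sup>2 / r - s\<bar> \<le> Q * \<xi>" using Q(2)[of s] s r Q(1) by (intro mult_mono) auto
        then have "\<bar>\<eta> s\<bar> * (\<bar>p s\<bar> * \<bar>s\<^sup>2 / r - s\<bar>) \<le> \<bar>\<eta> s\<bar> * (Q * \<xi>)" by (rule mult_left_mono) simp
        then show "norm (?f s) \<le> Q * \<xi> * norm (\<eta> s)" by (simp add: abs_mult mult_ac)
      qed
      also have "\<dots> = Q * \<xi> * integral {0..r} (\<lambda>s. \<bar>\<eta> s\<bar>)" by simp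
      finally show ?thesis .
    qed
  qed
  \<comment> \<open>So far h is controlled only where q is nonzero. The vanishing of the product
    makes \<open>Lop h\<close> zero everywhere, and the equation carries this over to h on all of
    space.\<close>
  have "q3 y * h y = 0" for y
  proof (cases "norm y \<le> \<xi>")
    case True
    then show ?thesis unfolding h_rad using zero[of "norm y"] by simp
  qed (use q3_0[of y] in simp)
  then have "(qm h) = (\<lambda>_. 0)" by (rule ext)
  then have "Lop h x = 0" by (simp only: Lop_def npot_def pot_def) simp
  then show ?thesis using eq[of x] by simp
qed

end

section \<open>Inverting the linearisation\<close>

text \<open>Compactness of the square of L, together with injectivity for all t in [0,1], gives an a
  priori bound uniform in t. The uniform bound lets solvability be continued from t = 0 to t = 1 in
  finitely many equal steps.\<close>

lemma fredholm_continuity: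
  fixes L :: "'a::{real_normed_vector, complete_space} \<Rightarrow> 'a" and S :: "'a set"
  assumes cl: "closed S" and sub: "subspace S" and L: "bounded_linear L" and LS: "\<And>u. u \<in> S \<Longrightarrow> L u \<in> S"
    and cpt: "\<And>u :: nat \<Rightarrow> 'a. (\<And>n. u n \<in> S \<and> norm (u n) \<le> 1) \<Longrightarrow>
        \<exists>(r :: nat \<Rightarrow> nat) l. strict_mono r \<and> (\<lambda>n. L (L (u (r n)))) \<longlonglongrightarrow> l"
    and inj: "\<And>t h. 0 \<le> t \<Longrightarrow> t \<le> 1 \<Longrightarrow> h \<in> S \<Longrightarrow> h = t *\<^sub>R L h \<Longrightarrow> h = 0"
  shows "\<exists>c>0. (\<forall>h\<in>S. norm h \<le> c * norm (h - L h)) \<and> (\<forall>f\<in>S. \<exists>h\<in>S. h - L h = f)"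
proof -
  interpret L: bounded_linear L by (rule L)
  have below: "\<exists>c>0. \<forall>t. 0 \<le> t \<and> t \<le> 1 \<longrightarrow> (\<forall>h\<in>S. norm h \<le> c * norm (h - t *\<^sub>R L h))"
  proof (rule ccontr)
    assume neg: "\<not> ?thesis"
    have "\<exists>t u. 0 \<le> t \<and> t \<le> 1 \<and> u \<in> S \<and> norm u = 1 \<and> norm (u - t *\<^sub>R L u) < 1 / real (Suc n)" for n
    proof -
      have "\<not> (\<forall>t. 0 \<le> t \<and> t \<le> 1 \<longrightarrow> (\<forall>h\<in>S. norm h \<le> real (Suc n) * norm (h - t *\<^sub>R L h)))"
        using neg by (metis of_nat_0_less_iff zero_less_Suc)
      then obtain t h where t: "0 \<le> t" "t \<le> 1" "h \<in> S" and lt: "real (Suc n) * norm (h - t *\<^sub>R L h) < norm h"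
        by (auto simp: not_le)
      have h0: "0 < norm h" using lt by (smt (verit) mult_nonneg_nonneg norm_ge_zero of_nat_0_le_iff)
      let ?u = "h /\<^sub>R norm h"
      have "?u - t *\<^sub>R L ?u = (h - t *\<^sub>R L h) /\<^sub>R norm h" by (simp add: L.scaleR algebra_simps)
      then have "norm (?u - t *\<^sub>R L ?u) = norm (h - t *\<^sub>R L h) / norm h" using h0 by (simp add: divide_inverse mult.commute)
      also have "\<dots> < 1 / real (Suc n)" using lt h0 by (simp add: field_simps)
      finally show ?thesis using t h0 by (intro exI[of _ t] exI[of _ ?u]) (auto intro: subspace_scale[OF sub])
    qed
    then obtain t u where tu: "\<And>n. 0 \<le> t n \<and> t n \<le> 1 \<and> u n \<in> S \<and> norm (u n) = 1 \<and> norm (u n - t n *\<^sub>R L (u n)) < 1 / real (Suc n)"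
      by metis
    obtain r l where r: "strict_mono r" "(\<lambda>n. L (L (u (r n)))) \<longlonglongrightarrow> l"
      using cpt[of u] tu by (metis order_refl)
    have "seq_compact {0..1::real}" by (simp add: compact_imp_seq_compact)
    then obtain t0 r2 where r2: "t0 \<in> {0..1}" "strict_mono r2" "((\<lambda>n. t (r n)) \<circ> r2) \<longlonglongrightarrow> t0"
      using seq_compactE[of "{0..1::real}" "\<lambda>n. t (r n)"] tu by (metis atLeastAtMost_iff)
    define k where "k = r \<circ> r2"
    have k: "strict_mono k" using r(1) r2(2) by (simp add: k_def strict_mono_o)
    have tk: "(\<lambda>n. t (k n)) \<longlonglongrightarrow> t0" using r2(3) by (simp add: k_def o_def)
    have LLk: "(\<lambda>n. L (L (u (k n)))) \<longlonglongrightarrow> l"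
      using LIMSEQ_subseq_LIMSEQ[OF r(2) r2(2)] by (simp add: k_def o_def)
    have d0: "(\<lambda>n. u n - t n *\<^sub>R L (u n)) \<longlonglongrightarrow> 0"
    proof (rule Lim_null_comparison)
      show "eventually (\<lambda>n. norm (u n - t n *\<^sub>R L (u n)) \<le> 1 / real (Suc n)) sequentially"
        using tu by (intro always_eventually) (auto intro: less_imp_le)
      show "(\<lambda>n. 1 / real (Suc n)) \<longlonglongrightarrow> 0" using LIMSEQ_Suc[OF lim_1_over_n[where 'a=real]] by simp
    qed
    have dk: "(\<lambda>n. u (k n) - t (k n) *\<^sub>R L (u (k n))) \<longlonglongrightarrow> 0"
      using LIMSEQ_subseq_LIMSEQ[OF d0 k] by (simp add: o_def)
    \<comment> \<open>Substituting u = (u - t L u) + t L u into itself expresses u through the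
      residual, which tends to 0, and t^2 L (L u), which converges along the subsequence. This is
      why compactness of L itself is not asked for.\<close>
    define h where "h = t0 *\<^sub>R t0 *\<^sub>R l"
    have "(\<lambda>n. (u (k n) - t (k n) *\<^sub>R L (u (k n))) + t (k n) *\<^sub>R L (u (k n) - t (k n) *\<^sub>R L (u (k n))) + t (k n) *\<^sub>R t (k n) *\<^sub>R L (L (u (k n))))
        \<longlonglongrightarrow> 0 + t0 *\<^sub>R L 0 + t0 *\<^sub>R t0 *\<^sub>R l"
      by (intro tendsto_add tendsto_scaleR L.tendsto dk tk LLk)
    then have uk: "(\<lambda>n. u (k n)) \<longlonglongrightarrow> h" by (simp add: h_def L.diff L.scaleR L.zero scaleR_diff_right)
    have hS: "h \<in> S" using closed_sequentially[OF cl _ uk] tu by blast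
    have "(\<lambda>n. norm (u (k n))) \<longlonglongrightarrow> norm h" by (intro tendsto_norm uk)
    then have "(\<lambda>n. 1) \<longlonglongrightarrow> norm h" using tu by simp
    then have nh: "norm h = 1" by (simp add: LIMSEQ_const_iff)
    have "(\<lambda>n. u (k n) - t (k n) *\<^sub>R L (u (k n))) \<longlonglongrightarrow> h - t0 *\<^sub>R L h"
      by (intro tendsto_diff tendsto_scaleR L.tendsto uk tk)
    then have "h - t0 *\<^sub>R L h = 0" using dk LIMSEQ_unique by blast
    then have "h = 0" using inj[of t0 h] r2(1) hS by simp
    then show False using nh by simp
  qed
  then obtain c where c: "0 < c" "\<And>t h. 0 \<le> t \<Longrightarrow> t \<le> 1 \<Longrightarrow> h \<in> S \<Longrightarrow> norm h \<le> c * norm (h - t *\<^sub>R L h)"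
    by blast
  obtain K where K: "0 < K" "\<And>x. norm (L x) \<le> norm x * K" using L.pos_bounded by blast
  \<comment> \<open>Raising t by 1/N adds a perturbation L/N. This choice of N gives c * K / N <
    1/2, the contraction factor in the induction step.\<close>
  obtain N :: nat where N: "2 * c * K < real N" using reals_Archimedean2 by blast
  have N0: "0 < real N" using N c K by (smt (verit) mult_pos_pos)
  have step: "\<forall>f\<in>S. \<exists>h\<in>S. h - (real k / real N) *\<^sub>R L h = f" if "k \<le> N" for k
    using that
  proof (induction k)
    case 0
    then show ?case by simp
  next
    case (Suc k)
    let ?t = "real k / real N"
    have t: "0 \<le> ?t" "?t \<le> 1" using Suc.prems by auto
    have IH: "\<forall>f\<in>S. \<exists>h\<in>S. h - ?t *\<^sub>R L h = f" using Suc by simp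
    then obtain J where J: "\<And>f. f \<in> S \<Longrightarrow> J f \<in> S \<and> J f - ?t *\<^sub>R L (J f) = f" by metis
    show ?case
    proof
      fix f assume f: "f \<in> S"
      let ?\<Phi> = "\<lambda>h. J (f + (1 / real N) *\<^sub>R L h)"
      have in_S: "f + (1 / real N) *\<^sub>R L h \<in> S" if "h \<in> S" for h
        using f that by (intro subspace_add[OF sub] subspace_scale[OF sub] LS)
      have "\<exists>!h\<in>S. ?\<Phi> h = h"
      proof (rule Banach_fix[where c="1/2"])
        show "complete S" using cl by (simp add: complete_eq_closed)
        show "S \<noteq> {}" using f by blast
        show "?\<Phi> ` S \<subseteq> S" using J in_S by blast
        fix x y assume xy: "x \<in> S" "y \<in> S"
        let ?d = "?\<Phi> x - ?\<Phi> y"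
        have dS: "?d \<in> S" using J in_S xy by (intro subspace_diff[OF sub]) auto
        have "?d - ?t *\<^sub>R L ?d = (?\<Phi> x - ?t *\<^sub>R L (?\<Phi> x)) - (?\<Phi> y - ?t *\<^sub>R L (?\<Phi> y))"
          by (simp add: L.diff scaleR_diff_right)
        also have "\<dots> = (1 / real N) *\<^sub>R L (x - y)"
          using J[OF in_S[OF xy(1)]] J[OF in_S[OF xy(2)]] by (simp add: L.diff scaleR_diff_right)
        finally have "norm ?d \<le> c * norm ((1 / real N) *\<^sub>R L (x - y))" using c(2)[OF t dS] by simp
        also have "\<dots> \<le> c * ((1 / real N) * (norm (x - y) * K))"
          using c(1) K(2)[of "x - y"] N0 by (auto intro!: mult_left_mono divide_right_mono)
        also have "\<dots> = (c * K / real N) * norm (x - y)" by simp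
        also have "\<dots> \<le> 1 / 2 * norm (x - y)" using N N0 by (intro mult_right_mono) (auto simp: field_simps)
        finally show "dist (?\<Phi> x) (?\<Phi> y) \<le> 1 / 2 * dist x y" by (simp add: dist_norm)
      qed auto
      then obtain h where h: "h \<in> S" "?\<Phi> h = h" by blast
      have "h - ?t *\<^sub>R L h = f + (1 / real N) *\<^sub>R L h" using J[OF in_S[OF h(1)]] h(2) by simp
      then have "h - (real (Suc k) / real N) *\<^sub>R L h = f" by (simp add: add_divide_distrib scaleR_add_left algebra_simps)
      then show "\<exists>h\<in>S. h - (real (Suc k) / real N) *\<^sub>R L h = f" using h(1) by blast
    qed
  qed
  have "\<forall>f\<in>S. \<exists>h\<in>S. h - L h = f" using step[of N] N0 by simp
  moreover have "\<forall>h\<in>S. norm h \<le> c * norm (h - L h)" using c(2)[of 1] by simp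
  ultimately show ?thesis using c(1) by blast
qed

text \<open>Inverting 1 - L turns the equation into a fixed point problem in a ball of radius C e.
  There the Lipschitz constant of Q is at most A * C * e, so for small e the inverse composed with Q
  contracts.\<close>

lemma small_forcing_solution:
  fixes L Q :: "'a::{real_normed_vector, complete_space} \<Rightarrow> 'a" and S :: "'a set"
  assumes cl: "closed S" and sub: "subspace S" and L: "bounded_linear L"
    and c: "0 < c" "\<And>h. h \<in> S \<Longrightarrow> norm h \<le> c * norm (h - L h)" and surj: "\<And>f. f \<in> S \<Longrightarrow> \<exists>h\<in>S. h - L h = f"
    and QS: "\<And>u. u \<in> S \<Longrightarrow> Q u \<in> S" and Q0: "Q 0 = 0" and A: "0 < A"
    and Q: "\<And>u v d. d \<le> 1 \<Longrightarrow> u \<in> S \<Longrightarrow> v \<in> S \<Longrightarrow> norm u \<le> d \<Longrightarrow> norm v \<le> d \<Longrightarrow> norm (Q u - Q v) \<le> A * d * norm (u - v)"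
    and b: "b \<in> S"
  shows "\<exists>e0>0. \<exists>C>0. \<forall>e. 0 < e \<and> e \<le> e0 \<longrightarrow> (\<exists>v\<in>S. v - L v = e *\<^sub>R b + Q v \<and> norm v \<le> C * e)"
proof -
  interpret L: bounded_linear L by (rule L)
  \<comment> \<open>The forcing contributes at most c e |b|, which is at most half of the radius C
    e; the term +1 keeps C positive if b = 0. The choice of \<open>e0\<close> ensures C e \<le> 1,
    as the hypothesis on Q demands, and c A C e \<le> 1/2, which leaves the other half of the radius
    to Q.\<close>
  define C where "C = 2 * c * (norm b + 1)"
  have C: "0 < C" using c(1) by (simp add: C_def add_nonneg_pos)
  define e0 where "e0 = min (1 / C) (1 / (2 * c * A * C))"
  have e0: "0 < e0" using C c(1) A by (simp add: e0_def)
  obtain J where J: "\<And>f. f \<in> S \<Longrightarrow> J f \<in> S \<and> J f - L (J f) = f" using surj by metis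
  have "\<exists>v\<in>S. v - L v = e *\<^sub>R b + Q v \<and> norm v \<le> C * e" if e: "0 < e" "e \<le> e0" for e
  proof -
    let ?d = "C * e"
    have d: "0 \<le> ?d" "?d \<le> 1" "c * A * ?d \<le> 1 / 2"
    proof -
      show "0 \<le> ?d" using C e by simp
      have "e \<le> 1 / C" "e \<le> 1 / (2 * c * A * C)" using e by (auto simp: e0_def)
      then show "?d \<le> 1" "c * A * ?d \<le> 1 / 2" using C c(1) A by (simp_all add: field_simps)
    qed
    define B where "B = {v \<in> S. norm v \<le> ?d}"
    have B_eq: "B = S \<inter> cball 0 ?d" by (auto simp: B_def)
    let ?\<Phi> = "\<lambda>v. J (e *\<^sub>R b + Q v)"
    have in_S: "e *\<^sub>R b + Q v \<in> S" if "v \<in> S" for v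
      using b that by (intro subspace_add[OF sub] subspace_scale[OF sub] QS)
    have zero: "0 \<in> S" using sub by (rule subspace_0)
    have "\<exists>!v\<in>B. ?\<Phi> v = v"
    proof (rule Banach_fix[where c="1/2"])
      show "complete B" unfolding B_eq using cl by (intro complete_eq_closed[THEN iffD2] closed_Int) auto
      show "B \<noteq> {}" using zero d by (auto simp: B_def)
      show "?\<Phi> ` B \<subseteq> B"
      proof
        fix w assume "w \<in> ?\<Phi> ` B"
        then obtain v where v: "v \<in> S" "norm v \<le> ?d" "w = ?\<Phi> v" by (auto simp: B_def)
        have w: "w \<in> S" "w - L w = e *\<^sub>R b + Q v" using J[OF in_S[OF v(1)]] v(3) by auto
        have "norm w \<le> c * norm (e *\<^sub>R b + Q v)" using c(2)[OF w(1)] w(2) by simp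
        also have "\<dots> \<le> c * (e * norm b + A * ?d * ?d)"
        proof (intro mult_left_mono order_trans[OF norm_triangle_ineq] add_mono)
          have "norm (Q v) \<le> A * ?d * norm v" using Q[OF d(2) v(1) zero v(2)] d(1) Q0 by simp
          also have "\<dots> \<le> A * ?d * ?d" using v(2) A d(1) by (intro mult_left_mono) auto
          finally show "norm (Q v) \<le> A * ?d * ?d" .
        qed (use e c(1) in auto)
        also have "\<dots> = c * e * norm b + (c * A * ?d) * ?d" by (simp add: algebra_simps)
        also have "\<dots> \<le> c * e * norm b + 1 / 2 * ?d" using d by (intro add_left_mono mult_right_mono) auto
        also have "\<dots> \<le> ?d" using c(1) e by (simp add: C_def algebra_simps)
        finally show "w \<in> B" using w(1) by (simp add: B_def)
      qed
      fix x y assume "x \<in> B" "y \<in> B"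
      then have xy: "x \<in> S" "y \<in> S" "norm x \<le> ?d" "norm y \<le> ?d" by (auto simp: B_def)
      let ?z = "?\<Phi> x - ?\<Phi> y"
      have zS: "?z \<in> S" using J in_S xy by (intro subspace_diff[OF sub]) auto
      have "?z - L ?z = (?\<Phi> x - L (?\<Phi> x)) - (?\<Phi> y - L (?\<Phi> y))" by (simp add: L.diff)
      also have "\<dots> = Q x - Q y" using J[OF in_S[OF xy(1)]] J[OF in_S[OF xy(2)]] by simp
      finally have "norm ?z \<le> c * norm (Q x - Q y)" using c(2)[OF zS] by simp
      also have "\<dots> \<le> c * (A * ?d * norm (x - y))" using c(1) Q[OF d(2) xy] by simp
      also have "\<dots> = (c * A * ?d) * norm (x - y)" by simp
      also have "\<dots> \<le> 1 / 2 * norm (x - y)" using d by (intro mult_right_mono) auto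
      finally show "dist (?\<Phi> x) (?\<Phi> y) \<le> 1 / 2 * dist x y" by (simp add: dist_norm)
    qed auto
    then obtain v where "v \<in> B" "?\<Phi> v = v" by blast
    then show ?thesis using J[OF in_S[of v]] by (auto simp: B_def intro!: bexI[of _ v])
  qed
  then show ?thesis using e0 C by blast
qed

section \<open>Functions symmetric about the axis and in the equatorial plane\<close>

text \<open>Dependence on |x| and |x_3| only encodes axial symmetry and symmetry in \<zeta>
  together. It implies the invariance under -1 that \<open>Lop_injective\<close> needs.\<close>

definition sym3 :: "(real^3 \<Rightarrow> real) \<Rightarrow> bool" where
  "sym3 u \<longleftrightarrow> (\<forall>x y. norm x = norm y \<longrightarrow> \<bar>x $ 3\<bar> = \<bar>y $ 3\<bar> \<longrightarrow> u x = u y)"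

lemma sym3D: "sym3 u \<Longrightarrow> norm x = norm y \<Longrightarrow> \<bar>x $ 3\<bar> = \<bar>y $ 3\<bar> \<Longrightarrow> u x = u y"
  unfolding sym3_def by blast

lemma sym3_even: "sym3 u \<Longrightarrow> u (- x) = u x"
  by (rule sym3D) auto

lemma mirror_third: "n $ 3 = 0 \<Longrightarrow> mirror n x $ 3 = x $ 3"
  by (simp add: mirror_def)

lemma mirror_axis_third: "mirror (axis 3 1) x $ 3 = - x $ 3"
  by (simp add: mirror_def inner_axis)

text \<open>Reflections with horizontal normal connect any two points of equal norm and equal third
  coordinate, and one reflection in the equatorial plane flips the sign of that coordinate. A
  symmetric density is invariant under all of them.\<close>

lemma pot_sym3:
  assumes f: "f \<in> borel_measurable borel" and s: "sym3 f"
  shows "sym3 (pot f)"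
proof -
  have inv: "pot f (mirror n x) = pot f x" if n: "norm n = 1" and t: "\<And>y. \<bar>mirror n y $ 3\<bar> = \<bar>y $ 3\<bar>" for n x
  proof -
    have "(\<lambda>y. f (mirror n y)) = f"
      by (rule ext, rule sym3D[OF s norm_mirror[OF n] t])
    then show ?thesis using pot_orthogonal[OF f orthogonal_mirror[OF n], of x] by simp
  qed
  have same: "pot f x = pot f y" if xy: "norm x = norm y" "x $ 3 = y $ 3" for x y
  proof (cases "x = y")
    case False
    let ?n = "(x - y) /\<^sub>R norm (x - y)"
    have "pot f (mirror ?n x) = pot f x"
    proof (rule inv)
      show "norm ?n = 1" by (rule mirror_swap(1)[OF xy(1) False])
      have "?n $ 3 = 0" using xy(2) by simp
      then show "\<bar>mirror ?n y $ 3\<bar> = \<bar>y $ 3\<bar>" for y by (simp add: mirror_third)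
    qed
    then show ?thesis using mirror_swap(2)[OF xy(1) False] by simp
  qed simp
  have flip: "pot f (mirror (axis 3 1) x) = pot f x" for x
    by (rule inv) (auto simp: mirror_axis_third)
  show ?thesis unfolding sym3_def
  proof (intro allI impI)
    fix x y :: "real^3" assume xy: "norm x = norm y" "\<bar>x $ 3\<bar> = \<bar>y $ 3\<bar>"
    show "pot f x = pot f y"
    proof (cases "x $ 3 = y $ 3")
      case False
      then have "mirror (axis 3 1) x $ 3 = y $ 3" using xy(2) unfolding mirror_axis_third by linarith
      then have "pot f (mirror (axis 3 1) x) = pot f y" using xy(1) by (intro same) (simp_all add: norm_mirror)
      then show ?thesis using flip[of x] by simp
    qed (use same xy in blast)
  qed
qed

text \<open>Symmetry is a closed linear condition on the Banach space of bounded continuous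
  functions, so fixed point arguments can be run inside this subspace.\<close>

definition Ssym :: "((real^3) \<Rightarrow>\<^sub>C real) set" where
  "Ssym = {u. sym3 (apply_bcontfun u)}"

lemma subspace_Ssym: "subspace Ssym"
proof (rule subspaceI)
  fix u v :: "(real^3) \<Rightarrow>\<^sub>C real" and c :: real assume u: "u \<in> Ssym"
  show "c *\<^sub>R u \<in> Ssym"
    unfolding Ssym_def mem_Collect_eq sym3_def scaleR_bcontfun.rep_eq
  proof (intro allI impI)
    fix x y :: "real^3" assume "norm x = norm y" "\<bar>x $ 3\<bar> = \<bar>y $ 3\<bar>"
    moreover have "sym3 u" using u by (simp only: Ssym_def mem_Collect_eq)
    ultimately have "u x = u y" by (intro sym3D[of "apply_bcontfun u"])
    then show "c *\<^sub>R u x = c *\<^sub>R u y" by (simp only:)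
  qed
  assume v: "v \<in> Ssym"
  show "u + v \<in> Ssym"
    unfolding Ssym_def mem_Collect_eq sym3_def plus_bcontfun.rep_eq
  proof (intro allI impI)
    fix x y :: "real^3" assume xy: "norm x = norm y" "\<bar>x $ 3\<bar> = \<bar>y $ 3\<bar>"
    have "sym3 u" "sym3 v" using u v by (simp_all only: Ssym_def mem_Collect_eq)
    then have "u x = u y" "v x = v y" using xy by (blast intro: sym3D)+
    then show "u x + v x = u y + v y" by (simp only:)
  qed
next
  show "0 \<in> Ssym" unfolding Ssym_def mem_Collect_eq sym3_def zero_bcontfun.rep_eq by blast
qed

lemma tendsto_apply_bcontfun:
  fixes u :: "nat \<Rightarrow> 'a::metric_space \<Rightarrow>\<^sub>C 'b::metric_space"
  assumes "u \<longlonglongrightarrow> l" shows "(\<lambda>n. u n x) \<longlonglongrightarrow> l x"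
  using tendsto_uniform_limitI[OF tendsto_bcontfun_uniform_limit[OF assms]] by simp

lemma closed_Ssym: "closed Ssym"
  unfolding closed_sequential_limits
proof (intro allI impI, elim conjE)
  fix u :: "nat \<Rightarrow> (real^3) \<Rightarrow>\<^sub>C real" and l
  assume u: "\<forall>n. u n \<in> Ssym" and l: "u \<longlonglongrightarrow> l"
  have "l x = l y" if "norm x = norm y" "\<bar>x $ 3\<bar> = \<bar>y $ 3\<bar>" for x y
  proof -
    have un: "u n x = u n y" for n by (rule sym3D[OF _ that]) (use u in \<open>simp add: Ssym_def\<close>)
    show ?thesis
      by (rule LIMSEQ_unique[OF tendsto_apply_bcontfun[OF l, of x, unfolded un] tendsto_apply_bcontfun[OF l, of y]])
  qed
  then show "l \<in> Ssym" unfolding Ssym_def sym3_def by blast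
qed

lemma apply_Bcontfun:
  assumes "continuous_on UNIV f" "\<And>x. norm (f x) \<le> b"
  shows "apply_bcontfun (Bcontfun f) = f"
  by (rule Bcontfun_inverse) (use assms in \<open>rule bcontfun_normI\<close>)

lemma npot_add:
  assumes "dens R M f" "dens R' M' g" shows "npot (\<lambda>y. f y + g y) x = npot f x + npot g x"
  unfolding npot_def pot_add[OF assms] by (simp add: add_divide_distrib diff_divide_distrib)

lemma npot_diff:
  assumes "dens R M f" "dens R' M' g" shows "npot (\<lambda>y. f y - g y) x = npot f x - npot g x"
  unfolding npot_def pot_diff[OF assms] by (simp add: diff_divide_distrib)

lemma npot_scale: "npot (\<lambda>y. c * f y) x = c * npot f x"
proof -
  have "pot (\<lambda>y. c * f y) x = c * pot f x" for x unfolding pot_def by (simp flip: integral_mult_right_zero)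
  then show ?thesis by (simp add: npot_def right_diff_distrib)
qed

lemma continuous_npot:
  assumes "dens R M f" shows "continuous_on UNIV (npot f)"
  unfolding npot_def[abs_def] by (intro continuous_on_divide continuous_on_diff continuous_on_const continuous_pot[OF assms]) simp

lemma abs_npot_le:
  assumes "dens R M f" shows "\<bar>npot f x\<bar> \<le> M * pot_const R"
proof -
  have "\<bar>pot f x - pot f 0\<bar> \<le> 2 * (M * pot_const R)"
    using abs_pot_le[OF assms, of x] abs_pot_le[OF assms, of 0] by linarith
  also have "\<dots> \<le> (4 * pi) * (M * pot_const R)"
    using pi_ge_two densD(4)[OF assms] pot_const_pos[of R] by (intro mult_right_mono) (auto simp: less_imp_le)
  finally show ?thesis by (simp add: npot_def abs_mult divide_le_eq mult.commute)
qed

lemma npot_sym3: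
  assumes "f \<in> borel_measurable borel" "sym3 f" shows "sym3 (npot f)"
  unfolding sym3_def
proof (intro allI impI)
  fix x y :: "real^3" assume "norm x = norm y" "\<bar>x $ 3\<bar> = \<bar>y $ 3\<bar>"
  then have "pot f x = pot f y" by (rule sym3D[OF pot_sym3[OF assms]])
  then show "npot f x = npot f y" by (simp add: npot_def)
qed

section \<open>The linearised operator on bounded continuous functions\<close>

context lane_emden_profile
begin

lemma q3_bounded: obtains Mq where "0 < Mq" "dens \<xi> Mq q3"
proof -
  obtain M where M: "dens \<xi> M q3" using dens_cont[OF q3_cont] q3_0 by (metis less_imp_le)
  then have "dens \<xi> (M + 1) q3" "0 < M + 1" using densD(4)[OF M] by (auto simp: dens_def intro: order_trans)
  then show ?thesis using that by blast
qed

lemma dens_q3_bound: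
  assumes "dens \<xi> Mq q3" "continuous_on UNIV h" "\<And>y. norm y \<le> \<xi> \<Longrightarrow> \<bar>h y\<bar> \<le> d"
  shows "dens \<xi> (Mq * d) (qm h)"
proof (rule dens_mult_bounded[OF assms(1) borel_measurable_continuous_onI[OF assms(2)] assms(3)])
  show "0 \<le> d" using assms(3)[of 0] xi_pos by simp
qed

definition Lb :: "((real^3) \<Rightarrow>\<^sub>C real) \<Rightarrow> ((real^3) \<Rightarrow>\<^sub>C real)" where
  "Lb u = Bcontfun (Lop u)"

lemma Lb_apply: "apply_bcontfun (Lb u) = Lop u"
proof -
  obtain Mq where Mq: "0 < Mq" "dens \<xi> Mq q3" using q3_bounded by blast
  have d: "dens \<xi> (Mq * norm u) (qm u)"
    by (rule dens_q3_bound[OF Mq(2)]) (use norm_bounded[of u] in auto)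
  show ?thesis unfolding Lb_def
    by (rule apply_Bcontfun[where b="Mq * norm u * pot_const \<xi>"])
       (use continuous_npot[OF d] abs_npot_le[OF d] in \<open>auto simp: Lop_def\<close>)
qed

text \<open>Because q vanishes outside the ball of radius \<xi>, closeness on that ball alone gives
  closeness of the images on all of space.\<close>

lemma Lop_diff_le:
  assumes Mq: "dens \<xi> Mq q3" and c: "continuous_on UNIV a" "continuous_on UNIV b"
    and d: "\<And>y. norm y \<le> \<xi> \<Longrightarrow> \<bar>a y - b y\<bar> \<le> d"
  shows "\<bar>Lop a x - Lop b x\<bar> \<le> Mq * d * pot_const \<xi>"
proof -
  obtain Ma where Ma: "dens \<xi> Ma (qm a)" using dens_q3_cont[OF c(1)] .
  obtain Mb where Mb: "dens \<xi> Mb (qm b)" using dens_q3_cont[OF c(2)] .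
  note M = Ma Mb
  have "Lop a x - Lop b x = npot (\<lambda>y. q3 y * (a y - b y)) x"
    unfolding Lop_def npot_diff[OF M, symmetric] by (simp add: right_diff_distrib)
  also have "\<bar>\<dots>\<bar> \<le> Mq * d * pot_const \<xi>"
    by (rule abs_npot_le[OF dens_q3_bound[OF Mq _ d]]) (use c in \<open>auto intro!: continuous_intros\<close>)
  finally show ?thesis .
qed

lemma bounded_linear_Lb: "bounded_linear Lb"
proof -
  obtain Mq where Mq: "0 < Mq" "dens \<xi> Mq q3" using q3_bounded by blast
  show ?thesis
  proof (rule bounded_linear_intro[where K="Mq * pot_const \<xi>"])
    fix u v :: "(real^3) \<Rightarrow>\<^sub>C real" and r :: real
    obtain Mu where Mu: "dens \<xi> Mu (qm u)"
      using dens_q3_cont[OF continuous_on_apply_bcontfun] .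
    obtain Mv where Mv: "dens \<xi> Mv (qm v)"
      using dens_q3_cont[OF continuous_on_apply_bcontfun] .
    note M = Mu Mv
    show "Lb (u + v) = Lb u + Lb v"
      by (rule bcontfun_eqI) (simp add: Lb_apply Lop_def distrib_left npot_add[OF M])
    show "Lb (r *\<^sub>R u) = r *\<^sub>R Lb u"
      by (rule bcontfun_eqI) (simp add: Lb_apply Lop_def mult.left_commute[of _ r] npot_scale)
    show "norm (Lb u) \<le> norm u * (Mq * pot_const \<xi>)"
    proof (rule norm_bound)
      have d: "dens \<xi> (Mq * norm u) (qm u)"
        by (rule dens_q3_bound[OF Mq(2)]) (use norm_bounded[of u] in auto)
      show "norm (Lb u x) \<le> norm u * (Mq * pot_const \<xi>)" for x
        using abs_npot_le[OF d, of x] by (simp add: Lb_apply Lop_def mult_ac)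
    qed
  qed
qed

lemma q3_sym3: "sym3 q3" by (simp add: sym3_def q3_def)

lemma Lb_Ssym: "u \<in> Ssym \<Longrightarrow> Lb u \<in> Ssym"
proof -
  assume u: "u \<in> Ssym"
  have "sym3 (qm u)" 
    using u unfolding Ssym_def mem_Collect_eq sym3_def[of "\<lambda>y. q3 y * u y"]
    by (intro allI impI arg_cong2[where f="(*)"] sym3D[OF q3_sym3] sym3D[of "apply_bcontfun u"])
  moreover have "(qm u) \<in> borel_measurable borel"
    by (intro borel_measurable_continuous_onI continuous_intros q3_cont) auto
  ultimately show ?thesis by (simp add: Ssym_def Lb_apply Lop_def npot_sym3)
qed

text \<open>Arzela-Ascoli gives uniform convergence of the first images only on the compact ball of
  radius \<xi>. The second application of the operator sees nothing else, so the second images are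
  Cauchy in the supremum norm over all of space.\<close>

lemma Lb_compact:
  assumes u: "\<And>n::nat. norm (u n) \<le> 1"
  shows "\<exists>(r :: nat \<Rightarrow> nat) l. strict_mono r \<and> (\<lambda>n. Lb (Lb (u (r n)))) \<longlonglongrightarrow> l"
proof -
  obtain Mq where Mq: "0 < Mq" "dens \<xi> Mq q3" using q3_bounded by blast
  have d: "dens \<xi> (Mq * 1) (qm (u n))" for n
    by (rule dens_q3_bound[OF Mq(2)]) (use order_trans[OF norm_bounded u[of n]] in auto)
  obtain g r where g: "strict_mono (r :: nat \<Rightarrow> nat)"
    "\<And>e. 0 < e \<Longrightarrow> \<exists>N. \<forall>n x. n \<ge> N \<and> x \<in> cball 0 \<xi> \<longrightarrow> norm (Lop (u (r n)) x - g x) < e"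
  proof (rule Arzela_Ascoli[of "cball 0 \<xi>" "\<lambda>n. Lop (u n)" "Mq * 1 * pot_const \<xi>"])
    show "norm (Lop (u n) x) \<le> Mq * 1 * pot_const \<xi>" for n x
      using abs_npot_le[OF d] by (simp add: Lop_def)
    fix x :: "real^3" and e :: real assume "0 < e"
    then have "0 < 4 * pi * e" by simp
    from pot_equicontinuous[OF densD(4)[OF d] this] obtain \<delta> where \<delta>: "0 < \<delta>"
      "\<And>f x x'. dens \<xi> (Mq * 1) f \<Longrightarrow> norm (x - x') < \<delta> \<Longrightarrow> \<bar>pot f x - pot f x'\<bar> < 4 * pi * e" by blast
    have "norm (Lop (u n) x - Lop (u n) y) < e" if "norm (x - y) < \<delta>" for n y
    proof -
      have "Lop (u n) x - Lop (u n) y = (pot (qm (u n)) x - pot (qm (u n)) y) / (4 * pi)"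
        by (simp add: Lop_def npot_def diff_divide_distrib)
      then show ?thesis using \<delta>(2)[OF d that] by (simp add: abs_mult divide_less_eq mult.commute)
    qed
    then show "\<exists>\<delta>>0. \<forall>n y. y \<in> cball 0 \<xi> \<and> norm (x - y) < \<delta> \<longrightarrow> norm (Lop (u n) x - Lop (u n) y) < e"
      using \<delta>(1) by blast
  qed auto
  have "Cauchy (\<lambda>n. Lb (Lb (u (r n))))"
  proof (rule metric_CauchyI)
    fix e :: real assume e: "0 < e"
    \<comment> \<open>Two images within e' of the same limit differ by at most 2 e', and
      \<open>Lop_diff_le\<close> turns this into e/2.\<close>
    define e' where "e' = e / (4 * (Mq * pot_const \<xi>))"
    have K: "0 < Mq" "0 < pot_const \<xi>" using Mq pot_const_pos by simp_all
    have e': "0 < e'" using e K by (simp add: e'_def)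
    obtain N where N: "\<And>n x. n \<ge> N \<Longrightarrow> x \<in> cball 0 \<xi> \<Longrightarrow> norm (Lop (u (r n)) x - g x) < e'"
      using g(2)[OF e'] by blast
    have "dist (Lb (Lb (u (r m)))) (Lb (Lb (u (r n)))) < e" if mn: "N \<le> m" "N \<le> n" for m n
    proof -
      have "dist (Lb (Lb (u (r m)))) (Lb (Lb (u (r n)))) \<le> Mq * (2 * e') * pot_const \<xi>"
      proof (rule dist_bound)
        fix x
        have "\<bar>Lop (Lb (u (r m))) x - Lop (Lb (u (r n))) x\<bar> \<le> Mq * (2 * e') * pot_const \<xi>"
        proof (rule Lop_diff_le[OF Mq(2)])
          fix y :: "real^3" assume "norm y \<le> \<xi>"
          then have "y \<in> cball 0 \<xi>" by simp
          from N[OF mn(1) this] N[OF mn(2) this]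
          show "\<bar>Lb (u (r m)) y - Lb (u (r n)) y\<bar> \<le> 2 * e'" by (simp add: Lb_apply abs_if split: if_splits)
        qed auto
        then show "dist (Lb (Lb (u (r m))) x) (Lb (Lb (u (r n))) x) \<le> Mq * (2 * e') * pot_const \<xi>"
          by (simp add: Lb_apply dist_real_def)
      qed
      also have "\<dots> = e / 2" using K by (simp add: e'_def field_simps)
      finally show ?thesis using e by simp
    qed
    then show "\<exists>M. \<forall>m\<ge>M. \<forall>n\<ge>M. dist (Lb (Lb (u (r m)))) (Lb (Lb (u (r n)))) < e" by blast
  qed
  then obtain l where "(\<lambda>n. Lb (Lb (u (r n)))) \<longlonglongrightarrow> l" using Cauchy_convergent convergent_def by blast
  then show ?thesis using g(1) by blast
qed

lemma Lb_inverse: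
  obtains c where "0 < c" "\<And>h. h \<in> Ssym \<Longrightarrow> norm h \<le> c * norm (h - Lb h)"
    "\<And>f. f \<in> Ssym \<Longrightarrow> \<exists>h\<in>Ssym. h - Lb h = f"
proof -
  have "\<exists>c>0. (\<forall>h\<in>Ssym. norm h \<le> c * norm (h - Lb h)) \<and> (\<forall>f\<in>Ssym. \<exists>h\<in>Ssym. h - Lb h = f)"
  proof (rule fredholm_continuity[OF closed_Ssym subspace_Ssym bounded_linear_Lb Lb_Ssym])
    fix t and h :: "(real^3) \<Rightarrow>\<^sub>C real"
    assume t: "0 \<le> t" "t \<le> 1" and h: "h \<in> Ssym" "h = t *\<^sub>R Lb h"
    have eq: "h x = t * Lop h x" for x
      using arg_cong[OF h(2), of "\<lambda>u. apply_bcontfun u x"] by (simp add: Lb_apply)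
    have "sym3 h" using h(1) by (simp only: Ssym_def mem_Collect_eq)
    then have "h x = 0" for x
      by (intro Lop_injective[OF continuous_on_apply_bcontfun _ t eq] sym3_even)
    then show "h = 0" by (intro bcontfun_eqI) simp
  next
    fix u :: "nat \<Rightarrow> (real^3) \<Rightarrow>\<^sub>C real" assume "\<And>n. u n \<in> Ssym \<and> norm (u n) \<le> 1"
    then show "\<exists>(r :: nat \<Rightarrow> nat) l. strict_mono r \<and> (\<lambda>n. Lb (Lb (u (r n)))) \<longlonglongrightarrow> l"
      by (intro Lb_compact) blast
  qed
  then show ?thesis using that by blast
qed

end

section \<open>The nonlinear problem\<close>

text \<open>The mean value theorem with an increasing derivative. In the remainder estimate the
  exponent is \<nu> - 1, and requiring it to be at least 1 is exactly \<nu> \<ge> 2.\<close>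

lemma pos_pow_lipschitz:
  assumes a: "1 \<le> a" and M: "s \<le> M" "s' \<le> M" "0 \<le> M"
  shows "\<bar>pos_pow a s - pos_pow a s'\<bar> \<le> a * M powr (a - 1) * \<bar>s - s'\<bar>"
proof -
  have main: "\<bar>y powr a - x powr a\<bar> \<le> a * M powr (a - 1) * (y - x)" if xy: "0 \<le> x" "x < y" "y \<le> M" for x y
  proof -
    have c: "continuous_on {x..y} (\<lambda>t. t powr a)"
      using a xy by (intro continuous_on_powr' continuous_intros) auto
    have d: "((\<lambda>t. t powr a) has_derivative (\<lambda>h. (a * t powr (a - 1)) * h)) (at t)" if "x < t" "t < y" for t
    proof -
      have "0 < t" using that xy by simp
      from has_real_derivative_powr[OF this, of a] show ?thesis unfolding has_field_derivative_def .
    qed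
    from mvt[OF xy(2) c d] obtain t where t: "x < t" "t < y" "y powr a - x powr a = a * t powr (a - 1) * (y - x)" by blast
    have "\<bar>y powr a - x powr a\<bar> = a * t powr (a - 1) * (y - x)" unfolding t(3) using a xy by simp
    also have "\<dots> \<le> a * M powr (a - 1) * (y - x)"
      using a t xy by (intro mult_right_mono mult_left_mono powr_mono2) auto
    finally show ?thesis .
  qed
  have "\<bar>pos_pow a s - pos_pow a s'\<bar> \<le> a * M powr (a - 1) * \<bar>max 0 s - max 0 s'\<bar>"
  proof (cases "max 0 s" "max 0 s'" rule: linorder_cases)
    case less
    then show ?thesis using main[of "max 0 s" "max 0 s'"] M by (simp add: abs_minus_commute)
  next
    case greater
    then show ?thesis using main[of "max 0 s'" "max 0 s"] M by simp
  qed simp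
  also have "\<dots> \<le> a * M powr (a - 1) * \<bar>s - s'\<bar>"
    using a by (intro mult_left_mono) (auto simp: max_def)
  finally show ?thesis .
qed

lemma dens_indicator_cont:
  fixes g :: "real^3 \<Rightarrow> real"
  assumes g: "continuous_on UNIV g"
  obtains M where "dens R M (\<lambda>y. indicator (cball 0 R) y * g y)"
proof -
  obtain B where B: "0 < B" "\<And>y. y \<in> cball 0 R \<Longrightarrow> \<bar>g y\<bar> \<le> B"
    using abs_bounded_on_compact[OF compact_cball continuous_on_subset[OF g subset_UNIV]] by blast
  note [measurable] = borel_measurable_continuous_onI[OF g]
  have m: "(\<lambda>y. indicator (cball 0 R) y * g y) \<in> borel_measurable borel"
    by (intro borel_measurable_times borel_measurable_indicator) auto
  have "dens R B (\<lambda>y. indicator (cball 0 R) y * g y)"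
    unfolding dens_def using B m by (auto simp: indicator_def)
  then show ?thesis by (rule that)
qed

text \<open>The Cartesian form of \<open>\<gg>\<close>, a quarter of the squared distance from the
  axis, truncated so that it is bounded on all of space. On the ball of radius R the truncation has
  no effect.\<close>

definition g3 :: "real \<Rightarrow> real^3 \<Rightarrow> real" where
  "g3 R x = 1 / 4 * min (R\<^sup>2) ((norm x)\<^sup>2 - (x $ 3)\<^sup>2)"

lemma g3_cont: "continuous_on UNIV (g3 R)"
  unfolding g3_def[abs_def] by (intro continuous_intros)

lemma g3_bound: "\<bar>g3 R x\<bar> \<le> R\<^sup>2"
proof -
  have "(x $ 3)\<^sup>2 \<le> (norm x)\<^sup>2" using component_le_norm_cart[of x 3] by (simp add: abs_le_square_iff[symmetric])
  then show ?thesis by (auto simp: g3_def min_def)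
qed

lemma g3_sym3: "sym3 (g3 R)"
  unfolding sym3_def
proof (intro allI impI)
  fix x y :: "real^3" assume xy: "norm x = norm y" "\<bar>x $ 3\<bar> = \<bar>y $ 3\<bar>"
  have "(x $ 3)\<^sup>2 = (y $ 3)\<^sup>2" using xy(2) by (simp only: power2_eq_iff abs_eq_iff)
  then show "g3 R x = g3 R y" using xy(1) by (simp add: g3_def)
qed

context lane_emden_profile
begin

text \<open>The derivative of the remainder at z is \<nu> times the increment of the (\<nu>-1)-st
  power from t to t + z. That power is Lipschitz for arguments up to B + 1, so the increment is of
  order d for |z| \<le> d. The factor d is what makes the contraction possible.\<close>

lemma taylor_remainder_lipschitz:
  assumes t: "t \<le> B" and B: "0 \<le> B" and d: "d \<le> 1" and v: "\<bar>v\<bar> \<le> d" and w: "\<bar>w\<bar> \<le> d"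
  shows "\<bar>(pos_pow \<nu> (t + v) - \<nu> * pos_pow (\<nu> - 1) t * v) - (pos_pow \<nu> (t + w) - \<nu> * pos_pow (\<nu> - 1) t * w)\<bar>
    \<le> \<nu> * ((\<nu> - 1) * (B + 1) powr (\<nu> - 1 - 1)) * d * \<bar>v - w\<bar>"
proof -
  let ?A = "(\<nu> - 1) * (B + 1) powr (\<nu> - 1 - 1)"
  have A: "0 \<le> ?A" using nu2 by simp
  have "norm ((\<lambda>v. pos_pow \<nu> (t + v) - \<nu> * pos_pow (\<nu> - 1) t * v) v - (\<lambda>v. pos_pow \<nu> (t + v) - \<nu> * pos_pow (\<nu> - 1) t * v) w)
    \<le> (\<nu> * ?A * d) * norm (v - w)"
  proof (rule field_differentiable_bound)
    show "convex {-d..d}" by simp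
    show "v \<in> {-d..d}" "w \<in> {-d..d}" using v w by auto
    fix z assume z: "z \<in> {-d..d}"
    have "((\<lambda>v. pos_pow \<nu> (t + v)) has_real_derivative (\<nu> * pos_pow (\<nu> - 1) (t + z)) * (0 + 1)) (at z)"
      by (rule DERIV_chain2[OF pos_pow_deriv DERIV_add[OF DERIV_const DERIV_ident]]) (use nu2 in simp)
    moreover have "((\<lambda>v. \<nu> * pos_pow (\<nu> - 1) t * v) has_real_derivative (\<nu> * pos_pow (\<nu> - 1) t * 1)) (at z)"
      by (rule DERIV_cmult[OF DERIV_ident])
    ultimately show "((\<lambda>v. pos_pow \<nu> (t + v) - \<nu> * pos_pow (\<nu> - 1) t * v) has_field_derivative
       (\<nu> * pos_pow (\<nu> - 1) (t + z)) * (0 + 1) - \<nu> * pos_pow (\<nu> - 1) t * 1) (at z within {-d..d})"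
      by (intro has_field_derivative_at_within[OF DERIV_diff])
    have "\<bar>pos_pow (\<nu> - 1) (t + z) - pos_pow (\<nu> - 1) t\<bar> \<le> ?A * \<bar>(t + z) - t\<bar>"
      by (rule pos_pow_lipschitz) (use nu2 t z d B in auto)
    also have "\<dots> \<le> ?A * d" using z A by (intro mult_left_mono) auto
    finally have "\<nu> * \<bar>pos_pow (\<nu> - 1) (t + z) - pos_pow (\<nu> - 1) t\<bar> \<le> \<nu> * (?A * d)" using nu by (intro mult_left_mono) auto
    then have "\<bar>\<nu> * (pos_pow (\<nu> - 1) (t + z) - pos_pow (\<nu> - 1) t)\<bar> \<le> \<nu> * (?A * d)" using nu by (simp add: abs_mult)
    then show "norm ((\<nu> * pos_pow (\<nu> - 1) (t + z)) * (0 + 1) - \<nu> * pos_pow (\<nu> - 1) t * 1) \<le> \<nu> * ?A * d"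
      by (simp only: real_norm_def right_diff_distrib mult_1_right add_0 mult.assoc)
  qed
  then show ?thesis by simp
qed

text \<open>The remainder of the linearisation, cut off to the domain of integration of
  \<open>\<G>\<close>. If \<xi> \<le> R, only the full power is affected by the cutoff, since the
  other two terms already vanish outside the ball of radius \<xi>.\<close>

definition nl :: "real \<Rightarrow> (real^3 \<Rightarrow> real) \<Rightarrow> real^3 \<Rightarrow> real" where
  "nl R v y = indicator (cball 0 R) y * (pos_pow \<nu> (lext (norm y) + v y) - P3 y - q3 y * v y)"

lemma lext_norm_cont: "continuous_on UNIV (\<lambda>y::real^3. lext (norm y))"
  by (rule continuous_norm_fun[OF lext_cont])

lemma dens_nl:
  assumes "continuous_on UNIV v" obtains M where "dens R M (nl R v)"
proof -
  have "continuous_on UNIV (\<lambda>y. pos_pow \<nu> (lext (norm y) + v y) - P3 y - q3 y * v y)"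
    by (intro continuous_on_diff continuous_on_mult continuous_on_pos_pow[OF nu] continuous_on_add lext_norm_cont P3_cont q3_cont assms)
  from dens_indicator_cont[OF this, of R] obtain M where "dens R M (nl R v)"
    unfolding nl_def[abs_def] .
  then show ?thesis by (rule that)
qed

lemma nl_lipschitz:
  assumes R: "0 \<le> R"
  obtains A where "0 < A" "\<And>u v d e. d \<le> 1 \<Longrightarrow> continuous_on UNIV u \<Longrightarrow> continuous_on UNIV v \<Longrightarrow>
     (\<And>y. \<bar>u y\<bar> \<le> d) \<Longrightarrow> (\<And>y. \<bar>v y\<bar> \<le> d) \<Longrightarrow> (\<And>y. \<bar>u y - v y\<bar> \<le> e) \<Longrightarrow> dens R (A * d * e) (\<lambda>y. nl R u y - nl R v y)"
proof -
  obtain B where B: "0 < B" "\<And>y::real^3. y \<in> cball 0 R \<Longrightarrow> \<bar>lext (norm y)\<bar> \<le> B"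
    using abs_bounded_on_compact[OF compact_cball continuous_on_subset[OF lext_norm_cont subset_UNIV]] by blast
  define A where "A = \<nu> * ((\<nu> - 1) * (B + 1) powr (\<nu> - 1 - 1))"
  have A: "0 < A" using nu2 B by (simp add: A_def)
  show ?thesis
  proof (rule that[OF A])
    fix u v :: "real^3 \<Rightarrow> real" and d e
    assume d: "d \<le> 1" and c: "continuous_on UNIV u" "continuous_on UNIV v"
      and ud: "\<And>y. \<bar>u y\<bar> \<le> d" and vd: "\<And>y. \<bar>v y\<bar> \<le> d" and e: "\<And>y. \<bar>u y - v y\<bar> \<le> e"
    obtain Mu where Mu: "dens R Mu (nl R u)" using dens_nl[OF c(1)] .
    obtain Mv where Mv: "dens R Mv (nl R v)" using dens_nl[OF c(2)] .
    have de: "0 \<le> d" "0 \<le> e" using ud[of 0] e[of 0] by linarith+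
    have le: "\<bar>nl R u y - nl R v y\<bar> \<le> A * d * e" for y
    proof (cases "y \<in> cball 0 R")
      case True
      have "\<bar>(pos_pow \<nu> (lext (norm y) + u y) - \<nu> * pos_pow (\<nu> - 1) (lext (norm y)) * u y)
          - (pos_pow \<nu> (lext (norm y) + v y) - \<nu> * pos_pow (\<nu> - 1) (lext (norm y)) * v y)\<bar> \<le> A * d * \<bar>u y - v y\<bar>"
        unfolding A_def by (rule taylor_remainder_lipschitz[OF _ _ d ud vd]) (use B True in \<open>force simp: abs_le_iff\<close>)+
      also have "\<dots> \<le> A * d * e" using A de e by (intro mult_left_mono) auto
      moreover have "nl R u y - nl R v y = (pos_pow \<nu> (lext (norm y) + u y) - \<nu> * pos_pow (\<nu> - 1) (lext (norm y)) * u y)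
          - (pos_pow \<nu> (lext (norm y) + v y) - \<nu> * pos_pow (\<nu> - 1) (lext (norm y)) * v y)"
        using True by (simp add: nl_def q3_def)
      ultimately show ?thesis by (simp only:)
    next
      case False
      then show ?thesis using A de by (simp add: nl_def)
    qed
    have "dens R (Mu + Mv) (\<lambda>y. nl R u y - nl R v y)" by (rule dens_diff[OF Mu Mv])
    then show "dens R (A * d * e) (\<lambda>y. nl R u y - nl R v y)" using le by (auto simp: dens_def)
  qed
qed

lemma nl_sym3: "sym3 v \<Longrightarrow> sym3 (nl R v)"
  unfolding sym3_def[of "nl R v"]
proof (intro allI impI)
  fix x y :: "real^3" assume v: "sym3 v" and xy: "norm x = norm y" "\<bar>x $ 3\<bar> = \<bar>y $ 3\<bar>"
  have "v x = v y" by (rule sym3D[OF v xy])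
  then show "nl R v x = nl R v y" using xy(1) by (simp add: nl_def P3_def q3_def indicator_def)
qed

definition Qb :: "real \<Rightarrow> ((real^3) \<Rightarrow>\<^sub>C real) \<Rightarrow> ((real^3) \<Rightarrow>\<^sub>C real)" where
  "Qb R u = Bcontfun (npot (nl R u))"

lemma Qb_apply: "apply_bcontfun (Qb R u) = npot (nl R u)"
proof -
  obtain M where M: "dens R M (nl R u)" using dens_nl[OF continuous_on_apply_bcontfun] .
  show ?thesis unfolding Qb_def
    by (rule apply_Bcontfun[where b="M * pot_const R"]) (use continuous_npot[OF M] abs_npot_le[OF M] in auto)
qed

lemma Qb_Ssym: "u \<in> Ssym \<Longrightarrow> Qb R u \<in> Ssym"
proof -
  assume "u \<in> Ssym"
  then have u: "sym3 u" by (simp only: Ssym_def mem_Collect_eq)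
  obtain M where M: "dens R M (nl R u)" using dens_nl[OF continuous_on_apply_bcontfun] .
  show ?thesis unfolding Ssym_def mem_Collect_eq Qb_apply by (rule npot_sym3[OF densD(1)[OF M] nl_sym3[OF u]])
qed

lemma npot_P3: "npot P3 x = lext (norm x) - 1"
  unfolding npot_def P3_potential by simp

text \<open>The normalised potential of \<open>P3\<close> is the profile minus 1, so the ansatz
  profile plus v cancels the unperturbed equation. What remains is v - L v = e g +
  N[\<open>nl R v\<close>], with a quadratically small last term.\<close>

lemma nonlinear_solution:
  assumes R: "\<xi> \<le> R"
  shows "\<exists>e0>0. \<exists>C>0. \<forall>e. 0 < e \<and> e \<le> e0 \<longrightarrow> (\<exists>v. continuous_on UNIV v \<and> sym3 v \<and> (\<forall>x. \<bar>v x\<bar> \<le> C * e) \<and>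
     (\<forall>x. lext (norm x) + v x = e * g3 R x + 1 + npot (\<lambda>y. indicator (cball 0 R) y * pos_pow \<nu> (lext (norm y) + v y)) x))"
proof -
  have R0: "0 \<le> R" using R xi_pos by simp
  obtain c where c: "0 < c" "\<And>h. h \<in> Ssym \<Longrightarrow> norm h \<le> c * norm (h - Lb h)"
    "\<And>f. f \<in> Ssym \<Longrightarrow> \<exists>h\<in>Ssym. h - Lb h = f" using Lb_inverse by blast
  have gb: "apply_bcontfun (Bcontfun (g3 R)) = g3 R"
    by (rule apply_Bcontfun[where b="R\<^sup>2"]) (use g3_cont g3_bound in auto)
  have gS: "Bcontfun (g3 R) \<in> Ssym" unfolding Ssym_def mem_Collect_eq gb by (rule g3_sym3)
  obtain A where A: "0 < A" "\<And>u v d e. d \<le> 1 \<Longrightarrow> continuous_on UNIV u \<Longrightarrow> continuous_on UNIV v \<Longrightarrow>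
     (\<And>y. \<bar>u y\<bar> \<le> d) \<Longrightarrow> (\<And>y. \<bar>v y\<bar> \<le> d) \<Longrightarrow> (\<And>y. \<bar>u y - v y\<bar> \<le> e) \<Longrightarrow> dens R (A * d * e) (\<lambda>y. nl R u y - nl R v y)"
    using nl_lipschitz[OF R0] by blast
  have "\<exists>e0>0. \<exists>C>0. \<forall>e. 0 < e \<and> e \<le> e0 \<longrightarrow> (\<exists>v\<in>Ssym. v - Lb v = e *\<^sub>R Bcontfun (g3 R) + Qb R v \<and> norm v \<le> C * e)"
  proof (rule small_forcing_solution[OF closed_Ssym subspace_Ssym bounded_linear_Lb c])
    show "Qb R 0 = 0"
    proof (rule bcontfun_eqI)
      have "nl R (\<lambda>_. 0) = (\<lambda>_. 0)" by (simp add: nl_def P3_def fun_eq_iff)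
      then show "apply_bcontfun (Qb R 0) x = apply_bcontfun 0 x" for x by (simp add: Qb_apply npot_def pot_def)
    qed
    show "0 < A * pot_const R" using A pot_const_pos by simp
    fix u v :: "(real^3) \<Rightarrow>\<^sub>C real" and d
    assume d: "d \<le> 1" and uv: "norm u \<le> d" "norm v \<le> d"
    have D: "dens R (A * d * norm (u - v)) (\<lambda>y. nl R u y - nl R v y)"
    proof (rule A(2)[OF d])
      show "\<bar>u y\<bar> \<le> d" "\<bar>v y\<bar> \<le> d" for y
        using order_trans[OF norm_bounded uv(1)] order_trans[OF norm_bounded uv(2)] by auto
      show "\<bar>u y - v y\<bar> \<le> norm (u - v)" for y using norm_bounded[of "u - v" y] by simp
    qed auto
    obtain Mu where Mu: "dens R Mu (nl R u)" using dens_nl[OF continuous_on_apply_bcontfun] .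
    obtain Mv where Mv: "dens R Mv (nl R v)" using dens_nl[OF continuous_on_apply_bcontfun] .
    show "norm (Qb R u - Qb R v) \<le> A * pot_const R * d * norm (u - v)"
    proof (rule norm_bound)
      fix x
      have "(Qb R u - Qb R v) x = npot (\<lambda>y. nl R u y - nl R v y) x"
        by (simp add: Qb_apply npot_diff[OF Mu Mv])
      then show "norm ((Qb R u - Qb R v) x) \<le> A * pot_const R * d * norm (u - v)"
        using abs_npot_le[OF D, of x] by (simp add: mult_ac)
    qed
  qed (use gS Qb_Ssym in auto)
  then obtain e0 C where eC: "0 < e0" "0 < C" "\<And>e. 0 < e \<Longrightarrow> e \<le> e0 \<Longrightarrow>
     \<exists>v\<in>Ssym. v - Lb v = e *\<^sub>R Bcontfun (g3 R) + Qb R v \<and> norm v \<le> C * e" by blast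
  have "\<exists>v. continuous_on UNIV v \<and> sym3 v \<and> (\<forall>x. \<bar>v x\<bar> \<le> C * e) \<and>
     (\<forall>x. lext (norm x) + v x = e * g3 R x + 1 + npot (\<lambda>y. indicator (cball 0 R) y * pos_pow \<nu> (lext (norm y) + v y)) x)"
    if e: "0 < e" "e \<le> e0" for e
  proof -
    obtain v where v: "v \<in> Ssym" "v - Lb v = e *\<^sub>R Bcontfun (g3 R) + Qb R v" "norm v \<le> C * e" using eC(3)[OF e] by blast
    obtain Mv where Mv: "dens R Mv (nl R v)" using dens_nl[OF continuous_on_apply_bcontfun] .
    obtain MP where MP: "dens \<xi> MP P3" using dens_cont[OF P3_cont P3_0] .
    obtain Mq where Mq: "dens \<xi> Mq (qm v)" using dens_q3_cont[OF continuous_on_apply_bcontfun] .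
    \<comment> \<open>Outside the ball of radius R every term vanishes because \<xi> \<le> R, so
      neither \<open>P3\<close> nor the linear term is truncated.\<close>
    have split: "(\<lambda>y. indicator (cball 0 R) y * pos_pow \<nu> (lext (norm y) + v y)) = (\<lambda>y. (P3 y + q3 y * v y) + nl R v y)"
    proof
      fix y :: "real^3"
      show "indicator (cball 0 R) y * pos_pow \<nu> (lext (norm y) + v y) = (P3 y + q3 y * v y) + nl R v y"
      proof (cases "y \<in> cball 0 R")
        case False
        then have "\<xi> < norm y" using R by auto
        then show ?thesis using False P3_0[of y] q3_0[of y] by (simp add: nl_def)
      qed (simp add: nl_def)
    qed
    have e1: "lext (norm x) + v x = e * g3 R x + 1 + npot (\<lambda>y. indicator (cball 0 R) y * pos_pow \<nu> (lext (norm y) + v y)) x" for x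
    proof -
      have "npot (\<lambda>y. indicator (cball 0 R) y * pos_pow \<nu> (lext (norm y) + v y)) x = npot P3 x + Lop v x + npot (nl R v) x"
        unfolding split npot_add[OF dens_add[OF MP Mq] Mv] npot_add[OF MP Mq] Lop_def by simp
      moreover have "v x - Lop v x = e * g3 R x + npot (nl R v) x"
        using arg_cong[OF v(2), of "\<lambda>u. apply_bcontfun u x"] by (simp add: Lb_apply Qb_apply gb)
      ultimately show ?thesis by (simp add: npot_P3)
    qed
    have e2: "sym3 v" using v(1) by (simp only: Ssym_def mem_Collect_eq)
    have e3: "\<bar>v x\<bar> \<le> C * e" for x using order_trans[OF norm_bounded[of v x] v(3)] by simp
    show ?thesis by (intro exI[of _ "apply_bcontfun v"] conjI allI continuous_on_apply_bcontfun e1 e2 e3)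
  qed
  then show ?thesis using eC(1,2) by blast
qed

end

section \<open>Return to the coordinates r and \<zeta>\<close>

text \<open>For an axisymmetric density the azimuth enters only through the kernel, and its integral
  is \<open>K\<close>. At the origin the kernel is 1/b: it lowers b^2 to b and the azimuth
  contributes 2 * pi, which becomes the factor 1/2 in \<open>\<G>\<close> after division by 4 *
  pi.\<close>

lemma pot_axisymmetric:
  assumes F: "dens R M F" and \<Phi>: "\<And>a b c. a \<in> {-1..1} \<Longrightarrow> b \<in> {0..R} \<Longrightarrow> F (sph (a, b, c)) = \<Phi> (b, a)"
  shows "\<zeta> \<in> {-1..1} \<Longrightarrow> 0 \<le> r \<Longrightarrow>
      pot F (sph (\<zeta>, r, 0)) = (LBINT a:{-1..1}. LBINT b:{0..R}. K r \<zeta> b a * \<Phi> (b, a) * b\<^sup>2)"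
    and "pot F 0 = 2 * pi * (LBINT a:{-1..1}. LBINT b:{0..R}. \<Phi> (b, a) * b)"
proof -
  have it: "pot F x = (LBINT a. LBINT b. LBINT c. sph_weight (a, b, c) * (F (sph (a, b, c)) / norm (x - sph (a, b, c))))" for x
    unfolding pot_spherical_integrable(2)[OF F]
    by (rule integral_lborel_triple[OF pot_spherical_integrable(1)[OF F]])
  have w: "sph_weight (a, b, c) * (F (sph (a, b, c)) / norm (x - sph (a, b, c))) =
     indicator {-1..1} a * (indicator {0..R} b * (indicator {0..2*pi} c * (1 / norm (x - sph (a, b, c))) * (\<Phi> (b, a) * b\<^sup>2)))" for x a b c
  proof (cases "(a, b, c) \<in> sph_cbox")
    case True
    then have abc: "a \<in> {-1..1}" "0 \<le> b" "c \<in> {0..2*pi}" by (auto simp: sph_cbox_def)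
    show ?thesis
    proof (cases "b \<le> R")
      case False
      then have "F (sph (a, b, c)) = 0" using densD(3)[OF F] abc by (simp add: norm_sph)
      then show ?thesis using False by simp
    qed (use True abc \<Phi>[of a b c] in simp)
  next
    case False
    then have "a \<notin> {-1..1} \<or> b \<notin> {0..R} \<or> c \<notin> {0..2*pi}" by (auto simp: sph_cbox_def)
    then show ?thesis using False by (elim disjE) simp_all
  qed
  show "pot F (sph (\<zeta>, r, 0)) = (LBINT a:{-1..1}. LBINT b:{0..R}. K r \<zeta> b a * \<Phi> (b, a) * b\<^sup>2)"
    if z: "\<zeta> \<in> {-1..1}" "0 \<le> r"
  proof -
    have inner: "(LBINT c. sph_weight (a, b, c) * (F (sph (a, b, c)) / norm (sph (\<zeta>, r, 0) - sph (a, b, c)))) =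
       indicator {-1..1} a * (indicator {0..R} b * (K r \<zeta> b a * \<Phi> (b, a) * b\<^sup>2))" for a b
    proof (cases "a \<in> {-1..1} \<and> b \<in> {0..R}")
      case True
      then have d: "norm (sph (\<zeta>, r, 0) - sph (a, b, c)) =
          sqrt (r\<^sup>2 + b\<^sup>2 - 2 * r * b * (sqrt (1 - \<zeta>\<^sup>2) * sqrt (1 - a\<^sup>2) * cos c + \<zeta> * a))" for c
        by (intro dist_sph z) auto
      \<comment> \<open>Pulling out the constant factor requires no integrability, so the identity
        also holds at the points where \<open>K\<close> takes a value by convention.\<close>
      have "(LBINT c. indicator {0..2*pi} c * (1 / norm (sph (\<zeta>, r, 0) - sph (a, b, c))) * (\<Phi> (b, a) * b\<^sup>2)) = K r \<zeta> b a * (\<Phi> (b, a) * b\<^sup>2)"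
        unfolding d K_def set_lebesgue_integral_def real_scaleR_def by (rule integral_mult_left_zero)
      then show ?thesis using True unfolding w by (simp add: mult.assoc)
    next
      case False
      then show ?thesis unfolding w by auto
    qed
    show ?thesis unfolding it inner set_lebesgue_integral_def by simp
  qed
  have inner0: "(LBINT c. sph_weight (a, b, c) * (F (sph (a, b, c)) / norm (0 - sph (a, b, c)))) =
      indicator {-1..1} a * (indicator {0..R} b * (2 * pi * (\<Phi> (b, a) * b)))" for a b
  proof (cases "a \<in> {-1..1} \<and> b \<in> {0..R}")
    case True
    have "(LBINT c. indicator {0..2*pi} c * ((1 / b) * (\<Phi> (b, a) * b\<^sup>2))) = 2 * pi * ((1 / b) * (\<Phi> (b, a) * b\<^sup>2))" by simp
    \<comment> \<open>At b = 0 the conventional value 1 / 0 = 0 is harmless, since both sides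
      contain a factor 0.\<close>
    also have "\<dots> = 2 * pi * (\<Phi> (b, a) * b)" by (cases "b = 0") (simp_all add: power2_eq_square)
    finally show ?thesis using True unfolding w by (simp add: norm_sph mult.assoc)
  next
    case False
    then show ?thesis unfolding w by auto
  qed
  show "pot F 0 = 2 * pi * (LBINT a:{-1..1}. LBINT b:{0..R}. \<Phi> (b, a) * b)"
  proof -
    have b: "(LBINT b. indicator {-1..1} a * (indicator {0..R} b * (2 * pi * (\<Phi> (b, a) * b)))) =
        2 * pi * (indicator {-1..1} a * (LBINT b. indicator {0..R} b * (\<Phi> (b, a) * b)))" for a
    proof -
      have "(\<lambda>b. indicator {-1..1} a * (indicator {0..R} b * (2 * pi * (\<Phi> (b, a) * b)))) =
          (\<lambda>b. (2 * pi * indicator {-1..1} a) * (indicator {0..R} b * (\<Phi> (b, a) * b)))" by (simp add: fun_eq_iff)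
      then show ?thesis by (simp only: integral_mult_right_zero mult.assoc)
    qed
    show ?thesis unfolding it inner0 b set_lebesgue_integral_def real_scaleR_def by (rule integral_mult_right_zero)
  qed
qed

theorem theorem1:
  fixes \<nu> \<xi>1 R0 :: real and \<theta> :: "real \<Rightarrow> real"
  assumes "2 \<le> \<nu>" and "\<nu> < 5"
    and "lane_emden \<nu> \<xi>1 \<theta>"
    and "2 * \<xi>1 \<le> R0"
  shows "\<exists>\<epsilon>0>0. \<exists>C>0. \<forall>\<epsilon>. 0 < \<epsilon> \<and> \<epsilon> \<le> \<epsilon>0 \<longrightarrow>
    (\<exists>\<Theta>\<in>E_space R0.
       (\<forall>r\<in>{0..R0}. \<forall>\<zeta>\<in>{-1..1}. \<Theta> (r, \<zeta>) = \<epsilon> * \<gg> (r, \<zeta>) + \<G> \<nu> R0 \<Theta> (r, \<zeta>)) \<and>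
       E_norm R0 (\<lambda>(r, \<zeta>). \<Theta> (r, \<zeta>) - lane_emden_ext \<nu> \<xi>1 \<theta> r) \<le> C * \<epsilon>)"
proof -
  interpret lane_emden_profile \<nu> \<xi>1 \<theta> by standard (use assms in auto)
  have R0: "0 < R0" "\<xi>1 \<le> R0" using xi_pos assms(4) by auto
  obtain e0 C where eC: "0 < e0" "0 < C" "\<And>e. 0 < e \<Longrightarrow> e \<le> e0 \<Longrightarrow>
     \<exists>v. continuous_on UNIV v \<and> sym3 v \<and> (\<forall>x. \<bar>v x\<bar> \<le> C * e) \<and>
     (\<forall>x. lext (norm x) + v x = e * g3 R0 x + 1 + npot (\<lambda>y. indicator (cball 0 R0) y * pos_pow \<nu> (lext (norm y) + v y)) x)"
    using nonlinear_solution[OF R0(2)] by blast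
  have "\<exists>\<Theta>\<in>E_space R0.
       (\<forall>r\<in>{0..R0}. \<forall>\<zeta>\<in>{-1..1}. \<Theta> (r, \<zeta>) = e * \<gg> (r, \<zeta>) + \<G> \<nu> R0 \<Theta> (r, \<zeta>)) \<and>
       E_norm R0 (\<lambda>(r, \<zeta>). \<Theta> (r, \<zeta>) - lext r) \<le> C * e" if e: "0 < e" "e \<le> e0" for e
  proof -
    obtain v where v: "continuous_on UNIV v" "sym3 v" "\<And>x. \<bar>v x\<bar> \<le> C * e"
      and veq: "\<And>x. lext (norm x) + v x = e * g3 R0 x + 1 + npot (\<lambda>y. indicator (cball 0 R0) y * pos_pow \<nu> (lext (norm y) + v y)) x"
      using eC(3)[OF e] by blast
    define U where "U x = lext (norm x) + v x" for x
    have Uc: "continuous_on UNIV U" unfolding U_def[abs_def] by (intro continuous_on_add lext_norm_cont v(1))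
    have Us: "U x = U y" if "norm x = norm y" "\<bar>x $ 3\<bar> = \<bar>y $ 3\<bar>" for x y
      using sym3D[OF v(2) that] that(1) by (simp add: U_def)
    \<comment> \<open>Evaluation at azimuth 0 loses nothing, because U depends only on the norm and
      on the absolute value of the third coordinate.\<close>
    define \<Theta> where "\<Theta> = (\<lambda>(r, \<zeta>). U (sph (\<zeta>, r, 0)))"
    define F where "F y = indicator (cball 0 R0) y * pos_pow \<nu> (U y)" for y
    obtain M where M: "dens R0 M F"
      unfolding F_def[abs_def] using dens_indicator_cont[OF continuous_on_pos_pow[OF nu Uc]] .
    have F\<Phi>: "F (sph (a, b, c)) = max 0 (\<Theta> (b, a)) powr \<nu>" if "a \<in> {-1..1}" "b \<in> {0..R0}" for a b c
    proof -
      have "U (sph (a, b, c)) = U (sph (a, b, 0))" using that by (intro Us) (simp_all add: norm_sph)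
      then show ?thesis using that by (simp add: F_def \<Theta>_def norm_sph)
    qed
    have "\<Theta> \<in> E_space R0"
      unfolding E_space_def mem_Collect_eq
    proof (intro conjI ballI)
      show "continuous_on (rect R0) \<Theta>"
        unfolding \<Theta>_def case_prod_beta
        by (rule continuous_on_compose2[OF Uc continuous_on_compose2[OF continuous_sph]]) (auto intro!: continuous_intros)
      show "\<Theta> (0, \<zeta>) = \<Theta> (0, 0)" if "\<zeta> \<in> {-1..1}" for \<zeta>
        unfolding \<Theta>_def prod.case using that by (intro Us) (simp_all add: norm_sph)
      fix p assume p: "p \<in> rect R0"
      obtain r z where rz: "p = (r, z)" by (cases p)
      then have "r \<in> {0..R0}" "z \<in> {-1..1}" using p by (auto simp: rect_def)
      then show "case p of (r, \<zeta>) \<Rightarrow> \<Theta> (r, \<zeta>) = \<Theta> (r, - \<zeta>)"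
        unfolding rz \<Theta>_def prod.case by (intro Us) (simp_all add: norm_sph abs_mult)
    qed
    moreover have "\<Theta> (r, \<zeta>) = e * \<gg> (r, \<zeta>) + \<G> \<nu> R0 \<Theta> (r, \<zeta>)" if r: "r \<in> {0..R0}" and z: "\<zeta> \<in> {-1..1}" for r \<zeta>
    proof -
      let ?x = "sph (\<zeta>, r, 0)"
      have "\<zeta>\<^sup>2 \<le> 1" using z by (auto simp: abs_square_le_1 abs_le_iff)
      \<comment> \<open>Within radius R0 the squared distance from the axis is at most R0^2, so the
        minimum in \<open>g3\<close> selects it and \<open>\<gg>\<close> is recovered.\<close>
      then have "r\<^sup>2 - (r * \<zeta>)\<^sup>2 \<le> R0\<^sup>2" using r power_mono[of r R0 2] by (smt (verit) atLeastAtMost_iff zero_le_power2)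
      then have "g3 R0 ?x = \<gg> (r, \<zeta>)"
        using r z by (simp add: g3_def \<gg>_def norm_sph min_absorb2) (simp add: power_mult_distrib algebra_simps)
      moreover have "npot F ?x = 1 / (4 * pi) * (LBINT a:{-1..1}. LBINT b:{0..R0}. K r \<zeta> b a * max 0 (\<Theta> (b, a)) powr \<nu> * b\<^sup>2)
         - 1 / 2 * (LBINT a:{-1..1}. LBINT b:{0..R0}. max 0 (\<Theta> (b, a)) powr \<nu> * b)"
        unfolding npot_def
        using pot_axisymmetric(1)[OF M, of "\<lambda>p. max 0 (\<Theta> p) powr \<nu>", OF F\<Phi> z] pot_axisymmetric(2)[OF M, of "\<lambda>p. max 0 (\<Theta> p) powr \<nu>", OF F\<Phi>] r
        by (simp add: diff_divide_distrib)
      moreover have "U ?x = e * g3 R0 ?x + 1 + npot F ?x" unfolding U_def F_def[abs_def] using veq[of ?x] .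
      ultimately show ?thesis by (simp add: \<Theta>_def \<G>_def)
    qed
    moreover have "E_norm R0 (\<lambda>(r, \<zeta>). \<Theta> (r, \<zeta>) - lext r) \<le> C * e"
      unfolding E_norm_def
    proof (rule cSUP_least)
      have "(0, 0) \<in> rect R0" using R0 by (simp add: rect_def)
      then show "rect R0 \<noteq> {}" by blast
      fix p assume p: "p \<in> rect R0"
      obtain r z where rz: "p = (r, z)" by (cases p)
      then have "r \<in> {0..R0}" "z \<in> {-1..1}" using p by (auto simp: rect_def)
      then have "\<Theta> (r, z) - lext r = v (sph (z, r, 0))" by (simp add: \<Theta>_def U_def norm_sph)
      then show "\<bar>case p of (r, \<zeta>) \<Rightarrow> \<Theta> (r, \<zeta>) - lext r\<bar> \<le> C * e" using v(3) rz by simp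
    qed
    ultimately show ?thesis by blast
  qed
  then show ?thesis using eC(1,2) by blast
qed

end
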